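(* Let $3\le N\le 10$ and let $a:[0,1]\to\mathbb{R}$ be such that $x\mapsto a(|x|)$ belongs to $C^2(\overline{B_1})$, $a(r)>0$ on $[0,1]$, and $a(0)=1$. Let $H$ be the first (Dirichlet) eigenvalue of $-\Delta$ in the unit ball of $\mathbb{R}^2$ and let $$a_H(r):=\Bigl(1+\frac{H}{2(N-2)}r^2\Bigr)e^{\frac{H}{2N}r^2}.$$ Then the extremal solution $u^*$ of $$-\Delta u=\lambda a(|x|)e^{u}\ \text{ in } B_1,\qquad u>0\ \text{ in } B_1,\qquad u=0\ \text{ on }\partial B_1 \tag{P}$$ is: (i) bounded if $N\le 9$; (ii) singular (i.e. $u^*\notin L^\infty(B_1)$) if $(a/a_H)'\le0$ in $(0,1]$ and $N=10$; (iii) bounded if $(a/a_H)'>0$ in $(0,1]$ and $N=10$.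
   Context: $B_1\subset\mathbb{R}^N$ is the open unit ball. There exists $\lambda^*\in(0,\infty)$ (well-known) such that: for $0<\lambda<\lambda^*$ problem (P) has a minimal classical solution $u_\lambda\in C^2(\overline{B_1})$, which is radially symmetric and satisfies $u_\lambda<u_{\lambda'}$ in $B_1$ for $\lambda<\lambda'$; for $\lambda>\lambda^*$ problem (P) has no weak solution. The extremal solution is $u^*:=\lim_{\lambda\uparrow\lambda^*}u_\lambda$; it is a weak solution of (P) for $\lambda=\lambda^*$, where a weak solution for a given $\lambda$ is $u\in L^1(B_1)$ with $a(|x|)e^{u}\,\mathrm{dist}(\cdot,\partial B_1)\in L^1(B_1)$ and $-\int_{B_1}u\,\Delta\xi\,dx=\int_{B_1}\lambda a(|x|)e^{u}\xi\,dx$ for all $\xi\in C^2(\overline{B_1})$ vanishing on $\partial B_1$. *)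

theory Defs
  imports "HOL-Analysis.Analysis"
begin

definition C2_on :: "'a::euclidean_space set \<Rightarrow> ('a \<Rightarrow> real) \<Rightarrow> bool" where
  "C2_on S u \<longleftrightarrow>
    (\<exists>(Du :: 'a \<Rightarrow> 'a \<Rightarrow>\<^sub>L real) (D2u :: 'a \<Rightarrow> 'a \<Rightarrow>\<^sub>L ('a \<Rightarrow>\<^sub>L real)).
      (\<forall>x\<in>S. (u has_derivative blinfun_apply (Du x)) (at x)) \<and>
      (\<forall>x\<in>S. (Du has_derivative blinfun_apply (D2u x)) (at x)) \<and>
      continuous_on S D2u)"

text \<open>
  For open \<open>S\<close>, the next predicate is \<open>u \<in> C\<^sup>2(closure S)\<close>: the function and its derivatives of order
  at most two, taken in \<open>S\<close>, extend continuously to \<open>closure S\<close>, and \<open>u\<close> agrees with its extension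
  there. Values of \<open>u\<close> outside \<open>closure S\<close> are irrelevant.
\<close>

definition C2_closure :: "'a::euclidean_space set \<Rightarrow> ('a \<Rightarrow> real) \<Rightarrow> bool" where
  "C2_closure S u \<longleftrightarrow>
    (\<exists>(Du :: 'a \<Rightarrow> 'a \<Rightarrow>\<^sub>L real) (D2u :: 'a \<Rightarrow> 'a \<Rightarrow>\<^sub>L ('a \<Rightarrow>\<^sub>L real)).
      (\<forall>x\<in>S. (u has_derivative blinfun_apply (Du x)) (at x)) \<and>
      (\<forall>x\<in>S. (Du has_derivative blinfun_apply (D2u x)) (at x)) \<and>
      continuous_on (closure S) u \<and>
      continuous_on (closure S) Du \<and>
      continuous_on (closure S) D2u)"

definition laplacian :: "('a::euclidean_space \<Rightarrow> real) \<Rightarrow> 'a \<Rightarrow> real" where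
  "laplacian u x = (\<Sum>b\<in>Basis. (deriv ^^ 2) (\<lambda>t. u (x + t *\<^sub>R b)) 0)"

definition dirichlet_eigenvalue :: "'a::euclidean_space set \<Rightarrow> real \<Rightarrow> bool" where
  "dirichlet_eigenvalue S \<mu> \<longleftrightarrow>
    (\<exists>\<phi>. C2_on S \<phi> \<and> continuous_on (closure S) \<phi> \<and>
      (\<forall>x\<in>S. - laplacian \<phi> x = \<mu> * \<phi> x) \<and>
      (\<forall>x\<in>frontier S. \<phi> x = 0) \<and>
      (\<exists>x\<in>S. \<phi> x \<noteq> 0))"

definition first_dirichlet_eigenvalue :: "'a::euclidean_space set \<Rightarrow> real \<Rightarrow> bool" where
  "first_dirichlet_eigenvalue S H \<longleftrightarrow>
    dirichlet_eigenvalue S H \<and> (\<forall>\<mu>. dirichlet_eigenvalue S \<mu> \<longrightarrow> H \<le> \<mu>)"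

definition a_H :: "real \<Rightarrow> nat \<Rightarrow> real \<Rightarrow> real" where
  "a_H H N r = (1 + H / (2 * (real N - 2)) * r\<^sup>2) * exp (H / (2 * real N) * r\<^sup>2)"

definition classical_solution ::
    "(real \<Rightarrow> real) \<Rightarrow> real \<Rightarrow> ('a::euclidean_space \<Rightarrow> real) \<Rightarrow> bool" where
  "classical_solution a l u \<longleftrightarrow>
    C2_closure (ball 0 1) u \<and>
    (\<forall>x\<in>ball 0 1. - laplacian u x = l * a (norm x) * exp (u x)) \<and>
    (\<forall>x\<in>ball 0 1. u x > 0) \<and>
    (\<forall>x\<in>sphere 0 1. u x = 0)"

definition minimal_classical_solution ::
    "(real \<Rightarrow> real) \<Rightarrow> real \<Rightarrow> ('a::euclidean_space \<Rightarrow> real) \<Rightarrow> bool" where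
  "minimal_classical_solution a l u \<longleftrightarrow>
    classical_solution a l u \<and>
    (\<forall>v. classical_solution a l v \<longrightarrow> (\<forall>x\<in>ball 0 1. u x \<le> v x))"

definition weak_solution ::
    "(real \<Rightarrow> real) \<Rightarrow> real \<Rightarrow> ('a::euclidean_space \<Rightarrow> real) \<Rightarrow> bool" where
  "weak_solution a l u \<longleftrightarrow>
    integrable (lebesgue_on (ball 0 1)) u \<and>
    integrable (lebesgue_on (ball 0 1))
      (\<lambda>x. a (norm x) * exp (u x) * infdist x (sphere 0 1)) \<and>
    (\<forall>\<xi>. C2_closure (ball 0 1) \<xi> \<and> (\<forall>x\<in>sphere 0 1. \<xi> x = 0) \<longrightarrow>
      - (\<integral>x. u x * laplacian \<xi> x \<partial>lebesgue_on (ball 0 1))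
      = (\<integral>x. l * a (norm x) * exp (u x) * \<xi> x \<partial>lebesgue_on (ball 0 1)))"

definition radial_on :: "'a::euclidean_space set \<Rightarrow> ('a \<Rightarrow> real) \<Rightarrow> bool" where
  "radial_on S u \<longleftrightarrow> (\<forall>x\<in>S. \<forall>y\<in>S. norm x = norm y \<longrightarrow> u x = u y)"

text \<open>
  The threshold \<open>ls\<close> is determined uniquely by the existence of classical solutions below it and the
  absence of weak solutions above it, and \<open>u l\<close> is determined on the closed ball by minimality.
\<close>

definition extremal_branch ::
    "(real \<Rightarrow> real) \<Rightarrow> real \<Rightarrow> (real \<Rightarrow> 'a::euclidean_space \<Rightarrow> real) \<Rightarrow> bool" where
  "extremal_branch a ls u \<longleftrightarrow>
    0 < ls \<and>
    (\<forall>l\<in>{0<..<ls}. minimal_classical_solution a l (u l) \<and> radial_on (ball 0 1) (u l)) \<and>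
    (\<forall>l\<in>{0<..<ls}. \<forall>l'\<in>{0<..<ls}. l < l' \<longrightarrow> (\<forall>x\<in>ball 0 1. u l x < u l' x)) \<and>
    (\<forall>l>ls. \<nexists>v::'a \<Rightarrow> real. weak_solution a l v)"

text \<open>
  The limit is taken almost everywhere because the increasing limit of \<open>u l x\<close> is infinite at the
  origin when the extremal solution is singular.
\<close>

definition extremal_solution ::
    "real \<Rightarrow> (real \<Rightarrow> 'a::euclidean_space \<Rightarrow> real) \<Rightarrow> ('a \<Rightarrow> real) \<Rightarrow> bool" where
  "extremal_solution ls u us \<longleftrightarrow>
    (AE x in lebesgue_on (ball 0 1). ((\<lambda>l. u l x) \<longlongrightarrow> us x) (at_left ls))"

definition L_infty_on :: "'a::euclidean_space set \<Rightarrow> ('a \<Rightarrow> real) \<Rightarrow> bool" where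
  "L_infty_on S u \<longleftrightarrow>
    u \<in> borel_measurable (lebesgue_on S) \<and> (\<exists>C. AE x in lebesgue_on S. \<bar>u x\<bar> \<le> C)"

end

theory Submission
  imports Defs
begin

text \<open>
  All functions involved are radial, so the proof is carried out for ordinary differential equations.
  For \<open>l < m\<close> the difference \<open>w = u m - u l\<close> is a positive supersolution of the equation linearised
  at \<open>u l\<close>; this is the only form in which stability is used. In dimension at most nine, \<open>w\<close> serves
  as the Picone multiplier in the Crandall--Rabinowitz estimate, which bounds \<open>u l 0\<close> uniformly in \<open>l\<close>.

  In dimension ten put \<open>V = 16 / r\<^sup>2 + H\<close>, the potential of the improved Hardy inequality, whose
  ground state is \<open>r powr -4 * J\<^sub>0 (sqrt H r)\<close>, and \<open>z = u + 2 ln r + H r\<^sup>2 / 20\<close>. Then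
  \<open>- \<Delta> z = Q - V\<close> and \<open>Q = V * exp (\<beta> + z)\<close> for \<open>Q = l a exp u\<close> and \<open>\<beta> = ln (l / 16 * a / a_H)\<close>, so
  the monotonicity of \<open>a / a_H\<close> decides how \<open>Q\<close> compares with \<open>V\<close>. If \<open>a / a_H\<close> is nonincreasing,
  every shooting solution satisfies \<open>Q < V\<close>; hence these solutions are ordered by their value at the
  origin, and a bounded extremal solution could be continued past \<open>lambda_star\<close>. If \<open>a / a_H\<close> is
  increasing, stability forces \<open>{r. Q r < V r}\<close> to be an initial interval whose length is bounded
  below as \<open>l\<close> tends to \<open>lambda_star\<close>, and \<open>Q \<le> V\<close> near the origin bounds \<open>u l 0\<close>.
\<close>

section \<open>Reduction to the radial variable\<close>

text \<open>Dimension ten is critical because two constants coincide there: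
  \<open>- \<Delta>\<close> of \<open>- 2 ln r\<close> is 2 (N - 2) / r^2, the Hardy constant is (N
  - 2)^2 / 4, and both equal 16. The eigenvalue of a planar disc enters because conjugation by
  \<open>r powr -4\<close> turns the ten-dimensional radial Laplacian plus 16 / r^2 into the
  two-dimensional one. As H is given abstractly as a least eigenvalue, it has to be identified with
  the first zero of the Bessel series.

  Neither spectral theory nor an implicit function theorem is used: comparisons are monotonicity
  statements for fluxes and Wronskians, so boundary behaviour enters only through one-sided limits.
  The parameter is absorbed by the shift u + ln l; a solution of
  \<open>- \<Delta> v = a exp v\<close> with any boundary value then represents the parameter exp (v
  1). Continuation past the threshold thus reduces to shooting from a higher value at the origin and
  checking that the result is a weak solution with a larger parameter.\<close>

lemma C2_closure_line_derivs:
  fixes u :: "'a::euclidean_space \<Rightarrow> real"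
  assumes Du: "\<forall>x\<in>S. (u has_derivative blinfun_apply (Du x)) (at x)"
    and D2u: "\<forall>x\<in>S. (Du has_derivative blinfun_apply (D2u x)) (at x)"
    and x: "x + t *\<^sub>R b \<in> S"
  shows "((\<lambda>t. u (x + t *\<^sub>R b)) has_real_derivative Du (x + t *\<^sub>R b) b) (at t)"
    and "((\<lambda>t. Du (x + t *\<^sub>R b) b) has_real_derivative D2u (x + t *\<^sub>R b) b b) (at t)"
proof -
  have l: "((\<lambda>t. x + t *\<^sub>R b) has_derivative (\<lambda>h. h *\<^sub>R b)) (at t)"
    by (auto intro!: derivative_eq_intros)
  have "((\<lambda>t. u (x + t *\<^sub>R b)) has_derivative (\<lambda>h. Du (x + t *\<^sub>R b) (h *\<^sub>R b))) (at t)"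
    using has_derivative_compose[OF l bspec[OF Du x]] .
  then show "((\<lambda>t. u (x + t *\<^sub>R b)) has_real_derivative Du (x + t *\<^sub>R b) b) (at t)"
    by (simp add: has_field_derivative_def blinfun.scaleR_right mult_commute_abs)
  have "((\<lambda>t. Du (x + t *\<^sub>R b)) has_derivative (\<lambda>h. D2u (x + t *\<^sub>R b) (h *\<^sub>R b))) (at t)"
    using has_derivative_compose[OF l bspec[OF D2u x]] .
  then have "((\<lambda>t. Du (x + t *\<^sub>R b) b) has_derivative (\<lambda>h. D2u (x + t *\<^sub>R b) (h *\<^sub>R b) b)) (at t)"
    by (rule bounded_linear.has_derivative[OF blinfun.bounded_linear_left])
  then show "((\<lambda>t. Du (x + t *\<^sub>R b) b) has_real_derivative D2u (x + t *\<^sub>R b) b b) (at t)"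
    by (simp add: has_field_derivative_def blinfun.scaleR_right blinfun.scaleR_left mult_commute_abs)
qed

lemma eventually_line_in_open:
  fixes x :: "'a::real_normed_vector"
  assumes "open S" "x \<in> S"
  shows "\<forall>\<^sub>F t in nhds 0. x + t *\<^sub>R b \<in> S"
proof -
  have "((\<lambda>t::real. x + t *\<^sub>R b) \<longlongrightarrow> x + 0 *\<^sub>R b) (nhds 0)"
    by (intro tendsto_intros filterlim_ident)
  then show ?thesis using assms by (auto dest!: topological_tendstoD)
qed

lemma second_deriv_eqI:
  fixes f :: "real \<Rightarrow> real"
  assumes "\<forall>\<^sub>F t in nhds 0. (f has_real_derivative f' t) (at t)"
    and "(f' has_real_derivative d) (at 0)"
  shows "(deriv ^^ 2) f 0 = d"
proof -
  have "\<forall>\<^sub>F t in nhds 0. deriv f t = f' t"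
    using assms(1) by eventually_elim (rule DERIV_imp_deriv)
  then have "(deriv f has_real_derivative d) (at 0)"
    using assms(2) by (subst DERIV_cong_ev[OF refl _ refl]) auto
  then show ?thesis by (simp add: numeral_2_eq_2 DERIV_imp_deriv)
qed

lemma laplacian_eq:
  fixes u :: "'a::euclidean_space \<Rightarrow> real"
  assumes "open S" "x \<in> S"
    and Du: "\<forall>x\<in>S. (u has_derivative blinfun_apply (Du x)) (at x)"
    and D2u: "\<forall>x\<in>S. (Du has_derivative blinfun_apply (D2u x)) (at x)"
  shows "laplacian u x = (\<Sum>b\<in>Basis. D2u x b b)"
  unfolding laplacian_def
proof (rule sum.cong[OF refl])
  fix b :: 'a assume "b \<in> Basis"
  show "(deriv ^^ 2) (\<lambda>t. u (x + t *\<^sub>R b)) 0 = D2u x b b"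
  proof (rule second_deriv_eqI)
    show "\<forall>\<^sub>F t in nhds 0. ((\<lambda>t. u (x + t *\<^sub>R b)) has_real_derivative Du (x + t *\<^sub>R b) b) (at t)"
      using eventually_line_in_open[OF assms(1,2), of b]
      by eventually_elim (rule C2_closure_line_derivs(1)[OF Du D2u])
    show "((\<lambda>t. Du (x + t *\<^sub>R b) b) has_real_derivative D2u x b b) (at 0)"
      using C2_closure_line_derivs(2)[OF Du D2u, of x 0 b] assms(2) by simp
  qed
qed

text \<open>The radial form of \<open>- \<Delta> v = h\<close>, required on the open interval only.
  Boundedness of \<open>v'\<close> stands in for \<open>v' 0 = 0\<close>: it makes boundary terms
  such as \<open>r ^ n * v' r\<close> vanish at the origin, and it passes to differences of
  solutions.\<close>

definition radial_ode ::
    "nat \<Rightarrow> (real \<Rightarrow> real) \<Rightarrow> (real \<Rightarrow> real) \<Rightarrow> (real \<Rightarrow> real) \<Rightarrow> bool" where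
  "radial_ode N v v' h \<longleftrightarrow>
    continuous_on {0..1} v \<and> (\<exists>M. \<forall>r\<in>{0<..<1}. \<bar>v' r\<bar> \<le> M) \<and>
    (\<forall>r\<in>{0<..<1}. (v has_real_derivative v' r) (at r) \<and>
      (v' has_real_derivative - h r - (real N - 1) / r * v' r) (at r))"

text \<open>Radial symmetry evaluates the Hessian on a ray: across the ray the function is
  \<open>u (sqrt (r\<^sup>2 + t\<^sup>2) *\<^sub>R e)\<close>, which contributes
  \<open>v' r / r\<close> for each of the N - 1 directions orthogonal to \<open>e\<close>.\<close>

lemma radial_reduction:
  fixes u :: "'a::euclidean_space \<Rightarrow> real"
  assumes C2: "C2_closure (ball 0 1) u" and rad: "radial_on (ball 0 1) u" and e: "e \<in> Basis"
  shows "\<exists>v'. radial_ode DIM('a) (\<lambda>r. u (r *\<^sub>R e)) v' (\<lambda>r. - laplacian u (r *\<^sub>R e))"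
proof -
  obtain Du D2u where Du: "\<forall>x\<in>ball 0 1. (u has_derivative blinfun_apply (Du x)) (at x)"
    and D2u: "\<forall>x\<in>ball 0 1. (Du has_derivative blinfun_apply (D2u x)) (at x)"
    and cu: "continuous_on (cball 0 1) u" and cDu: "continuous_on (cball 0 1) Du"
    using C2 unfolding C2_closure_def closure_ball[OF zero_less_one] by blast
  have ne: "norm e = 1" using e by simp
  define v' where "v' r = Du (r *\<^sub>R e) e" for r
  note lines = C2_closure_line_derivs[OF Du D2u]
  have inb: "r *\<^sub>R e \<in> ball 0 1" if "\<bar>r\<bar> < 1" for r using that ne by simp
  have d1: "((\<lambda>r. u (r *\<^sub>R e)) has_real_derivative v' r) (at r)" if "\<bar>r\<bar> < 1" for r
    using lines(1)[of 0 r e] inb[OF that] by (simp add: v'_def)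
  have d2: "(v' has_real_derivative D2u (r *\<^sub>R e) e e) (at r)" if "\<bar>r\<bar> < 1" for r
    using lines(2)[of 0 r e] inb[OF that] by (simp add: v'_def[abs_def])
  have tang: "D2u (r *\<^sub>R e) b b = v' r / r" if r: "r \<in> {0<..<1}" and b: "b \<in> Basis - {e}" for r b
  proof -
    let ?s = "\<lambda>t. sqrt (r\<^sup>2 + t\<^sup>2)"
    have nrm: "norm (r *\<^sub>R e + t *\<^sub>R b) = ?s t" for t
    proof -
      have "e \<bullet> b = 0" "e \<bullet> e = 1" "b \<bullet> b = 1" using b e by (auto simp: inner_Basis)
      then show ?thesis
        by (simp add: norm_eq_sqrt_inner inner_add_left inner_add_right inner_commute power2_eq_square)
    qed
    have rin: "r *\<^sub>R e \<in> ball 0 1" using inb[of r] r by auto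
    have ev: "\<forall>\<^sub>F t in nhds 0. r *\<^sub>R e + t *\<^sub>R b \<in> ball 0 1"
      by (rule eventually_line_in_open) (use rin in auto)
    have eq1: "Du (r *\<^sub>R e + t *\<^sub>R b) b = v' (?s t) * (t / ?s t)" if t: "r *\<^sub>R e + t *\<^sub>R b \<in> ball 0 1" for t
    proof -
      have s1: "?s t < 1" using t nrm by simp
      have pos: "r\<^sup>2 + t\<^sup>2 > 0" using r by (simp add: add_pos_nonneg)
      have "((\<lambda>t. u (?s t *\<^sub>R e)) has_real_derivative v' (?s t) * (t / ?s t)) (at t)"
      proof (rule DERIV_chain2[where f="\<lambda>r. u (r *\<^sub>R e)"])
        show "((\<lambda>r. u (r *\<^sub>R e)) has_real_derivative v' (?s t)) (at (?s t))"
          by (rule d1) (use s1 pos in auto)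
        show "(?s has_real_derivative t / ?s t) (at t)"
          using pos by (auto intro!: derivative_eq_intros simp: field_simps)
      qed
      moreover have "\<forall>\<^sub>F \<tau> in nhds t. u (r *\<^sub>R e + \<tau> *\<^sub>R b) = u (?s \<tau> *\<^sub>R e)"
      proof -
        have "\<forall>\<^sub>F \<tau> in nhds t. ?s \<tau> < 1"
          by (rule order_tendstoD(2)[OF _ s1]) (intro tendsto_intros filterlim_ident)
        then show ?thesis
        proof eventually_elim
          case (elim \<tau>)
          then have "?s \<tau> *\<^sub>R e \<in> ball 0 1" using inb[of "?s \<tau>"] by simp
          then show ?case
            using rad[unfolded radial_on_def, rule_format, of "r *\<^sub>R e + \<tau> *\<^sub>R b" "?s \<tau> *\<^sub>R e"]
              elim nrm[of \<tau>] ne by simp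
        qed
      qed
      ultimately have "((\<lambda>t. u (r *\<^sub>R e + t *\<^sub>R b)) has_real_derivative v' (?s t) * (t / ?s t)) (at t)"
        by (subst DERIV_cong_ev[OF refl _ refl])
      then show ?thesis using lines(1)[OF t] DERIV_unique by blast
    qed
    have lim: "((\<lambda>t. v' (?s t) / ?s t) \<longlongrightarrow> v' r / r) (at 0)"
    proof -
      have "((\<lambda>t. ?s t) \<longlongrightarrow> r) (at 0)"
        using r by (auto intro!: tendsto_eq_intros)
      moreover have "isCont v' r" using d2[of r] r DERIV_isCont by auto
      ultimately show ?thesis
        using r by (intro tendsto_divide isCont_tendsto_compose[of r v']) auto
    qed
    have "((\<lambda>t. Du (r *\<^sub>R e + t *\<^sub>R b) b) has_real_derivative D2u (r *\<^sub>R e) b b) (at 0)"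
      using lines(2)[of "r *\<^sub>R e" 0 b] rin by simp
    \<comment> \<open>By \<open>eq1\<close> at t = 0 the first derivative across the ray vanishes,
      so the difference quotient loses its subtracted term.\<close>
    then have A: "((\<lambda>t. Du (r *\<^sub>R e + t *\<^sub>R b) b / t) \<longlongrightarrow> D2u (r *\<^sub>R e) b b) (at 0)"
      using eq1[of 0] rin by (simp add: has_field_derivative_iff)
    have "\<forall>\<^sub>F t in at 0. Du (r *\<^sub>R e + t *\<^sub>R b) b / t = v' (?s t) / ?s t"
      using ev unfolding eventually_nhds_conv_at
      by (auto elim!: eventually_mono[OF eventually_conj[OF _ eventually_neq_at_within[of 0]]] simp: eq1)
    then have "((\<lambda>t. v' (?s t) / ?s t) \<longlongrightarrow> D2u (r *\<^sub>R e) b b) (at 0)"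
      using A by (rule Lim_transform_eventually[rotated])
    then show ?thesis using lim tendsto_unique[of "at (0::real)"] by auto
  qed
  have lap: "D2u (r *\<^sub>R e) e e = laplacian u (r *\<^sub>R e) - (real DIM('a) - 1) / r * v' r"
    if r: "r \<in> {0<..<1}" for r
  proof -
    have "laplacian u (r *\<^sub>R e) = (\<Sum>b\<in>Basis. D2u (r *\<^sub>R e) b b)"
      by (rule laplacian_eq[OF _ _ Du D2u]) (use inb[of r] r in auto)
    also have "\<dots> = D2u (r *\<^sub>R e) e e + (\<Sum>b\<in>Basis - {e}. D2u (r *\<^sub>R e) b b)"
      using e by (simp add: sum.remove)
    also have "(\<Sum>b\<in>Basis - {e}. D2u (r *\<^sub>R e) b b) = (\<Sum>b\<in>Basis - {e}. v' r / r)"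
      by (intro sum.cong refl tang r)
    also have "\<dots> = (real DIM('a) - 1) / r * v' r"
      using e by (simp add: card_Diff_singleton of_nat_diff Suc_leI DIM_positive)
    finally show ?thesis by simp
  qed
  have "continuous_on {0..1} (\<lambda>r. u (r *\<^sub>R e))"
    by (rule continuous_on_compose2[OF cu]) (auto intro!: continuous_intros simp: ne)
  moreover have "\<exists>M. \<forall>r\<in>{0<..<1}. \<bar>v' r\<bar> \<le> M"
  proof -
    have "continuous_on {0..1} v'"
      unfolding v'_def
      by (intro continuous_intros continuous_on_compose2[OF cDu]) (auto simp: ne)
    then have "bounded (v' ` {0..1})" by (intro compact_imp_bounded compact_continuous_image) auto
    then obtain M where "\<forall>r\<in>{0..1}. \<bar>v' r\<bar> \<le> M" by (auto simp: bounded_iff)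
    then show ?thesis by (intro exI[of _ M]) auto
  qed
  moreover have "((\<lambda>r. u (r *\<^sub>R e)) has_real_derivative v' r) (at r) \<and>
      (v' has_real_derivative - (- laplacian u (r *\<^sub>R e)) - (real DIM('a) - 1) / r * v' r) (at r)"
    if "r \<in> {0<..<1}" for r
    using d1[of r] d2[of r] lap[OF that] that by simp
  ultimately show ?thesis
    unfolding radial_ode_def by (intro exI[of _ v'] conjI) blast+
qed

section \<open>The first Dirichlet eigenvalue of the disc\<close>

definition bessel_coeff :: "nat \<Rightarrow> real" where
  "bessel_coeff n = (- 1 / 4) ^ n / (fact n)\<^sup>2"

text \<open>\<open>bessel_fn x\<close> is the Bessel function \<open>J\<^sub>0\<close> at \<open>sqrt x\<close>, hence entire in \<open>x\<close>.\<close>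

definition bessel_fn :: "real \<Rightarrow> real" where
  "bessel_fn x = (\<Sum>n. bessel_coeff n * x ^ n)"

definition bessel_fn1 :: "real \<Rightarrow> real" where
  "bessel_fn1 x = (\<Sum>n. diffs bessel_coeff n * x ^ n)"

definition bessel_fn2 :: "real \<Rightarrow> real" where
  "bessel_fn2 x = (\<Sum>n. diffs (diffs bessel_coeff) n * x ^ n)"

lemma summable_bessel: "summable (\<lambda>n. bessel_coeff n * x ^ n)"
proof (rule summable_comparison_test')
  show "summable (\<lambda>n. \<bar>x / 4\<bar> ^ n / fact n)"
    using summable_exp[of "\<bar>x / 4\<bar>"] by (simp add: field_simps)
  fix n :: nat
  have "\<bar>x / 4\<bar> ^ n / (fact n)\<^sup>2 \<le> \<bar>x / 4\<bar> ^ n / fact n"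
    by (intro divide_left_mono) (auto simp: power2_eq_square)
  then show "norm (bessel_coeff n * x ^ n) \<le> \<bar>x / 4\<bar> ^ n / fact n"
    by (simp add: bessel_coeff_def abs_mult power_abs power_divide field_simps)
qed

lemma bessel_fn_deriv: "(bessel_fn has_real_derivative bessel_fn1 x) (at x)"
  unfolding bessel_fn_def[abs_def] bessel_fn1_def
  by (rule termdiffs_strong_converges_everywhere) (rule summable_bessel)

lemma bessel_fn1_deriv: "(bessel_fn1 has_real_derivative bessel_fn2 x) (at x)"
  unfolding bessel_fn1_def[abs_def] bessel_fn2_def
  by (rule termdiffs_strong_converges_everywhere) (intro termdiff_converges_all summable_bessel)

lemma bessel_fn2_cont: "continuous_on S bessel_fn2"
proof -
  have "(bessel_fn2 has_real_derivative (\<Sum>n. diffs (diffs (diffs bessel_coeff)) n * x ^ n)) (at x)" for x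
    unfolding bessel_fn2_def[abs_def]
    by (rule termdiffs_strong_converges_everywhere) (intro termdiff_converges_all summable_bessel)
  then show ?thesis by (meson DERIV_isCont continuous_at_imp_continuous_on)
qed

lemma bessel_fn_cont: "continuous_on S bessel_fn"
  using bessel_fn_deriv by (meson DERIV_isCont continuous_at_imp_continuous_on)

lemma bessel_fn1_cont: "continuous_on S bessel_fn1"
  using bessel_fn1_deriv by (meson DERIV_isCont continuous_at_imp_continuous_on)

lemma bessel_coeff_Suc: "(real n + 1)\<^sup>2 * bessel_coeff (Suc n) = - bessel_coeff n / 4"
proof -
  have "real n + 1 \<noteq> 0" by linarith
  then show ?thesis
    unfolding bessel_coeff_def fact_Suc of_nat_Suc power_mult_distrib power_Suc
    by (simp add: divide_simps)
qed

text \<open>Bessel's equation of order zero after the substitution x = s^2; coefficientwise it is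
  the recurrence \<open>bessel_coeff_Suc\<close>.\<close>

lemma bessel_fn_ode: "x * bessel_fn2 x + bessel_fn1 x + bessel_fn x / 4 = 0"
proof -
  let ?d = "diffs bessel_coeff"
  have s2: "(\<lambda>n. diffs ?d n * x ^ n) sums bessel_fn2 x"
    unfolding bessel_fn2_def by (intro summable_sums termdiff_converges_all summable_bessel)
  have s1: "(\<lambda>n. ?d n * x ^ n) sums bessel_fn1 x"
    unfolding bessel_fn1_def by (intro summable_sums termdiff_converges_all summable_bessel)
  have s0: "(\<lambda>n. bessel_coeff n * x ^ n) sums bessel_fn x"
    unfolding bessel_fn_def by (intro summable_sums summable_bessel)
  have "(\<lambda>n. real n * ?d n * x ^ n) sums (x * bessel_fn2 x + real 0 * ?d 0 * x ^ 0)"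
  proof (rule sums_Suc)
    show "(\<lambda>n. real (Suc n) * ?d (Suc n) * x ^ Suc n) sums (x * bessel_fn2 x)"
      using sums_mult[OF s2, of x] by (simp add: diffs_def mult_ac)
  qed
  then have s2': "(\<lambda>n. real n * ?d n * x ^ n) sums (x * bessel_fn2 x)" by simp
  have "real n * ?d n * x ^ n + ?d n * x ^ n + bessel_coeff n * x ^ n / 4 = 0" for n
  proof -
    have "real n * ?d n + ?d n + bessel_coeff n / 4 = 0"
      using bessel_coeff_Suc[of n] by (simp add: diffs_def power2_eq_square algebra_simps)
    then have "(real n * ?d n + ?d n + bessel_coeff n / 4) * x ^ n = 0" by simp
    then show ?thesis by (simp add: algebra_simps)
  qed
  then have "(\<lambda>n. real n * ?d n * x ^ n + ?d n * x ^ n + bessel_coeff n * x ^ n / 4) sums 0"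
    by simp
  moreover have "(\<lambda>n. real n * ?d n * x ^ n + ?d n * x ^ n + bessel_coeff n * x ^ n / 4)
      sums (x * bessel_fn2 x + bessel_fn1 x + bessel_fn x / 4)"
    by (intro sums_add sums_divide s2' s1 s0)
  ultimately show ?thesis using sums_unique2 by blast
qed

lemma bessel_fn_0 [simp]: "bessel_fn 0 = 1"
  unfolding bessel_fn_def by (subst powser_zero) (simp add: bessel_coeff_def)

text \<open>For m \<ge> 0 this is J_0 of \<open>sqrt m * norm x\<close>, written through
  \<open>x \<bullet> x\<close> so that it is visibly smooth at the origin.\<close>

definition radial_bessel :: "real \<Rightarrow> 'a::euclidean_space \<Rightarrow> real" where
  "radial_bessel m x = bessel_fn (m * (x \<bullet> x))"

definition radial_bessel_D :: "real \<Rightarrow> 'a::euclidean_space \<Rightarrow> 'a \<Rightarrow>\<^sub>L real" where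
  "radial_bessel_D m x = (2 * m * bessel_fn1 (m * (x \<bullet> x))) *\<^sub>R blinfun_inner_right x"

definition radial_bessel_D2 :: "real \<Rightarrow> 'a::euclidean_space \<Rightarrow> 'a \<Rightarrow>\<^sub>L ('a \<Rightarrow>\<^sub>L real)" where
  "radial_bessel_D2 m x = Blinfun (\<lambda>h.
     (4 * m\<^sup>2 * bessel_fn2 (m * (x \<bullet> x)) * (x \<bullet> h)) *\<^sub>R blinfun_inner_right x +
     (2 * m * bessel_fn1 (m * (x \<bullet> x))) *\<^sub>R blinfun_inner_right h)"

lemma radial_bessel_D2_apply:
  "blinfun_apply (radial_bessel_D2 m x) h =
     (4 * m\<^sup>2 * bessel_fn2 (m * (x \<bullet> x)) * (x \<bullet> h)) *\<^sub>R blinfun_inner_right x +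
     (2 * m * bessel_fn1 (m * (x \<bullet> x))) *\<^sub>R blinfun_inner_right h"
  unfolding radial_bessel_D2_def
  by (subst bounded_linear_Blinfun_apply) (auto intro!: bounded_linear_intros)

lemma radial_bessel_deriv:
  "(radial_bessel m has_derivative blinfun_apply (radial_bessel_D m x)) (at x)"
  unfolding radial_bessel_def[abs_def] radial_bessel_D_def
proof (rule has_derivative_eq_rhs[OF DERIV_compose_FDERIV[OF bessel_fn_deriv]])
  show "((\<lambda>x. m * (x \<bullet> x)) has_derivative (\<lambda>h. m * (2 * (x \<bullet> h)))) (at x)"
    by (auto intro!: derivative_eq_intros simp: inner_commute)
qed (auto simp: fun_eq_iff blinfun.scaleR_left)

lemma radial_bessel_D_deriv:
  "(radial_bessel_D m has_derivative blinfun_apply (radial_bessel_D2 m x)) (at x)"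
  unfolding radial_bessel_D_def[abs_def]
proof (rule has_derivative_eq_rhs[OF has_derivative_scaleR])
  show "((\<lambda>x. 2 * m * bessel_fn1 (m * (x \<bullet> x))) has_derivative
      (\<lambda>h. 2 * m * (bessel_fn2 (m * (x \<bullet> x)) * (m * (2 * (x \<bullet> h)))))) (at x)"
    by (auto intro!: derivative_eq_intros DERIV_compose_FDERIV[OF bessel_fn1_deriv]
        simp: inner_commute algebra_simps)
  show "(blinfun_inner_right has_derivative blinfun_inner_right) (at x)"
    by (rule bounded_linear_imp_has_derivative[OF bounded_linear_blinfun_inner_right])
qed (auto simp: fun_eq_iff radial_bessel_D2_apply power2_eq_square algebra_simps)

lemma radial_bessel_derivs:
  "\<forall>x\<in>S. (radial_bessel m has_derivative blinfun_apply (radial_bessel_D m x)) (at x)"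
  "\<forall>x\<in>S. (radial_bessel_D m has_derivative blinfun_apply (radial_bessel_D2 m x)) (at x)"
  using radial_bessel_deriv radial_bessel_D_deriv by blast+

lemma radial_bessel_D2_cont: "continuous_on S (radial_bessel_D2 m)"
  by (rule continuous_on_blinfun_componentwise)
     (auto simp: radial_bessel_D2_apply intro!: continuous_intros
        continuous_on_compose2[OF bessel_fn1_cont[of UNIV]] continuous_on_compose2[OF bessel_fn2_cont[of UNIV]]
        bounded_linear.continuous_on[OF bounded_linear_blinfun_inner_right])

lemma radial_bessel_laplacian:
  "- laplacian (radial_bessel m) x = m * radial_bessel m (x :: real ^ 2)"
proof -
  let ?s = "x \<bullet> x"
  have "laplacian (radial_bessel m) x = (\<Sum>b\<in>Basis. radial_bessel_D2 m x b b)"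
    by (rule laplacian_eq[OF open_UNIV UNIV_I]) (auto intro: radial_bessel_deriv radial_bessel_D_deriv)
  also have "\<dots> = (\<Sum>b\<in>Basis. 4 * m\<^sup>2 * bessel_fn2 (m * ?s) * ((x \<bullet> b) * (x \<bullet> b)) + 2 * m * bessel_fn1 (m * ?s))"
    by (intro sum.cong refl)
      (simp add: radial_bessel_D2_apply blinfun.add_left blinfun.scaleR_left mult.assoc)
  \<comment> \<open>Summing over the basis counts the constant summand twice; this is where the
    dimension of the disc enters.\<close>
  also have "\<dots> = 4 * m\<^sup>2 * bessel_fn2 (m * ?s) * ?s + 4 * m * bessel_fn1 (m * ?s)"
    unfolding sum.distrib sum_distrib_left[symmetric] euclidean_inner[symmetric] by simp
  also have "\<dots> = 4 * m * (m * ?s * bessel_fn2 (m * ?s) + bessel_fn1 (m * ?s))"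
    by (simp add: power2_eq_square algebra_simps)
  also have "m * ?s * bessel_fn2 (m * ?s) + bessel_fn1 (m * ?s) = - bessel_fn (m * ?s) / 4"
    using bessel_fn_ode[of "m * ?s"] by simp
  finally show ?thesis unfolding radial_bessel_def[of m x] by simp
qed

text \<open>One half of the identification of the first eigenvalue: by minimality, H lies at or
  below every zero of \<open>bessel_fn\<close>. The other half is
  \<open>dirichlet_eigenvalue_ge\<close>.\<close>

lemma radial_bessel_eigenvalue:
  assumes "bessel_fn m = 0"
  shows "dirichlet_eigenvalue (ball 0 1 :: (real ^ 2) set) m"
  unfolding dirichlet_eigenvalue_def
proof (intro exI[of _ "radial_bessel m"] conjI)
  show "C2_on (ball 0 1) (radial_bessel m :: real ^ 2 \<Rightarrow> real)"
    unfolding C2_on_def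
    using radial_bessel_deriv radial_bessel_D_deriv radial_bessel_D2_cont by blast
  show "continuous_on (closure (ball 0 1)) (radial_bessel m :: real ^ 2 \<Rightarrow> real)"
    unfolding radial_bessel_def
    by (intro continuous_on_compose2[OF bessel_fn_cont[of UNIV]] continuous_intros) auto
  show "\<forall>x\<in>frontier (ball 0 1 :: (real ^ 2) set). radial_bessel m x = 0"
    using assms by (auto simp: radial_bessel_def frontier_ball norm_eq_1)
  show "\<exists>x\<in>ball 0 1 :: (real ^ 2) set. radial_bessel m x \<noteq> 0"
    by (intro bexI[of _ 0]) (auto simp: radial_bessel_def)
qed (use radial_bessel_laplacian in blast)

lemma second_deriv_nonpos_at_max:
  fixes k :: "real \<Rightarrow> real"
  assumes "\<forall>\<^sub>F t in nhds 0. (k has_real_derivative k' t) (at t)"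
    and k2: "(k' has_real_derivative l) (at 0)"
    and mx: "\<forall>\<^sub>F t in nhds 0. k t \<le> k 0"
  shows "l \<le> 0"
proof (rule ccontr)
  assume "\<not> l \<le> 0"
  then obtain d1 where d1: "d1 > 0" "\<And>h. 0 < h \<Longrightarrow> h < d1 \<Longrightarrow> k' 0 < k' h"
    using DERIV_pos_inc_right[OF k2] by auto
  obtain d2 where d2: "d2 > 0" "\<And>t. \<bar>t\<bar> < d2 \<Longrightarrow> (k has_real_derivative k' t) (at t) \<and> k t \<le> k 0"
    using eventually_conj[OF assms(1) mx] by (auto simp: eventually_nhds_metric dist_real_def)
  have "k' 0 = 0"
    by (rule DERIV_local_max[of k "k' 0" 0 d2]) (use d2 in auto)
  define h where "h = min d1 d2 / 2"
  have h: "0 < h" "h < d1" "h < d2" using d1(1) d2(1) by (auto simp: h_def)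
  have "\<exists>z. 0 < z \<and> z < h \<and> k h - k 0 = (h - 0) * k' z"
    by (rule MVT2) (use h d2(2) in auto)
  then obtain z where z: "0 < z" "z < h" "k h - k 0 = h * k' z" by auto
  have "k' z > 0" using d1(2)[of z] z h \<open>k' 0 = 0\<close> by auto
  then have "h * k' z > 0" using h by simp
  then show False using z h d2(2)[of h] by auto
qed

text \<open>Barta's argument: at a maximum of the quotient of an eigenfunction and the positive function
  \<open>radial_bessel m\<close>, the second-order condition compares the two eigenvalues.\<close>

lemma dirichlet_eigenvalue_ge:
  assumes pos: "\<And>s. 0 \<le> s \<Longrightarrow> s \<le> 1 \<Longrightarrow> bessel_fn (m * s) > 0"
    and ev: "dirichlet_eigenvalue (ball 0 1 :: (real ^ 2) set) \<mu>"
  shows "m \<le> \<mu>"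
proof -
  obtain \<phi>0 :: "real ^ 2 \<Rightarrow> real" and x1 where "C2_on (ball 0 1) \<phi>0" and cphi0: "continuous_on (cball 0 1) \<phi>0"
    and eq0: "\<And>x. x \<in> ball 0 1 \<Longrightarrow> - laplacian \<phi>0 x = \<mu> * \<phi>0 x"
    and bd0: "\<And>x. norm x = 1 \<Longrightarrow> \<phi>0 x = 0" and x1: "x1 \<in> ball 0 1" "\<phi>0 x1 \<noteq> 0"
    using ev unfolding dirichlet_eigenvalue_def closure_ball[OF zero_less_one] frontier_ball[OF zero_less_one]
    by (auto simp: sphere_def)
  then obtain Du D2u where Du: "\<forall>x\<in>ball 0 1. (\<phi>0 has_derivative blinfun_apply (Du x)) (at x)"
    and D2u: "\<forall>x\<in>ball 0 1. (Du has_derivative blinfun_apply (D2u x)) (at x)"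
    unfolding C2_on_def by blast
  \<comment> \<open>The sign makes the quotient positive at \<open>x1\<close>, so its maximum is
    positive and, as the eigenfunction vanishes on the boundary, is attained inside.\<close>
  define \<sigma> where "\<sigma> = sgn (\<phi>0 x1)"
  define \<Psi> :: "real ^ 2 \<Rightarrow> real" where "\<Psi> = radial_bessel m"
  have Psi: "\<Psi> x > 0" if "norm x \<le> 1" for x
  proof -
    have "x \<bullet> x \<le> 1" using that by (simp add: power2_norm_eq_inner[symmetric] power_le_one)
    then show ?thesis unfolding \<Psi>_def radial_bessel_def by (intro pos) auto
  qed
  define q where "q x = \<sigma> * \<phi>0 x / \<Psi> x" for x
  have "continuous_on (cball 0 1) \<Psi>" unfolding \<Psi>_def
    by (intro continuous_at_imp_continuous_on ballI has_derivative_continuous[OF radial_bessel_deriv])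
  then have "continuous_on (cball 0 1) q"
    unfolding q_def using Psi by (intro continuous_intros cphi0) (auto simp: less_imp_neq[symmetric])
  then obtain x0 where x0: "x0 \<in> cball 0 1" "\<And>y. y \<in> cball 0 1 \<Longrightarrow> q y \<le> q x0"
    using continuous_attains_sup[of "cball 0 1" q] by auto
  define t where "t = q x0"
  have "q x1 > 0" unfolding q_def \<sigma>_def using x1 Psi[of x1]
    by (intro divide_pos_pos) (auto simp: sgn_if)
  then have t: "t > 0" using x0(2)[of x1] x1(1) by (simp add: t_def)
  have x0b: "x0 \<in> ball 0 1"
    using x0(1) t bd0[of x0] by (cases "norm x0 = 1") (auto simp: t_def q_def)
  have le: "\<sigma> * \<phi>0 y \<le> t * \<Psi> y" if "norm y \<le> 1" for y
    using x0(2)[of y] that Psi[OF that] by (simp add: t_def[symmetric] q_def[of y] pos_divide_le_eq)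
  have eqx0: "\<sigma> * \<phi>0 x0 = t * \<Psi> x0" using Psi[of x0] x0(1) by (simp add: t_def q_def)
  \<comment> \<open>Instead of differentiating the quotient, use
    \<open>\<sigma> * \<phi>0 - t * \<Psi>\<close>, which is nowhere positive and vanishes at
    \<open>x0\<close>; its second derivative there is nonpositive in every direction.\<close>
  have "\<sigma> * laplacian \<phi>0 x0 - t * laplacian \<Psi> x0 =
      (\<Sum>b\<in>Basis. \<sigma> * D2u x0 b b - t * radial_bessel_D2 m x0 b b)"
    unfolding sum_subtractf sum_distrib_left[symmetric] \<Psi>_def
    using laplacian_eq[OF open_ball x0b Du D2u]
      laplacian_eq[OF open_UNIV UNIV_I radial_bessel_derivs, of m x0] by simp
  also have "\<dots> \<le> 0"
  proof (rule sum_nonpos)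
    fix b :: "real ^ 2" assume "b \<in> Basis"
    have ev: "\<forall>\<^sub>F s in nhds 0. x0 + s *\<^sub>R b \<in> ball 0 1"
      by (rule eventually_line_in_open) (use x0b in auto)
    let ?k = "\<lambda>s. \<sigma> * \<phi>0 (x0 + s *\<^sub>R b) - t * \<Psi> (x0 + s *\<^sub>R b)"
    let ?k' = "\<lambda>s. \<sigma> * Du (x0 + s *\<^sub>R b) b - t * radial_bessel_D m (x0 + s *\<^sub>R b) b"
    show "\<sigma> * D2u x0 b b - t * radial_bessel_D2 m x0 b b \<le> 0"
    proof (rule second_deriv_nonpos_at_max[of ?k ?k'])
      show "\<forall>\<^sub>F s in nhds 0. (?k has_real_derivative ?k' s) (at s)"
        using ev unfolding \<Psi>_def
        by eventually_elim (intro DERIV_diff DERIV_cmult C2_closure_line_derivs(1)[OF Du D2u]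
          C2_closure_line_derivs(1)[OF radial_bessel_derivs[of UNIV]]; simp)
      show "(?k' has_real_derivative \<sigma> * D2u x0 b b - t * radial_bessel_D2 m x0 b b) (at 0)"
        using C2_closure_line_derivs(2)[OF Du D2u, of x0 0 b]
          C2_closure_line_derivs(2)[OF radial_bessel_derivs[of UNIV m], of x0 0 b] x0b
        by (intro DERIV_diff DERIV_cmult) auto
      show "\<forall>\<^sub>F s in nhds 0. ?k s \<le> ?k 0"
        using ev by eventually_elim (use le eqx0 in auto)
    qed
  qed
  finally have "\<sigma> * (\<mu> * \<phi>0 x0) \<ge> t * (m * \<Psi> x0)"
    using eq0[OF x0b] radial_bessel_laplacian[of m x0] unfolding \<Psi>_def
    by (metis (no_types, opaque_lifting) diff_le_0_iff_le minus_mult_right neg_le_iff_le minus_minus)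
  then have "\<mu> * (t * \<Psi> x0) \<ge> m * (t * \<Psi> x0)" using eqx0 by (metis mult.left_commute)
  moreover have "t * \<Psi> x0 > 0" using mult_pos_pos[OF t Psi[of x0]] x0(1) by simp
  ultimately show ?thesis using mult_le_cancel_right_pos by blast
qed

text \<open>If \<open>bessel_fn\<close> were positive on [0, H], it would be positive slightly
  beyond H, and Barta's bound would give m \<le> H for some m > H. So there is a first zero
  \<open>x0 \<le> H\<close>; being an eigenvalue itself, it equals H by minimality.\<close>

lemma first_dirichlet_eigenvalue_bessel:
  assumes "first_dirichlet_eigenvalue (ball 0 1 :: (real ^ 2) set) H"
  shows "H > 0" "bessel_fn H = 0" "\<And>x. 0 \<le> x \<Longrightarrow> x < H \<Longrightarrow> bessel_fn x > 0"
proof -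
  have evH: "dirichlet_eigenvalue (ball 0 1 :: (real ^ 2) set) H"
    and mn: "\<And>\<mu>. dirichlet_eigenvalue (ball 0 1 :: (real ^ 2) set) \<mu> \<Longrightarrow> H \<le> \<mu>"
    using assms unfolding first_dirichlet_eigenvalue_def by auto
  \<comment> \<open>Barta's bound with m = 0, where the comparison function is the constant
    1.\<close>
  have H0: "H \<ge> 0" by (rule dirichlet_eigenvalue_ge[OF _ evH]) simp
  have P: "\<exists>x\<in>{0..H}. bessel_fn x \<le> 0"
  proof (rule ccontr)
    assume "\<not> ?thesis"
    then have p: "\<And>x. 0 \<le> x \<Longrightarrow> x \<le> H \<Longrightarrow> bessel_fn x > 0" by force
    have "\<forall>\<^sub>F x in nhds H. bessel_fn x > 0"
      using p[of H] H0 bessel_fn_deriv DERIV_isCont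
      by (intro order_tendstoD(1)[where y="bessel_fn H"]) (auto simp: isCont_def tendsto_at_iff_tendsto_nhds)
    then obtain d where d: "d > 0" "\<And>x. \<bar>x - H\<bar> < d \<Longrightarrow> bessel_fn x > 0"
      by (auto simp: eventually_nhds_metric dist_real_def)
    have "H + d / 2 \<le> H"
    proof (rule dirichlet_eigenvalue_ge[OF _ evH])
      fix s :: real assume s: "0 \<le> s" "s \<le> 1"
      have "(H + d/2) * s \<le> (H + d/2) * 1" using s d H0 by (intro mult_left_mono) auto
      moreover have "(H + d/2) * s \<ge> 0" using s d H0 by simp
      ultimately show "bessel_fn ((H + d / 2) * s) > 0"
        using p[of "(H + d/2) * s"] d(2)[of "(H + d/2) * s"] d(1) by (cases "(H + d/2) * s \<le> H") auto
    qed
    then show False using d by simp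
  qed
  define x0 where "x0 = Inf {x\<in>{0..H}. bessel_fn x \<le> 0}"
  have cl: "closed {x\<in>{0..H}. bessel_fn x \<le> 0}"
    by (intro continuous_on_closed_Collect_le bessel_fn_cont continuous_intros closed_atLeastAtMost)
  have "x0 \<in> {x\<in>{0..H}. bessel_fn x \<le> 0}"
    unfolding x0_def using P by (intro closed_contains_Inf[OF _ _ cl] bdd_belowI[of _ 0]) auto
  then have x0: "x0 \<in> {0..H}" "bessel_fn x0 \<le> 0" by auto
  have lt: "bessel_fn x > 0" if "0 \<le> x" "x < x0" for x
  proof (rule ccontr)
    assume "\<not> ?thesis"
    then have "x0 \<le> x" unfolding x0_def using that x0(1) by (intro cInf_lower bdd_belowI[of _ 0]) auto
    then show False using that by simp
  qed
  have "x0 \<noteq> 0" using x0(2) by auto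
  then have x0p: "x0 > 0" using x0(1) by auto
  have "bessel_fn x0 \<ge> 0"
  proof (rule tendsto_lowerbound)
    show "(bessel_fn \<longlongrightarrow> bessel_fn x0) (at_left x0)"
      using bessel_fn_deriv[of x0] DERIV_isCont isCont_def filterlim_at_split by blast
    show "\<forall>\<^sub>F x in at_left x0. 0 \<le> bessel_fn x"
      using eventually_at_left_real[OF x0p] by eventually_elim (use lt in \<open>auto intro: less_imp_le\<close>)
  qed auto
  then have z: "bessel_fn x0 = 0" using x0 by simp
  then have "H \<le> x0" by (intro mn radial_bessel_eigenvalue)
  then have "x0 = H" using x0 by auto
  then show "H > 0" "bessel_fn H = 0" "\<And>x. 0 \<le> x \<Longrightarrow> x < H \<Longrightarrow> bessel_fn x > 0"
    using x0p z lt by blast+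
qed

section \<open>Low dimensions\<close>

lemma deriv_nonneg_mono:
  fixes f :: "real \<Rightarrow> real"
  assumes "\<And>x. A < x \<Longrightarrow> x < B \<Longrightarrow> (f has_real_derivative f' x) (at x) \<and> 0 \<le> f' x"
    and "A < x" "x \<le> y" "y < B"
  shows "f x \<le> f y"
proof (rule DERIV_nonneg_imp_nondecreasing[OF assms(3)])
  fix z assume "x \<le> z" "z \<le> y"
  then show "\<exists>D. (f has_real_derivative D) (at z) \<and> 0 \<le> D"
    using assms(1)[of z] assms(2,4) by auto
qed

lemma deriv_pos_mono:
  fixes f :: "real \<Rightarrow> real"
  assumes "\<And>x. A < x \<Longrightarrow> x < B \<Longrightarrow> (f has_real_derivative f' x) (at x) \<and> 0 < f' x"
    and "A < x" "x < y" "y < B"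
  shows "f x < f y"
proof (rule DERIV_pos_imp_increasing[OF assms(3)])
  fix z assume "x \<le> z" "z \<le> y"
  then show "\<exists>D. (f has_real_derivative D) (at z) \<and> 0 < D"
    using assms(1)[of z] assms(2,4) by auto
qed

lemma right_limit_le:
  fixes f :: "real \<Rightarrow> real"
  assumes d: "\<And>x. A < x \<Longrightarrow> x < B \<Longrightarrow> (f has_real_derivative f' x) (at x) \<and> 0 \<le> f' x"
    and lim: "(f \<longlongrightarrow> c) (at_right A)" and "A < x" "x < B"
  shows "c \<le> f x"
proof (rule tendsto_upperbound[OF lim])
  show "\<forall>\<^sub>F y in at_right A. f y \<le> f x"
    using eventually_at_right_real[OF \<open>A < x\<close>]
    by eventually_elim (rule deriv_nonneg_mono[OF d]; use assms in auto)
qed auto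

text \<open>Comparison with a limit is only weak; strictness is gained by passing through the
  midpoint.\<close>

lemma right_limit_less:
  fixes f :: "real \<Rightarrow> real"
  assumes d: "\<And>x. A < x \<Longrightarrow> x < B \<Longrightarrow> (f has_real_derivative f' x) (at x) \<and> 0 < f' x"
    and lim: "(f \<longlongrightarrow> c) (at_right A)" and "A < x" "x < B"
  shows "c < f x"
proof -
  have "c \<le> f ((A + x) / 2)"
    by (rule right_limit_le[of A B f f', OF _ lim]) (use d assms in \<open>auto intro: less_imp_le\<close>)
  also have "\<dots> < f x"
    by (rule deriv_pos_mono[of A B f f', OF d]) (use assms in auto)
  finally show ?thesis .
qed

lemma le_left_limit:
  fixes f :: "real \<Rightarrow> real"
  assumes d: "\<And>x. A < x \<Longrightarrow> x < B \<Longrightarrow> (f has_real_derivative f' x) (at x) \<and> 0 \<le> f' x"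
    and lim: "(f \<longlongrightarrow> c) (at_left B)" and "A < x" "x < B"
  shows "f x \<le> c"
proof (rule tendsto_lowerbound[OF lim])
  show "\<forall>\<^sub>F y in at_left B. f x \<le> f y"
    using eventually_at_left_real[OF \<open>x < B\<close>]
    by eventually_elim (rule deriv_nonneg_mono[OF d]; use assms in auto)
qed auto

lemma less_left_limit:
  fixes f :: "real \<Rightarrow> real"
  assumes d: "\<And>x. A < x \<Longrightarrow> x < B \<Longrightarrow> (f has_real_derivative f' x) (at x) \<and> 0 < f' x"
    and lim: "(f \<longlongrightarrow> c) (at_left B)" and "A < x" "x < B"
  shows "f x < c"
proof -
  have "f x < f ((x + B) / 2)"
    by (rule deriv_pos_mono[of A B f f', OF d]) (use assms in auto)
  also have "\<dots> \<le> c"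
    by (rule le_left_limit[of A B f f', OF _ lim]) (use d assms in \<open>auto intro: less_imp_le\<close>)
  finally show ?thesis .
qed

lemma tendsto_at_right_of_cont:
  fixes f :: "real \<Rightarrow> real"
  assumes "continuous_on {a..b} f" "a < b"
  shows "(f \<longlongrightarrow> f a) (at_right a)"
  using assms continuous_on_Icc_at_rightD by blast

lemma tendsto_at_left_of_cont:
  fixes f :: "real \<Rightarrow> real"
  assumes "continuous_on {a..b} f" "a < b"
  shows "(f \<longlongrightarrow> f b) (at_left b)"
  using assms continuous_on_Icc_at_leftD by blast

section \<open>Fluxes and boundary terms of the radial equation\<close>

lemma radial_odeD:
  assumes "radial_ode N v v' h"
  shows "continuous_on {0..1} v"
    and "0 < r \<Longrightarrow> r < 1 \<Longrightarrow> (v has_real_derivative v' r) (at r)"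
    and "0 < r \<Longrightarrow> r < 1 \<Longrightarrow> (v' has_real_derivative - h r - (real N - 1) / r * v' r) (at r)"
    and "(v \<longlongrightarrow> v 0) (at_right 0)" and "(v \<longlongrightarrow> v 1) (at_left 1)"
  using assms tendsto_at_right_of_cont[of 0 1 v] tendsto_at_left_of_cont[of 0 1 v]
  unfolding radial_ode_def by auto

lemma radial_ode_diff:
  assumes "radial_ode N v v' h" "radial_ode N w w' k"
  shows "radial_ode N (\<lambda>r. v r - w r) (\<lambda>r. v' r - w' r) (\<lambda>r. h r - k r)"
proof -
  obtain M M' where "\<forall>r\<in>{0<..<1}. \<bar>v' r\<bar> \<le> M" "\<forall>r\<in>{0<..<1}. \<bar>w' r\<bar> \<le> M'"
    using assms unfolding radial_ode_def by blast
  then have "\<forall>r\<in>{0<..<1}. \<bar>v' r - w' r\<bar> \<le> M + M'" by fastforce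
  moreover have "((\<lambda>r. v' r - w' r) has_real_derivative
      - (h r - k r) - (real N - 1) / r * (v' r - w' r)) (at r)" if "r \<in> {0<..<1}" for r
  proof -
    have "- a - c * x - (- b - c * y) = - (a - b) - c * (x - y)" for a b c x y :: real
      by (simp add: algebra_simps)
    then show ?thesis
      by (rule DERIV_cong[OF DERIV_diff[OF radial_odeD(3)[OF assms(1)] radial_odeD(3)[OF assms(2)]], rotated -1])
        (use that in auto)
  qed
  ultimately show ?thesis
    using assms unfolding radial_ode_def by (auto intro!: continuous_on_diff DERIV_diff)
qed

lemma radial_ode_add_const:
  assumes "radial_ode N v v' h"
  shows "radial_ode N (\<lambda>r. v r + c) v' h"
proof -
  have "radial_ode N (\<lambda>r. - c) (\<lambda>r. 0) (\<lambda>r. 0)" unfolding radial_ode_def by auto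
  from radial_ode_diff[OF assms this] show ?thesis by simp
qed

lemma radial_ode_flux:
  assumes "radial_ode N v v' h" "N \<ge> 2" "0 < r" "r < 1"
  shows "((\<lambda>r. r ^ (N - 1) * v' r) has_real_derivative - (r ^ (N - 1) * h r)) (at r)"
proof -
  obtain m where N: "N = Suc (Suc m)" by (rule that[of "N - 2"]) (use assms(2) in arith)
  show ?thesis
    by (rule DERIV_cong[OF DERIV_mult[OF DERIV_pow radial_odeD(3)[OF assms(1,3,4)]]])
      (use assms(3) in \<open>simp add: N field_simps\<close>)
qed

lemma bounded_times_vanishing:
  fixes f g :: "real \<Rightarrow> real"
  assumes "(f \<longlongrightarrow> 0) F" "\<forall>\<^sub>F x in F. \<bar>g x\<bar> \<le> M"
  shows "((\<lambda>x. f x * g x) \<longlongrightarrow> 0) F"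
proof (rule Lim_null_comparison)
  show "\<forall>\<^sub>F x in F. norm (f x * g x) \<le> \<bar>f x\<bar> * M"
    using assms(2) by eventually_elim (auto simp: abs_mult intro: mult_left_mono)
  show "((\<lambda>x. \<bar>f x\<bar> * M) \<longlongrightarrow> 0) F" using assms(1) by (auto intro!: tendsto_eq_intros)
qed

lemma radial_ode_vanishing:
  assumes ode: "radial_ode N v v' h"
  shows "(f \<longlongrightarrow> 0) (at_right 0) \<Longrightarrow> ((\<lambda>r. f r * v' r) \<longlongrightarrow> 0) (at_right 0)"
    and "(f \<longlongrightarrow> 0) (at_left 1) \<Longrightarrow> ((\<lambda>r. f r * v' r) \<longlongrightarrow> 0) (at_left 1)"
proof -
  obtain M where M: "\<forall>r\<in>{0<..<1}. \<bar>v' r\<bar> \<le> M" using ode unfolding radial_ode_def by blast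
  have "\<forall>\<^sub>F r in at_right 0. r \<in> {0<..<1::real}" "\<forall>\<^sub>F r in at_left 1. r \<in> {0<..<1::real}"
    using eventually_at_right_real[of 0 1] eventually_at_left_real[of 0 1] by simp_all
  then have "\<forall>\<^sub>F r in at_right 0. \<bar>v' r\<bar> \<le> M" "\<forall>\<^sub>F r in at_left 1. \<bar>v' r\<bar> \<le> M"
    using M by (auto elim: eventually_mono)
  then show "(f \<longlongrightarrow> 0) (at_right 0) \<Longrightarrow> ((\<lambda>r. f r * v' r) \<longlongrightarrow> 0) (at_right 0)"
    and "(f \<longlongrightarrow> 0) (at_left 1) \<Longrightarrow> ((\<lambda>r. f r * v' r) \<longlongrightarrow> 0) (at_left 1)"
    by (auto intro: bounded_times_vanishing)
qed

lemma power_vanishing: "n > 0 \<Longrightarrow> ((\<lambda>r::real. r ^ n) \<longlongrightarrow> 0) (at_right 0)"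
  by (auto intro!: tendsto_eq_intros)

text \<open>The flux \<open>r ^ (N - 1) * v' r\<close> starts at zero and can only decrease.
  Continuity extends the monotonicity of v to the origin, where no derivative is assumed.\<close>

lemma radial_ode_decreasing:
  assumes ode: "radial_ode N v v' h" and N: "N \<ge> 2" and h: "\<And>r. 0 < r \<Longrightarrow> r < 1 \<Longrightarrow> h r \<ge> 0"
  shows "0 < r \<Longrightarrow> r < 1 \<Longrightarrow> v' r \<le> 0" and "0 \<le> r \<Longrightarrow> r \<le> s \<Longrightarrow> s < 1 \<Longrightarrow> v s \<le> v r"
proof -
  have v': "v' r \<le> 0" if r: "0 < r" "r < 1" for r
  proof -
    have "0 \<le> - (r ^ (N - 1) * v' r)"
    proof (rule right_limit_le[where A=0 and B=1 and f="\<lambda>r. - (r ^ (N - 1) * v' r)" and f'="\<lambda>r. r ^ (N - 1) * h r"])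
      fix x :: real assume x: "0 < x" "x < 1"
      show "((\<lambda>r. - (r ^ (N - 1) * v' r)) has_real_derivative x ^ (N - 1) * h x) (at x) \<and>
          0 \<le> x ^ (N - 1) * h x"
        using DERIV_minus[OF radial_ode_flux[OF ode N x]] h[OF x] x by simp
    next
      show "((\<lambda>r. - (r ^ (N - 1) * v' r)) \<longlongrightarrow> 0) (at_right 0)"
        using tendsto_minus[OF radial_ode_vanishing(1)[OF ode power_vanishing[of "N - 1"]]] N by simp
    qed (use r in auto)
    then show ?thesis using r mult_pos_pos[OF zero_less_power[OF r(1), of "N - 1"], of "v' r"] by linarith
  qed
  have d: "((\<lambda>r. - v r) has_real_derivative - v' r) (at r) \<and> 0 \<le> - v' r" if "0 < r" "r < 1" for r
    using v'[OF that] DERIV_minus[OF radial_odeD(2)[OF ode that]] by simp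
  have "v s \<le> v r" if "0 \<le> r" "r \<le> s" "s < 1" for r s
  proof (cases "r = 0")
    case True
    show ?thesis
    proof (cases "s = 0")
      case False
      have "- v 0 \<le> - v s"
        by (rule right_limit_le[where A=0 and B=1, OF d tendsto_minus[OF radial_odeD(4)[OF ode]]])
          (use that False True in auto)
      then show ?thesis using True by simp
    qed (use True in simp)
  next
    case False
    have "- v r \<le> - v s"
      by (rule deriv_nonneg_mono[where A=0 and B=1, OF d]) (use that False in auto)
    then show ?thesis by simp
  qed
  then show "0 < r \<Longrightarrow> r < 1 \<Longrightarrow> v' r \<le> 0" and "0 \<le> r \<Longrightarrow> r \<le> s \<Longrightarrow> s < 1 \<Longrightarrow> v s \<le> v r"
    using v' by blast+
qed

text \<open>The pointwise inequality behind the Crandall--Rabinowitz argument with exponent \<open>15/8 < 2\<close>: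
  here \<open>X = exp (15/8 y)\<close>, and \<open>X\<^sup>2 / 16 - 2 X + 31/16 = (X - 1)\<^sup>2 - 15/16 (X\<^sup>2 - 1)\<close>.\<close>

lemma crandall_rabinowitz_pointwise:
  fixes K y Q :: real
  assumes Q: "0 \<le> Q" "Q \<le> K * exp y" and K: "K \<ge> 0"
  defines "X \<equiv> exp (15 / 8 * y)"
  shows "Q * X\<^sup>2 / 64 - 8192 * K \<le> Q * ((X - 1)\<^sup>2 - 15 / 16 * (X\<^sup>2 - 1))"
proof (cases "X \<ge> 64")
  case True
  \<comment> \<open>The quadratic term absorbs the linear one:
    \<open>3 / 64 * X\<^sup>2 \<ge> 2 * X\<close> holds from X = 128/3 on, so 64 is a convenient
    threshold.\<close>
  have "0 \<le> X * (3 * X / 64 - 2)" using True by (intro mult_nonneg_nonneg) auto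
  then have "0 \<le> 3 / 64 * X\<^sup>2 - 2 * X" by (simp add: power2_eq_square algebra_simps)
  moreover have "(X - 1)\<^sup>2 = X\<^sup>2 - 2 * X + 1" by (simp add: power2_diff)
  ultimately have "X\<^sup>2 / 64 \<le> (X - 1)\<^sup>2 - 15 / 16 * (X\<^sup>2 - 1)"
    by (simp add: field_simps)
  then have "Q * (X\<^sup>2 / 64) \<le> Q * ((X - 1)\<^sup>2 - 15 / 16 * (X\<^sup>2 - 1))"
    using Q by (intro mult_left_mono)
  then show ?thesis using K by (simp add: field_simps)
next
  case False
  have "exp y \<le> 64"
  proof (cases "y \<le> 0")
    case True
    then have "exp y \<le> 1" by simp
    then show ?thesis by linarith
  next
    case F: False
    have "exp y \<le> X" unfolding X_def using F by simp
    then show ?thesis using False by simp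
  qed
  \<comment> \<open>Below the threshold the defect is at most 128 and Q is at most
    \<open>64 * K\<close>, whence the constant 8192 = 64 * 128.\<close>
  then have Q64: "Q \<le> 64 * K" using Q K mult_left_mono[of "exp y" 64 K] by linarith
  have "X\<^sup>2 / 64 - 128 \<le> (X - 1)\<^sup>2 - 15 / 16 * (X\<^sup>2 - 1)"
  proof -
    have "t = s - 2 * x + 1 \<Longrightarrow> x < 64 \<Longrightarrow> 0 \<le> s \<Longrightarrow> s / 64 - 128 \<le> t - 15 / 16 * (s - 1)" for s t x :: real
      by argo
    from this[of "(X - 1)\<^sup>2" "X\<^sup>2" X] show ?thesis using False by (simp add: power2_diff)
  qed
  then have "Q * (X\<^sup>2 / 64 - 128) \<le> Q * ((X - 1)\<^sup>2 - 15 / 16 * (X\<^sup>2 - 1))"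
    using Q by (intro mult_left_mono)
  then show ?thesis using Q64 by (simp add: algebra_simps)
qed

text \<open>Below the level \<open>exp y = k\<close> the bound on Q gives \<open>K * k\<close>;
  above it \<open>(exp (15 / 8 * y))\<^sup>2 = exp (15 / 4 * y)\<close> exceeds
  \<open>k powr (15 / 4)\<close>. The level is left free because it is later tied to the
  radius.\<close>

lemma crandall_rabinowitz_split:
  fixes K k y Q :: real
  assumes Q: "0 \<le> Q" "Q \<le> K * exp y" and K: "K \<ge> 0" and k: "k > 0"
  shows "Q \<le> k powr (- 15 / 4) * (Q * (exp (15 / 8 * y))\<^sup>2) + K * k"
proof (cases "exp y \<le> k")
  case True
  then have "Q \<le> K * k" using Q K mult_left_mono[of "exp y" k K] by linarith
  moreover have "0 \<le> k powr (- 15 / 4) * (Q * (exp (15 / 8 * y))\<^sup>2)" using Q by simp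
  ultimately show ?thesis by linarith
next
  case False
  then have "ln k \<le> y" using k ln_le_cancel_iff[of k "exp y"] by simp
  then have "1 \<le> exp (15 / 4 * (y - ln k))" by simp
  also have "\<dots> = k powr (- 15 / 4) * (exp (15 / 8 * y))\<^sup>2"
  proof -
    have "(exp (15 / 8 * y))\<^sup>2 = exp (15 / 4 * y)" by (simp flip: exp_double)
    then show ?thesis using k by (simp add: powr_def right_diff_distrib flip: exp_add)
  qed
  finally have "Q * 1 \<le> Q * (k powr (- 15 / 4) * (exp (15 / 8 * y))\<^sup>2)"
    using Q by (intro mult_left_mono)
  moreover have "0 \<le> K * k" using K k by simp
  ultimately show ?thesis by (simp add: mult_ac)
qed

text \<open>With \<open>X = exp (15 / 8 * y)\<close>, y differing from u by a constant, stability
  bounds the integral of \<open>Q * X\<^sup>2\<close>. This gives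
  \<open>- u' \<le> D * r powr (1 - 4 * N / 19)\<close>, integrable at 0 exactly for N < 19/2. For a
  general exponent c in place of 15/8, the test needs c < 2 and N = 9 needs c > 7/4; 15/8 is the
  midpoint.\<close>

lemma stable_bounded_low_dim:
  assumes N: "3 \<le> N" "N \<le> 9"
    and u: "radial_ode N u u' Q" and cQ: "continuous_on {0..1} Q"
    and Q: "\<And>r. 0 \<le> r \<Longrightarrow> r < 1 \<Longrightarrow> 0 \<le> Q r \<and> Q r \<le> K * exp (u r)"
    and K: "K \<ge> 0" and u1: "u 1 = 0"
    and w: "radial_ode N w w' k" "\<And>r. 0 \<le> r \<Longrightarrow> r < 1 \<Longrightarrow> w r > 0"
      "\<And>r. 0 < r \<Longrightarrow> r < 1 \<Longrightarrow> Q r * w r \<le> k r"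
  shows "u 0 \<le> 1 + 10000000 * (K * exp 1)"
proof -
  have "\<forall>\<^sub>F r in at_left 1. u r < 1"
    using radial_odeD(5)[OF u] by (rule order_tendstoD) (simp add: u1)
  then obtain b where b: "b < 1" "\<And>r. b < r \<Longrightarrow> r < 1 \<Longrightarrow> u r < 1"
    unfolding eventually_at_left_field by auto
  \<comment> \<open>The test is carried out on [0, \<rho>] with \<rho> < 1, where \<open>w\<close>
    is bounded away from zero. Letting y vanish at \<rho> removes the boundary term there, and
    \<open>u \<rho> < 1\<close> costs only the factor \<open>exp 1\<close>. The final integration
    ends at the interior point \<rho>0.\<close>
  define \<rho>0 where "\<rho>0 = (max b 0 + 1) / 2"
  define \<rho> where "\<rho> = (\<rho>0 + 1) / 2"
  have rho0: "u \<rho>0 < 1" "0 < \<rho>0" "\<rho>0 < \<rho>" by (rule b) (use b(1) in \<open>auto simp: \<rho>0_def \<rho>_def max_def field_simps\<close>)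
  have rho: "u \<rho> < 1" "0 < \<rho>" "\<rho> < 1" by (rule b) (use b(1) in \<open>auto simp: \<rho>0_def \<rho>_def max_def field_simps\<close>)
  define K1 where "K1 = K * exp 1"
  have K1: "K1 \<ge> 0" using K by (simp add: K1_def)
  define y where "y r = u r - u \<rho>" for r
  define X where "X r = exp (15 / 8 * y r)" for r
  have QK1: "0 \<le> Q r" "Q r \<le> K1 * exp (y r)" if "0 \<le> r" "r < 1" for r
  proof -
    have "K * exp (u r) \<le> K * exp (1 + y r)" using K rho(1) by (intro mult_left_mono) (auto simp: y_def)
    then show "0 \<le> Q r" "Q r \<le> K1 * exp (y r)" using Q[OF that] by (auto simp: K1_def exp_add)
  qed
  \<comment> \<open>Picone's identity in flux form: the inequality for \<open>w\<close> is tested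
    with \<open>(X - 1)\<^sup>2 / w\<close>, the equation for u with \<open>X\<^sup>2 - 1\<close>.
    The weight 15/16 is chosen because \<open>15 / 16 * (15 / 4) = (15 / 8)\<^sup>2\<close>, so that
    the gradient terms form a complete square.\<close>
  define B where "B r = r ^ (N - 1) * w' r * ((X r - 1)\<^sup>2 / w r)
    - 15 / 16 * (r ^ (N - 1) * u' r * ((X r)\<^sup>2 - 1))" for r
  define J where "J r = r ^ (N - 1) * (Q r * (X r)\<^sup>2)" for r
  define I where "I r = integral {0..r} J" for r
  have cu: "continuous_on {0..1} u" using radial_odeD(1)[OF u] .
  have cX: "continuous_on {0..1} X" unfolding X_def y_def by (intro continuous_intros cu)
  have cJ: "continuous_on {0..1} J" unfolding J_def by (intro continuous_intros cQ cX)
  have dI: "(I has_real_derivative J r) (at r)" if "0 < r" "r < 1" for r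
    using integral_has_real_derivative[OF cJ, of r] that
    by (simp add: I_def[abs_def] at_within_Icc_at)
  have cI: "continuous_on {0..1} I"
    unfolding I_def by (intro indefinite_integral_continuous_1 integrable_continuous_real cJ)
  have I0: "(I \<longlongrightarrow> 0) (at_right 0)"
    using tendsto_at_right_of_cont[OF cI] by (simp add: I_def)
  have B0: "(B \<longlongrightarrow> 0) (at_right 0)"
  proof -
    have lX: "(X \<longlongrightarrow> X 0) (at_right 0)" using tendsto_at_right_of_cont[OF cX] by simp
    have lw: "(w \<longlongrightarrow> w 0) (at_right 0)" "w 0 \<noteq> 0" using radial_odeD(4)[OF w(1)] w(2)[of 0] by auto
    have "((\<lambda>r. r ^ (N - 1) * w' r) \<longlongrightarrow> 0) (at_right 0)" "((\<lambda>r. r ^ (N - 1) * u' r) \<longlongrightarrow> 0) (at_right 0)"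
      using radial_ode_vanishing(1)[OF w(1) power_vanishing] radial_ode_vanishing(1)[OF u power_vanishing] N by auto
    then have "(B \<longlongrightarrow> 0 * ((X 0 - 1)\<^sup>2 / w 0) - 15 / 16 * (0 * ((X 0)\<^sup>2 - 1))) (at_right 0)"
      unfolding B_def by (intro tendsto_intros lX lw)
    then show ?thesis by simp
  qed
  have Brho: "B \<rho> = 0" by (simp add: B_def X_def y_def)
  define B' where "B' r = - (r ^ (N - 1) * k r) * ((X r - 1)\<^sup>2 / w r)
      + r ^ (N - 1) * w' r * ((2 * (X r - 1) * (15 / 8 * X r * u' r) * w r - (X r - 1)\<^sup>2 * w' r) / (w r)\<^sup>2)
      - 15 / 16 * (- (r ^ (N - 1) * Q r) * ((X r)\<^sup>2 - 1) + r ^ (N - 1) * u' r * (15 / 4 * (X r)\<^sup>2 * u' r))" for r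
  have dB: "(B has_real_derivative B' r) (at r)" if r: "0 < r" "r < 1" for r
  proof -
    have N2: "N \<ge> 2" using N by simp
    have wr: "w r \<noteq> 0" using w(2)[of r] r by auto
    have dX: "(X has_real_derivative 15 / 8 * X r * u' r) (at r)"
      unfolding X_def y_def
      by (auto intro!: derivative_eq_intros radial_odeD(2)[OF u r])
    have d1: "((\<lambda>r. (X r - 1)\<^sup>2 / w r) has_real_derivative
       (2 * (X r - 1) * (15 / 8 * X r * u' r) * w r - (X r - 1)\<^sup>2 * w' r) / (w r)\<^sup>2) (at r)"
      by (rule derivative_eq_intros dX radial_odeD(2)[OF w(1) r] refl wr)+
        (simp add: power2_eq_square)
    have d2: "((\<lambda>r. (X r)\<^sup>2 - 1) has_real_derivative 15 / 4 * (X r)\<^sup>2 * u' r) (at r)"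
      by (rule derivative_eq_intros dX refl)+ (simp add: power2_eq_square)
    show ?thesis
      unfolding B_def B'_def
      by (rule DERIV_cong[OF DERIV_diff[OF DERIV_mult[OF radial_ode_flux[OF w(1) N2 r] d1]
        DERIV_cmult[OF DERIV_mult[OF radial_ode_flux[OF u N2 r] d2]]]]) (simp add: field_simps)
  qed
  have B'le: "B' r \<le> - J r / 64 + 8192 * K1 * r ^ (N - 1)" if r: "0 < r" "r < 1" for r
  proof -
    have wr: "w r > 0" using w(2)[of r] r by auto
    define f where "f = (X r - 1) / w r"
    have Xw: "X r - 1 = f * w r" using wr by (simp add: f_def)
    have "B' r = r ^ (N - 1) * (- (k r * w r) * f\<^sup>2 - (w' r * f - 15 / 8 * X r * u' r)\<^sup>2
        + 15 / 16 * Q r * ((X r)\<^sup>2 - 1))"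
    proof -
      have e1: "(X r - 1)\<^sup>2 / w r = f\<^sup>2 * w r" using wr by (simp add: Xw power2_eq_square)
      have e2: "(2 * (X r - 1) * (15 / 8 * X r * u' r) * w r - (X r - 1)\<^sup>2 * w' r) / (w r)\<^sup>2
          = 2 * f * (15 / 8 * X r * u' r) - f\<^sup>2 * w' r"
        unfolding Xw using wr by (simp add: power2_eq_square field_simps)
      show ?thesis unfolding B'_def e1 e2 by (simp add: power2_eq_square field_simps)
    qed
    also have "\<dots> \<le> r ^ (N - 1) * (- (Q r * (X r - 1)\<^sup>2) + 15 / 16 * Q r * ((X r)\<^sup>2 - 1))"
    proof (intro mult_left_mono)
      have "Q r * w r * w r \<le> k r * w r" using w(3)[OF r] wr by (intro mult_right_mono) auto
      then have "Q r * w r * w r * f\<^sup>2 \<le> k r * w r * f\<^sup>2" by (rule mult_right_mono) simp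
      then have "Q r * (X r - 1)\<^sup>2 \<le> k r * w r * f\<^sup>2" unfolding Xw by (simp add: power2_eq_square mult_ac)
      then have "- (k r * w r * f\<^sup>2) - c\<^sup>2 + d \<le> - (Q r * (X r - 1)\<^sup>2) + d" for c d :: real
        using zero_le_power2[of c] by linarith
      then show "- (k r * w r) * f\<^sup>2 - (w' r * f - 15 / 8 * X r * u' r)\<^sup>2 + 15 / 16 * Q r * ((X r)\<^sup>2 - 1)
        \<le> - (Q r * (X r - 1)\<^sup>2) + 15 / 16 * Q r * ((X r)\<^sup>2 - 1)"
        unfolding mult_minus_left by blast
    qed (use r in simp)
    also have "\<dots> \<le> r ^ (N - 1) * (8192 * K1 - Q r * (X r)\<^sup>2 / 64)"
    proof (intro mult_left_mono)
      show "- (Q r * (X r - 1)\<^sup>2) + 15 / 16 * Q r * ((X r)\<^sup>2 - 1) \<le> 8192 * K1 - Q r * (X r)\<^sup>2 / 64"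
        using crandall_rabinowitz_pointwise[OF QK1[of r] K1] r by (simp add: X_def algebra_simps)
    qed (use r in simp)
    finally show ?thesis by (simp add: J_def algebra_simps)
  qed
  \<comment> \<open>B vanishes at both ends of [0, \<rho>], so integrating \<open>B'le\<close>
    leaves a bound on I alone; the integration is phrased as monotonicity of
    \<open>?g\<close>.\<close>
  have Irho: "I \<rho> \<le> 64 * 8192 * K1"
  proof -
    let ?g = "\<lambda>r. 8192 * K1 * r - B r - I r / 64"
    have "0 \<le> ?g \<rho>"
    proof (rule right_limit_le[where A=0 and B=1 and f="?g" and f'="\<lambda>r. 8192 * K1 - B' r - J r / 64"])
      fix r :: real assume r: "0 < r" "r < 1"
      have "8192 * K1 * r ^ (N - 1) \<le> 8192 * K1 * 1"
        using r K1 by (intro mult_left_mono power_le_one) auto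
      then show "(?g has_real_derivative 8192 * K1 - B' r - J r / 64) (at r) \<and> 0 \<le> 8192 * K1 - B' r - J r / 64"
        using B'le[OF r] by (auto intro!: derivative_eq_intros dB dI r)
    next
      have "(?g \<longlongrightarrow> 8192 * K1 * 0 - 0 - 0 / 64) (at_right 0)"
        by (intro tendsto_intros B0 I0 tendsto_ident_at) auto
      then show "(?g \<longlongrightarrow> 0) (at_right 0)" by simp
    qed (use rho in auto)
    moreover have "8192 * K1 * \<rho> \<le> 8192 * K1" using rho K1 by (simp add: mult_left_le)
    ultimately show ?thesis using Brho by simp
  qed
  have Ile: "I r \<le> 64 * 8192 * K1" if "0 < r" "r \<le> \<rho>" for r
  proof -
    have "I r \<le> I \<rho>"
      by (rule deriv_nonneg_mono[where A=0 and B=1 and f'=J])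
        (use that rho QK1 dI in \<open>auto simp: J_def\<close>)
    then show ?thesis using Irho by simp
  qed
  define D where "D = 64 * 8192 * K1 + K1"
  have D: "D \<ge> 0" using K1 by (simp add: D_def)
  have u'le: "- u' r \<le> D * r powr (- 17 / 19)" if r: "0 < r" "r \<le> \<rho>" for r
  proof -
    \<comment> \<open>The level that balances the two contributions:
      \<open>\<kappa> powr (- 15 / 4)\<close> and \<open>\<kappa> * r ^ N\<close> are both equal to
      \<open>r powr (15 * N / 19)\<close>.\<close>
    define \<kappa> where "\<kappa> = r powr (- 4 * real N / 19)"
    have kap: "\<kappa> > 0" using r by (simp add: \<kappa>_def)
    have N2: "N \<ge> 2" using N by simp
    let ?g = "\<lambda>s. \<kappa> powr (- 15 / 4) * I s + K1 * \<kappa> * s ^ N + s ^ (N - 1) * u' s"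
    have "0 \<le> ?g r"
    proof (rule right_limit_le[where A=0 and B=1 and f="?g" and
          f'="\<lambda>s. \<kappa> powr (- 15 / 4) * J s + K1 * \<kappa> * (real N * s ^ (N - 1)) - s ^ (N - 1) * Q s"])
      fix s :: real assume s: "0 < s" "s < 1"
      have "s ^ (N - 1) * Q s \<le> s ^ (N - 1) * (\<kappa> powr (- 15 / 4) * (Q s * (X s)\<^sup>2) + K1 * \<kappa>)"
        unfolding X_def using s by (intro mult_left_mono crandall_rabinowitz_split QK1 K1 kap) auto
      moreover have "K1 * \<kappa> * (1 * s ^ (N - 1)) \<le> K1 * \<kappa> * (real N * s ^ (N - 1))"
        using s K1 kap N by (intro mult_left_mono mult_right_mono) auto
      ultimately have "0 \<le> \<kappa> powr (- 15 / 4) * J s + K1 * \<kappa> * (real N * s ^ (N - 1)) - s ^ (N - 1) * Q s"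
        by (simp add: J_def algebra_simps)
      then show "(?g has_real_derivative
          \<kappa> powr (- 15 / 4) * J s + K1 * \<kappa> * (real N * s ^ (N - 1)) - s ^ (N - 1) * Q s) (at s) \<and>
          0 \<le> \<kappa> powr (- 15 / 4) * J s + K1 * \<kappa> * (real N * s ^ (N - 1)) - s ^ (N - 1) * Q s"
        using DERIV_add[OF DERIV_add[OF DERIV_cmult[OF dI[OF s]] DERIV_cmult[OF DERIV_pow]]
            radial_ode_flux[OF u N2 s], of "\<kappa> powr (- 15 / 4)" "K1 * \<kappa>" N]
        by simp
    next
      have "(?g \<longlongrightarrow> \<kappa> powr (- 15 / 4) * 0 + K1 * \<kappa> * 0 + 0) (at_right 0)"
        using N by (intro tendsto_intros I0 power_vanishing radial_ode_vanishing(1)[OF u]) auto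
      then show "(?g \<longlongrightarrow> 0) (at_right 0)" by simp
    qed (use r rho in auto)
    then have "- (r ^ (N - 1) * u' r) \<le> \<kappa> powr (- 15 / 4) * (64 * 8192 * K1) + K1 * \<kappa> * r ^ N"
      using mult_left_mono[OF Ile[OF r], of "\<kappa> powr (- 15 / 4)"] by simp
    also have "\<kappa> powr (- 15 / 4) = r powr (15 * real N / 19)"
      unfolding \<kappa>_def by (simp add: powr_powr)
    also have "K1 * \<kappa> * r ^ N = K1 * r powr (15 * real N / 19)"
    proof -
      have "\<kappa> * r ^ N = r powr (- 4 * real N / 19 + real N)"
        unfolding \<kappa>_def powr_add using r by (simp add: powr_realpow)
      also have "- 4 * real N / 19 + real N = 15 * real N / 19" by simp
      finally show ?thesis by simp
    qed
    finally have "r ^ (N - 1) * (- u' r) \<le> D * r powr (15 * real N / 19)"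
      by (simp add: D_def algebra_simps)
    then have "- u' r \<le> D * (r powr (15 * real N / 19) / r ^ (N - 1))"
      using r by (simp add: field_simps)
    also have "r powr (15 * real N / 19) / r ^ (N - 1) = r powr (15 * real N / 19 - real (N - 1))"
      using r by (simp add: powr_diff powr_realpow)
    also have "D * \<dots> \<le> D * r powr (- 17 / 19)"
    proof (intro mult_left_mono powr_mono' D)
      \<comment> \<open>This is where N \<le> 9 is needed: the exponent
        \<open>1 - 4 * N / 19\<close> stays above -1.\<close>
      show "- 17 / 19 \<le> 15 * real N / 19 - real (N - 1)" using N by (simp add: of_nat_diff)
    qed (use r rho in auto)
    finally show ?thesis .
  qed
  let ?g = "\<lambda>r. u r + D * (19 / 2 * r powr (2 / 19))"
  have "u 0 \<le> ?g \<rho>0"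
  proof (rule right_limit_le[where A=0 and B=\<rho> and f="?g" and f'="\<lambda>r. u' r + D * r powr (- 17 / 19)"])
    fix r assume r: "0 < r" "r < \<rho>"
    show "(?g has_real_derivative u' r + D * r powr (- 17 / 19)) (at r) \<and> 0 \<le> u' r + D * r powr (- 17 / 19)"
      using u'le[of r] r rho
      by (auto intro!: derivative_eq_intros radial_odeD(2)[OF u])
  next
    have "(?g \<longlongrightarrow> u 0 + D * (19 / 2 * 0 powr (2 / 19))) (at_right 0)"
      by (intro tendsto_intros radial_odeD(4)[OF u] tendsto_powr'[OF tendsto_ident_at tendsto_const]) (auto simp: eventually_at_filter)
    then show "(?g \<longlongrightarrow> u 0) (at_right 0)" by simp
  qed (use rho0 in auto)
  also have "\<dots> \<le> 1 + D * (19 / 2 * 1)"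
    using rho0 rho D by (intro add_mono mult_left_mono powr_le1) auto
  \<comment> \<open>\<open>19 / 2 * (64 * 8192 + 1)\<close> is just below five million.\<close>
  also have "\<dots> \<le> 1 + 10000000 * K1" using K1 by (simp add: D_def)
  finally show ?thesis by (simp add: K1_def)
qed

section \<open>Stability in dimension ten\<close>

lemma last_crossing:
  fixes f :: "real \<Rightarrow> real"
  assumes cont: "continuous_on {p..q} f" and "f p \<le> c" "c < f q" "p \<le> q"
  shows "\<exists>r. p \<le> r \<and> r < q \<and> f r = c \<and> (\<forall>x. r < x \<longrightarrow> x \<le> q \<longrightarrow> c < f x)"
proof -
  let ?S = "{x\<in>{p..q}. f x \<le> c}"
  have cl: "closed ?S" by (intro continuous_on_closed_Collect_le cont continuous_intros closed_atLeastAtMost)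
  have ne: "p \<in> ?S" using assms by auto
  have bd: "bdd_above ?S" by (intro bdd_aboveI[of _ q]) auto
  define r where "r = Sup ?S"
  have r: "r \<in> ?S" unfolding r_def using ne bd by (intro closed_contains_Sup[OF _ _ cl]) auto
  have gt: "c < f x" if "r < x" "x \<le> q" for x
  proof (rule ccontr)
    assume "\<not> c < f x"
    then have "x \<le> r" unfolding r_def using that r by (intro cSup_upper bd) auto
    then show False using that by simp
  qed
  have rq: "r < q" using r assms by (cases "r = q") auto
  have "(f \<longlongrightarrow> f r) (at_right r)"
    using tendsto_at_right_of_cont[OF continuous_on_subset[OF cont], of r q] r rq by auto
  then have "c \<le> f r"
  proof (rule tendsto_lowerbound)
    show "\<forall>\<^sub>F x in at_right r. c \<le> f x"
      using eventually_at_right_real[OF rq] by eventually_elim (use gt in \<open>auto intro: less_imp_le\<close>)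
  qed auto
  then show ?thesis using r rq gt by (intro exI[of _ r]) auto
qed

lemma first_crossing:
  fixes f :: "real \<Rightarrow> real"
  assumes cont: "continuous_on {p..q} f" and "f p < c" "c \<le> f q" "p \<le> q"
  shows "\<exists>r. p < r \<and> r \<le> q \<and> f r = c \<and> (\<forall>x. p \<le> x \<longrightarrow> x < r \<longrightarrow> f x < c)"
proof -
  have "continuous_on {- q..- p} (\<lambda>x. - f (- x))"
    by (intro continuous_intros continuous_on_compose2[OF cont]) auto
  then obtain r where r: "- q \<le> r" "r < - p" "- f (- r) = - c" "\<And>x. r < x \<Longrightarrow> x \<le> - p \<Longrightarrow> - c < - f (- x)"
    using last_crossing[of "- q" "- p" "\<lambda>x. - f (- x)" "- c"] assms by auto
  have "f x < c" if "p \<le> x" "x < - r" for x using r(4)[of "- x"] that by auto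
  then show ?thesis using r by (intro exI[of _ "- r"]) auto
qed

lemma continuous_on_of_deriv:
  fixes f :: "real \<Rightarrow> real"
  assumes "\<And>x. p \<le> x \<Longrightarrow> x \<le> q \<Longrightarrow> (f has_real_derivative f' x) (at x)"
  shows "continuous_on {p..q} f"
  using assms by (intro continuous_at_imp_continuous_on ballI) (auto intro: DERIV_isCont)

lemma deriv_nonneg_at_min_right:
  fixes f :: "real \<Rightarrow> real"
  assumes "(f has_real_derivative d) (at r)" "r < s" "\<And>x. r < x \<Longrightarrow> x < s \<Longrightarrow> f r \<le> f x"
  shows "0 \<le> d"
proof (rule ccontr)
  assume "\<not> 0 \<le> d"
  then obtain e where e: "e > 0" "\<forall>h>0. h < e \<longrightarrow> f (r + h) < f r"
    using DERIV_neg_dec_right[OF assms(1)] by auto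
  define h where "h = min e (s - r) / 2"
  have "0 < h" "h < e" "r + h < s" using e(1) assms(2) by (auto simp: h_def min_def field_simps)
  then have "f (r + h) < f r" "f r \<le> f (r + h)"
    using e(2) assms(3)[of "r + h"] by simp_all
  then show False by simp
qed

lemma deriv_nonpos_at_min_left:
  fixes f :: "real \<Rightarrow> real"
  assumes "(f has_real_derivative d) (at r)" "s < r" "\<And>x. s < x \<Longrightarrow> x < r \<Longrightarrow> f r \<le> f x"
  shows "d \<le> 0"
proof (rule ccontr)
  assume "\<not> d \<le> 0"
  then obtain e where e: "e > 0" "\<forall>h>0. h < e \<longrightarrow> f (r - h) < f r"
    using DERIV_pos_inc_left[OF assms(1)] by auto
  define h where "h = min e (r - s) / 2"
  have "0 < h" "h < e" "s < r - h" using e(1) assms(2) by (auto simp: h_def min_def field_simps)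
  then have "f (r - h) < f r" "f r \<le> f (r - h)"
    using e(2) assms(3)[of "r - h"] by simp_all
  then show False by simp
qed

section \<open>The logarithmic change of unknown\<close>

definition hardy_pot :: "real \<Rightarrow> real \<Rightarrow> real" where
  "hardy_pot H r = 16 / r\<^sup>2 + H"

definition log_sing :: "real \<Rightarrow> (real \<Rightarrow> real) \<Rightarrow> real \<Rightarrow> real" where
  "log_sing H u r = u r + 2 * ln r + H * r\<^sup>2 / 20"

definition log_sing1 :: "real \<Rightarrow> (real \<Rightarrow> real) \<Rightarrow> real \<Rightarrow> real" where
  "log_sing1 H u' r = u' r + 2 / r + H * r / 10"

lemma hardy_pot_pos: "H > 0 \<Longrightarrow> r \<noteq> 0 \<Longrightarrow> hardy_pot H r > 0"
  unfolding hardy_pot_def by (simp add: add_pos_pos)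

lemma log_sing_derivs:
  assumes u: "radial_ode 10 u u' Q" and r: "0 < r" "r < 1"
  shows "(log_sing H u has_real_derivative log_sing1 H u' r) (at r)"
    and "(log_sing1 H u' has_real_derivative - (Q r - hardy_pot H r) - 9 / r * log_sing1 H u' r) (at r)"
proof -
  show "(log_sing H u has_real_derivative log_sing1 H u' r) (at r)"
    unfolding log_sing_def[abs_def] log_sing1_def using r
    by (auto intro!: derivative_eq_intros radial_odeD(2)[OF u] simp: field_simps)
  have "(log_sing1 H u' has_real_derivative (- Q r - (real 10 - 1) / r * u' r) + - 2 / r\<^sup>2 + H / 10) (at r)"
    unfolding log_sing1_def[abs_def]
    by (intro DERIV_add radial_odeD(3)[OF u r])
       (use r in \<open>auto intro!: derivative_eq_intros simp: power2_eq_square field_simps\<close>)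
  then show "(log_sing1 H u' has_real_derivative - (Q r - hardy_pot H r) - 9 / r * log_sing1 H u' r) (at r)"
    by (rule DERIV_cong) (use r in \<open>simp add: hardy_pot_def log_sing1_def power2_eq_square field_simps\<close>)
qed

lemma log_sing_at_bot:
  assumes "radial_ode 10 u u' Q"
  shows "LIM r at_right 0. log_sing H u r :> at_bot"
proof -
  have "((\<lambda>r. H * r\<^sup>2 / 20) \<longlongrightarrow> H * 0\<^sup>2 / 20) (at_right 0)"
    by (intro tendsto_intros tendsto_ident_at) auto
  then have "((\<lambda>r. u r + H * r\<^sup>2 / 20) \<longlongrightarrow> u 0 + H * 0\<^sup>2 / 20) (at_right 0)"
    using radial_odeD(4)[OF assms] by (intro tendsto_add)
  moreover have "LIM r at_right 0. 2 * ln r :> (at_bot :: real filter)"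
    by (rule filterlim_tendsto_pos_mult_at_bot[OF tendsto_const _ ln_at_0]) simp
  ultimately have "LIM r at_right 0. (u r + H * r\<^sup>2 / 20) + 2 * ln r :> at_bot"
    by (rule filterlim_tendsto_add_at_bot_iff[THEN iffD2])
  then show ?thesis unfolding log_sing_def[abs_def] by (simp add: add_ac)
qed

lemma log_sing_flux_vanishing:
  assumes "radial_ode 10 u u' Q"
  shows "n \<ge> 2 \<Longrightarrow> ((\<lambda>r. r ^ n * log_sing1 H u' r) \<longlongrightarrow> 0) (at_right 0)"
    and "((\<lambda>r. r ^ 4 * log_sing H u r) \<longlongrightarrow> 0) (at_right 0)"
proof -
  assume n: "n \<ge> 2"
  have "((\<lambda>r. r ^ n * u' r + 2 * r ^ (n - 1) + H * r ^ (n + 1) / 10) \<longlongrightarrow> 0 + 2 * 0 + H * 0 / 10) (at_right 0)"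
    using n by (intro tendsto_intros radial_ode_vanishing(1)[OF assms] power_vanishing) auto
  moreover have "\<forall>\<^sub>F r in at_right 0. r ^ n * u' r + 2 * r ^ (n - 1) + H * r ^ (n + 1) / 10 = r ^ n * log_sing1 H u' r"
  proof -
    have "r ^ n * u' r + 2 * r ^ (n - 1) + H * r ^ (n + 1) / 10 = r ^ n * log_sing1 H u' r"
      if "r \<in> {0<..<1}" for r
    proof -
      have "r ^ n = r * r ^ (n - 1)" using n by (cases n) auto
      then show ?thesis using that by (simp add: log_sing1_def field_simps)
    qed
    then show ?thesis
      using eventually_at_right_real[of 0 1, OF zero_less_one] by (rule eventually_mono[rotated])
  qed
  ultimately show "((\<lambda>r. r ^ n * log_sing1 H u' r) \<longlongrightarrow> 0) (at_right 0)"
    using Lim_transform_eventually by fastforce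
next
  have "((\<lambda>r. r ^ 3 * (r * ln r)) \<longlongrightarrow> 0) (at_right (0::real))"
  proof (rule bounded_times_vanishing[OF power_vanishing])
    have "\<bar>r * ln r\<bar> \<le> 1" if "r \<in> {0<..<1}" for r :: real
    proof -
      have "- ln r \<le> 1 / r - 1" using ln_le_minus_one[of "1 / r"] that by (simp add: ln_div)
      then have "r * (- ln r) \<le> r * (1 / r - 1)" using that by (intro mult_left_mono) auto
      also have "\<dots> \<le> 1" using that by (simp add: field_simps)
      finally show ?thesis using that by (simp add: abs_mult)
    qed
    then show "\<forall>\<^sub>F r in at_right 0. \<bar>r * ln r\<bar> \<le> (1::real)"
      using eventually_at_right_real[of 0 1, OF zero_less_one] by (auto elim!: eventually_mono)
  qed simp
  then have "((\<lambda>r. r ^ 4 * u r + 2 * (r ^ 3 * (r * ln r)) + H * r ^ 6 / 20) \<longlongrightarrow> 0 * u 0 + 2 * 0 + H * 0 / 20) (at_right 0)"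
    by (intro tendsto_intros radial_odeD(4)[OF assms] power_vanishing) auto
  moreover have "r ^ 4 * u r + 2 * (r ^ 3 * (r * ln r)) + H * r ^ 6 / 20 = r ^ 4 * log_sing H u r" for r
    by (simp add: log_sing_def algebra_simps power_numeral_reduce)
  ultimately show "((\<lambda>r. r ^ 4 * log_sing H u r) \<longlongrightarrow> 0) (at_right 0)" by simp
qed

lemma exp_tangent_bound: "exp G - 1 \<le> exp G * G" for G :: real
proof -
  have "exp G * (1 - G) \<le> exp G * exp (- G)"
    using exp_ge_add_one_self[of "- G"] by (intro mult_left_mono) auto
  then show ?thesis by (simp add: exp_minus field_simps)
qed

text \<open>Here \<open>w\<close> is a positive supersolution of the linearised equation. A downward crossing of
  \<open>Q = V\<close> at \<open>r0\<close> makes \<open>z - z r0\<close> a subsolution that is positive on an interval to the left of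
  \<open>r0\<close> and vanishes at its ends, against which \<open>w\<close> cannot stay positive.\<close>

lemma subcritical_initial_segment:
  fixes \<beta> z w Q V k :: "real \<Rightarrow> real"
  assumes z: "\<And>r. 0 < r \<Longrightarrow> r < 1 \<Longrightarrow> (z has_real_derivative z' r) (at r)"
      "\<And>r. 0 < r \<Longrightarrow> r < 1 \<Longrightarrow> (z' has_real_derivative - (Q r - V r) - 9 / r * z' r) (at r)"
    and zbot: "LIM r at_right 0. z r :> at_bot"
    and \<beta>: "\<And>r. 0 < r \<Longrightarrow> r < 1 \<Longrightarrow> (\<beta> has_real_derivative d r) (at r) \<and> d r > 0"
    and Q: "\<And>r. 0 < r \<Longrightarrow> r < 1 \<Longrightarrow> Q r = V r * exp (\<beta> r + z r)"
    and V: "\<And>r. 0 < r \<Longrightarrow> r < 1 \<Longrightarrow> V r > 0"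
    and w: "radial_ode 10 w w' k" "\<And>r. 0 < r \<Longrightarrow> r < 1 \<Longrightarrow> w r > 0"
      "\<And>r. 0 < r \<Longrightarrow> r < 1 \<Longrightarrow> Q r * w r \<le> k r"
    and r: "0 < r" "r < t" "t < 1" "Q t < V t"
  shows "Q r < V r"
proof (rule ccontr)
  assume nless: "\<not> Q r < V r"
  define G where "G x = \<beta> x + z x" for x
  have sgn: "Q x < V x \<longleftrightarrow> G x < 0" if "0 < x" "x < 1" for x
    using Q[OF that] V[OF that] mult_less_cancel_left_pos[of "V x" "exp (G x)" 1] by (simp add: G_def)
  have dG: "(G has_real_derivative d x + z' x) (at x)" if "0 < x" "x < 1" for x
    unfolding G_def[abs_def] using \<beta>[OF that] z(1)[OF that] by (auto intro: DERIV_add)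
  have "continuous_on {r..t} (\<lambda>x. - G x)"
    by (intro continuous_on_minus continuous_on_of_deriv[OF dG]) (use r in auto)
  then obtain r0 where r0: "r \<le> r0" "r0 < t" "G r0 = 0" "\<And>x. r0 < x \<Longrightarrow> x \<le> t \<Longrightarrow> G x < 0"
    using last_crossing[of r t "\<lambda>x. - G x" 0] nless sgn[of r] sgn[of t] r by auto
  have r01: "0 < r0" "r0 < 1" using r0 r by auto
  \<comment> \<open>At the downward crossing \<open>d r0 + z' r0 \<le> 0\<close>; as d is positive,
    z itself must be strictly decreasing there.\<close>
  have "0 \<le> - (d r0 + z' r0)"
    by (rule deriv_nonneg_at_min_right[OF DERIV_minus[OF dG[OF r01]] r0(2)]) (use r0 in \<open>auto intro: less_imp_le\<close>)
  then have z'neg: "z' r0 < 0" using \<beta>[OF r01] by linarith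
  obtain e where e: "e > 0" "\<And>h. 0 < h \<Longrightarrow> h < e \<Longrightarrow> z r0 < z (r0 - h)"
    using DERIV_neg_dec_left[OF z(1)[OF r01] z'neg] by auto
  define e' where "e' = min e r0 / 2"
  have e': "0 < e'" "e' < e" "e' < r0" using e(1) r01 by (auto simp: e'_def)
  have "\<forall>\<^sub>F x in at_right 0. z x < z r0 \<and> x \<in> {0<..<r0 - e'}"
    using zbot eventually_at_right_real[of 0 "r0 - e'"] e'
    by (auto simp: filterlim_at_bot_dense eventually_conj_iff)
  then obtain x0 where x0: "z x0 < z r0" "0 < x0" "x0 < r0 - e'"
    using eventually_happens'[of "at_right (0::real)"] by auto
  \<comment> \<open>Since z tends to minus infinity at the origin, it lies below \<open>z r0\<close>
    somewhere to the left; the last crossing \<open>r2\<close> is the other end of the interval on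
    which z exceeds \<open>z r0\<close>.\<close>
  have "continuous_on {x0..r0 - e'} z"
    by (rule continuous_on_of_deriv[OF z(1)]) (use x0 e' r01 in auto)
  then obtain r2 where r2: "x0 \<le> r2" "r2 < r0 - e'" "z r2 = z r0"
      "\<And>x. r2 < x \<Longrightarrow> x \<le> r0 - e' \<Longrightarrow> z r0 < z x"
    using last_crossing[of x0 "r0 - e'" z "z r0"] x0 e(2)[of e'] e' by auto
  have zpos: "z r0 < z x" if "r2 < x" "x < r0" for x
    using r2(4)[of x] e(2)[of "r0 - x"] that e' by (cases "x \<le> r0 - e'") auto
  have r201: "0 < r2" "r2 < 1" "r2 < r0" using r2 x0 r01 e' by auto
  have z'r2: "0 \<le> z' r2"
    by (rule deriv_nonneg_at_min_right[OF z(1)[OF r201(1,2)] r201(3)]) (use zpos r2(3) in \<open>auto intro: less_imp_le\<close>)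
  define W where "W x = x ^ 9 * (z' x * w x - (z x - z r0) * w' x)" for x
  have dW: "(W has_real_derivative x ^ 9 * ((V x - Q x) * w x + (z x - z r0) * k x)) (at x)"
    if x: "0 < x" "x < 1" for x
    unfolding W_def[abs_def]
    by (rule derivative_eq_intros z(1)[OF x] z(2)[OF x] radial_odeD(2)[OF w(1) x] radial_odeD(3)[OF w(1) x] refl)+
      (use x in \<open>simp add: field_simps power_numeral_reduce\<close>)
  have "W r2 \<le> W r0"
  proof (rule DERIV_nonneg_imp_increasing_open[where f=W])
    fix x assume x: "r2 < x" "x < r0"
    then have x01: "0 < x" "x < 1" using r201 r01 by auto
    have zp: "z x - z r0 > 0" using zpos[OF x] by simp
    \<comment> \<open>Growth of \<beta> and \<open>G r0 = 0\<close> give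
      \<open>G x \<le> z x - z r0\<close>; \<open>exp_tangent_bound\<close> turns this into the
      subsolution inequality \<open>Q x - V x \<le> Q x * (z x - z r0)\<close>.\<close>
    have "\<beta> x < \<beta> r0"
      by (rule deriv_pos_mono[where A=0 and B=1 and f'=d, OF \<beta>]) (use x x01 r01 in auto)
    then have "G x \<le> z x - z r0" using r0(3) by (simp add: G_def)
    then have "exp (G x) - 1 \<le> exp (G x) * (z x - z r0)"
      by (intro order_trans[OF exp_tangent_bound mult_left_mono]) simp_all
    then have "V x * (exp (G x) - 1) \<le> V x * (exp (G x) * (z x - z r0))"
      using V[OF x01] by (intro mult_left_mono) auto
    then have "Q x - V x \<le> Q x * (z x - z r0)"
      using Q[OF x01] by (simp add: G_def algebra_simps)
    then have "(Q x - V x) * w x \<le> Q x * (z x - z r0) * w x"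
      using w(2)[OF x01] by (intro mult_right_mono) auto
    also have "\<dots> = (z x - z r0) * (Q x * w x)" by simp
    also have "\<dots> \<le> (z x - z r0) * k x"
      using w(3)[OF x01] zp by (intro mult_left_mono) auto
    finally have "0 \<le> x ^ 9 * ((V x - Q x) * w x + (z x - z r0) * k x)"
      using x01 by (intro mult_nonneg_nonneg) (auto simp: algebra_simps)
    then show "\<exists>y. (W has_real_derivative y) (at x) \<and> 0 \<le> y" using dW[OF x01] by blast
  next
    show "continuous_on {r2..r0} W"
      by (rule continuous_on_of_deriv[OF dW]) (use r201 r01 in auto)
  qed (use r201 in simp)
  moreover have "W r0 < 0" unfolding W_def using r01 z'neg w(2)[OF r01]
    by (simp add: mult_pos_neg mult_neg_pos)
  moreover have "W r2 \<ge> 0" unfolding W_def using r201 z'r2 w(2)[OF r201(1,2)] r2(3) by simp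
  ultimately show False by simp
qed

text \<open>This identity is the origin of \<open>a_H\<close>: the function whose
  \<open>log_sing\<close> is zero, \<open>- 2 * ln r - H * r\<^sup>2 / 20\<close>, has
  \<open>- \<Delta>\<close> equal to \<open>hardy_pot H\<close> and solves the equation for the
  weight \<open>a_H\<close> with l = 16.\<close>

lemma weight_factorisation:
  assumes "H > 0" "r > 0"
  shows "l * a r * exp (u r) = hardy_pot H r * (l / 16 * (a r / a_H H 10 r) * exp (log_sing H u r))"
proof -
  have p: "1 + H / 16 * r\<^sup>2 > 0" using assms by (simp add: add_pos_pos)
  have e: "exp (log_sing H u r) = exp (u r) * r\<^sup>2 * exp (H / 20 * r\<^sup>2)"
    using assms by (simp add: log_sing_def exp_add power2_eq_square flip: exp_double) (simp add: mult_exp_exp exp_double power2_eq_square)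
  have h: "hardy_pot H r * r\<^sup>2 = 16 * (1 + H / 16 * r\<^sup>2)"
    using assms by (simp add: hardy_pot_def field_simps)
  have "hardy_pot H r * (l / 16 * (a r / a_H H 10 r) * exp (log_sing H u r))
      = (hardy_pot H r * r\<^sup>2) * (l / 16 * (a r / ((1 + H / 16 * r\<^sup>2) * exp (H / 20 * r\<^sup>2))) * exp (u r) * exp (H / 20 * r\<^sup>2))"
    unfolding e a_H_def by simp
  also have "\<dots> = l * a r * exp (u r)" unfolding h using p by simp
  finally show ?thesis by simp
qed

text \<open>Below \<rho> the ratio Q / V is a constant times a / a_H, which increases, times exp z,
  which does not decrease. Going from \<rho> / 2 down to \<rho> / 4 therefore gains a factor
  \<theta> < 1 independent of u and l. It keeps \<open>Q * r\<^sup>2\<close> strictly below the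
  critical value 16, so exp u is of lower order than \<open>1 / r\<^sup>2\<close>, and integrating
  the equation once more bounds u at the origin.\<close>

lemma bounded_if_subcritical:
  fixes a :: "real \<Rightarrow> real"
  assumes H: "H > 0" and ca: "continuous_on {0..1} a" and apos: "\<And>r. 0 \<le> r \<Longrightarrow> r \<le> 1 \<Longrightarrow> a r > 0"
    and bmono: "\<And>r s. 0 < r \<Longrightarrow> r < s \<Longrightarrow> s < 1 \<Longrightarrow> a r / a_H H 10 r < a s / a_H H 10 s"
    and rho: "0 < \<rho>" "\<rho> < 1" and l0: "l0 > 0"
  shows "\<exists>C. \<forall>l u u'. l0 \<le> l \<longrightarrow> radial_ode 10 u u' (\<lambda>r. l * a r * exp (u r)) \<longrightarrow>
    (\<forall>r. 0 < r \<longrightarrow> r < \<rho> \<longrightarrow> l * a r * exp (u r) \<le> hardy_pot H r) \<longrightarrow> u 0 \<le> C"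
proof -
  define b where "b r = a r / a_H H 10 r" for r
  have aHpos: "a_H H 10 r > 0" for r
    unfolding a_H_def using H by (intro mult_pos_pos add_pos_nonneg) auto
  have bpos: "b r > 0" if "0 < r" "r < 1" for r
    unfolding b_def using apos[of r] that aHpos by simp
  define \<theta> where "\<theta> = b (\<rho> / 4) / b (\<rho> / 2)"
  have th: "0 < \<theta>" "\<theta> < 1"
    unfolding \<theta>_def using bmono[of "\<rho> / 4" "\<rho> / 2"] bpos[of "\<rho> / 2"] bpos[of "\<rho> / 4"] rho
    by (auto simp: b_def[symmetric])
  define \<tau> where "\<tau> = 1 - \<theta>"
  have tau: "0 < \<tau>" "\<tau> < 1" using th by (auto simp: \<tau>_def)
  \<comment> \<open>On (0, \<rho>1) the term \<open>H * r\<^sup>2\<close> is at most \<tau>, so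
    \<open>Q r * r\<^sup>2 \<le> 16 * \<theta> + \<tau> \<le> 8 * (2 - \<tau>)\<close>. The 8 is N -
    2, the exponent in the comparison flux \<open>(2 - \<tau>) * r ^ 8\<close>.\<close>
  define \<rho>1 where "\<rho>1 = min (\<rho> / 4) (\<tau> / (H + 1))"
  have "\<rho>1 \<le> \<tau> / (H + 1)" by (simp add: \<rho>1_def)
  then have "\<rho>1 * (H + 1) \<le> \<tau>" using H by (simp add: pos_le_divide_eq)
  moreover have "\<rho>1 \<le> \<rho> / 4" unfolding \<rho>1_def by (rule min.cobounded1)
  moreover from this have "\<rho>1 < 1" using rho by linarith
  moreover have "0 < \<rho>1" using rho tau H by (simp add: \<rho>1_def)
  ultimately have rho1: "0 < \<rho>1" "\<rho>1 \<le> \<rho> / 4" "\<rho>1 < 1" "\<rho>1 * (H + 1) \<le> \<tau>" by blast+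
  obtain xm where xm: "xm \<in> {0..1}" "\<forall>y\<in>{0..1}. a xm \<le> a y"
    using continuous_attains_inf[OF _ _ ca] by auto
  define am where "am = a xm"
  have am: "am > 0" "\<And>r. 0 \<le> r \<Longrightarrow> r \<le> 1 \<Longrightarrow> am \<le> a r"
    using xm apos by (auto simp: am_def)
  obtain xM where xM: "xM \<in> {0..1}" "\<forall>y\<in>{0..1}. a y \<le> a xM"
    using continuous_attains_sup[OF _ _ ca] by auto
  define AM where "AM = a xM"
  have AM: "\<And>r. 0 \<le> r \<Longrightarrow> r \<le> 1 \<Longrightarrow> a r \<le> AM" using xM by (auto simp: AM_def)
  define \<rho>2 where "\<rho>2 = \<rho>1 / 2"
  define \<rho>3 where "\<rho>3 = \<rho>1 / 4"
  have rho23: "0 < \<rho>3" "\<rho>3 < \<rho>2" "\<rho>2 < \<rho>1" using rho1 by (auto simp: \<rho>2_def \<rho>3_def)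
  \<comment> \<open>The value at \<rho>2 is controlled by
    \<open>l * am * exp (u \<rho>2) \<le> hardy_pot H \<rho>2\<close>, and \<open>AM / am\<close>
    transfers it to smaller radii; so C1 depends neither on l nor on u.\<close>
  define C1 where "C1 = hardy_pot H \<rho>2 * (AM / am) * exp ((2 - \<tau>) * ln \<rho>2)"
  have AMpos: "AM > 0" using AM[of 0] apos[of 0] by linarith
  have C1: "C1 \<ge> 0"
    unfolding C1_def using AMpos am(1) hardy_pot_pos[OF H, of \<rho>2] rho23 by simp
  show ?thesis
  proof (intro exI[of _ "hardy_pot H \<rho>3 / (l0 * am) + C1 / \<tau>"] allI impI)
    fix l u u'
    assume l: "l0 \<le> l" and u: "radial_ode 10 u u' (\<lambda>r. l * a r * exp (u r))"
      and sub: "\<forall>r. 0 < r \<longrightarrow> r < \<rho> \<longrightarrow> l * a r * exp (u r) \<le> hardy_pot H r"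
    define Q where "Q r = l * a r * exp (u r)" for r
    define z where "z = log_sing H u"
    define z1 where "z1 = log_sing1 H u'"
    have u: "radial_ode 10 u u' Q" using u unfolding Q_def[abs_def] .
    have lp: "l > 0" using l l0 by simp
    have Qpos: "Q r > 0" if "0 \<le> r" "r \<le> 1" for r using apos[OF that] lp by (simp add: Q_def)
    have Qz: "Q r = hardy_pot H r * (l / 16 * b r * exp (z r))" if "0 < r" for r
      unfolding Q_def b_def z_def using weight_factorisation[OF H that] .
    note dz = log_sing_derivs[OF u, where H=H, folded z_def z1_def]
    have z1nn: "0 \<le> z1 r" if r: "0 < r" "r < \<rho>" for r
    proof -
      let ?f = "\<lambda>r. r ^ 9 * z1 r"
      have "0 \<le> ?f r"
      proof (rule right_limit_le[where A=0 and B=\<rho> and f="?f" and f'="\<lambda>r. r ^ 9 * (hardy_pot H r - Q r)"])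
        fix x assume x: "0 < x" "x < \<rho>"
        then have x1: "x < 1" using rho by simp
        have "(?f has_real_derivative x ^ 9 * (hardy_pot H x - Q x)) (at x)"
          by (rule derivative_eq_intros dz(2)[OF x(1) x1] refl)+
            (use x in \<open>simp add: field_simps power_numeral_reduce\<close>)
        then show "(?f has_real_derivative x ^ 9 * (hardy_pot H x - Q x)) (at x) \<and> 0 \<le> x ^ 9 * (hardy_pot H x - Q x)"
          using sub x by (simp add: Q_def)
      next
        show "(?f \<longlongrightarrow> 0) (at_right 0)"
          unfolding z1_def by (rule log_sing_flux_vanishing(1)[OF u]) simp
      qed (use r in auto)
      then show ?thesis using r by (simp add: zero_le_mult_iff)
    qed
    have zmono: "z r \<le> z s" if "0 < r" "r \<le> s" "s < \<rho>" for r s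
      by (rule deriv_nonneg_mono[where A=0 and B=\<rho> and f'=z1]) (use that rho dz z1nn in auto)
    have Qle: "Q r * r\<^sup>2 \<le> 8 * (2 - \<tau>)" if r: "0 < r" "r < \<rho>1" for r
    proof -
      have "b r \<le> b (\<rho> / 4)"
        using bmono[of r "\<rho> / 4"] r rho1 rho by (simp add: b_def)
      moreover have "exp (z r) \<le> exp (z (\<rho> / 2))" using zmono[of r "\<rho> / 2"] r rho1 rho by simp
      ultimately have "l / 16 * b r * exp (z r) \<le> l / 16 * b (\<rho> / 4) * exp (z (\<rho> / 2))"
        using lp bpos[of r] bpos[of "\<rho> / 4"] r rho1 rho by (intro mult_mono) auto
      also have "\<dots> = \<theta> * (l / 16 * b (\<rho> / 2) * exp (z (\<rho> / 2)))"
        unfolding \<theta>_def using bpos[of "\<rho> / 2"] rho by simp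
      also have "\<dots> \<le> \<theta> * 1"
      proof (intro mult_left_mono)
        have "hardy_pot H (\<rho> / 2) * (l / 16 * b (\<rho> / 2) * exp (z (\<rho> / 2))) \<le> hardy_pot H (\<rho> / 2) * 1"
          using sub[rule_format, of "\<rho> / 2", folded Q_def] rho Qz[of "\<rho> / 2"] by simp
        then show "l / 16 * b (\<rho> / 2) * exp (z (\<rho> / 2)) \<le> 1"
          using hardy_pot_pos[OF H, of "\<rho> / 2"] rho by (simp only: mult_le_cancel_left_pos)
      qed (use th in simp)
      finally have "Q r \<le> hardy_pot H r * \<theta>"
        unfolding Qz[OF r(1)] using r hardy_pot_pos[OF H, of r] by (intro mult_left_mono) auto
      then have "Q r * r\<^sup>2 \<le> hardy_pot H r * \<theta> * r\<^sup>2" by (intro mult_right_mono) auto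
      also have "\<dots> = \<theta> * (16 + H * (r * r))" using r by (simp add: hardy_pot_def field_simps power2_eq_square)
      also have "\<dots> \<le> \<theta> * 16 + 1 * (H * (r * r))"
        unfolding distrib_left using th H by (intro add_mono mult_right_mono) simp_all
      also have "H * (r * r) \<le> H * (\<rho>1 * 1)"
        using r rho1 H by (intro mult_left_mono mult_mono) auto
      also have "H * (\<rho>1 * 1) \<le> \<tau>" using rho1 by (simp add: algebra_simps)
      finally show ?thesis using tau by (simp add: \<tau>_def)
    qed
    have u1ge: "0 \<le> u' r + (2 - \<tau>) / r" if r: "0 < r" "r < \<rho>1" for r
    proof -
      let ?f = "\<lambda>r. r ^ 9 * u' r + (2 - \<tau>) * r ^ 8"
      have "0 \<le> ?f r"
      proof (rule right_limit_le[where A=0 and B=\<rho>1 and f="?f" and f'="\<lambda>r. r ^ 7 * (8 * (2 - \<tau>) - Q r * r\<^sup>2)"])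
        fix x assume x: "0 < x" "x < \<rho>1"
        then have x1: "x < 1" using rho1 by simp
        have "(?f has_real_derivative - (x ^ (10 - 1) * Q x) + (2 - \<tau>) * (8 * x ^ 7)) (at x)"
          using DERIV_add[OF radial_ode_flux[OF u _ x(1) x1] DERIV_cmult[OF DERIV_pow[of 8 x]], of "2 - \<tau>"] by simp
        then have "(?f has_real_derivative x ^ 7 * (8 * (2 - \<tau>) - Q x * x\<^sup>2)) (at x)"
          by (rule DERIV_cong) (simp add: algebra_simps power_numeral_reduce)
        then show "(?f has_real_derivative x ^ 7 * (8 * (2 - \<tau>) - Q x * x\<^sup>2)) (at x) \<and> 0 \<le> x ^ 7 * (8 * (2 - \<tau>) - Q x * x\<^sup>2)"
          using Qle[OF x] x by simp
      next
        have "(?f \<longlongrightarrow> 0 + (2 - \<tau>) * 0) (at_right 0)"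
          by (intro tendsto_intros radial_ode_vanishing(1)[OF u] power_vanishing) auto
        then show "(?f \<longlongrightarrow> 0) (at_right 0)" by simp
      qed (use r in auto)
      also have "?f r = r ^ 9 * (u' r + (2 - \<tau>) / r)"
        using r by (simp add: field_simps power_numeral_reduce)
      finally show ?thesis using r by (simp add: zero_le_mult_iff)
    qed
    have Qle2: "Q r \<le> C1 * r powr (\<tau> - 2)" if r: "0 < r" "r < \<rho>2" for r
    proof -
      let ?f = "\<lambda>r. u r + (2 - \<tau>) * ln r"
      have "?f r \<le> ?f \<rho>2"
      proof (rule deriv_nonneg_mono[where A=0 and B=\<rho>1 and f="?f" and f'="\<lambda>r. u' r + (2 - \<tau>) * (1 / r)"])
        fix x assume x: "0 < x" "x < \<rho>1"
        show "(?f has_real_derivative u' x + (2 - \<tau>) * (1 / x)) (at x) \<and> 0 \<le> u' x + (2 - \<tau>) * (1 / x)"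
          using u1ge[OF x] x rho1 by (auto intro!: derivative_eq_intros radial_odeD(2)[OF u])
      qed (use r rho23 in auto)
      then have "exp (u r) \<le> exp (u \<rho>2 + ((2 - \<tau>) * ln \<rho>2 + (\<tau> - 2) * ln r))" by (simp add: algebra_simps)
      also have "\<dots> = exp (u \<rho>2) * (exp ((2 - \<tau>) * ln \<rho>2) * r powr (\<tau> - 2))"
        unfolding exp_add using r by (simp add: powr_def)
      finally have "Q r \<le> l * AM * (exp (u \<rho>2) * (exp ((2 - \<tau>) * ln \<rho>2) * r powr (\<tau> - 2)))"
        unfolding Q_def using lp AM[of r] apos[of r] r rho23 rho1 by (intro mult_mono) auto
      also have "\<dots> = (l * am * exp (u \<rho>2)) * ((AM / am) * exp ((2 - \<tau>) * ln \<rho>2) * r powr (\<tau> - 2))"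
        using am(1) by simp
      also have "\<dots> \<le> hardy_pot H \<rho>2 * ((AM / am) * exp ((2 - \<tau>) * ln \<rho>2) * r powr (\<tau> - 2))"
      proof (intro mult_right_mono)
        have "l * am * exp (u \<rho>2) \<le> Q \<rho>2"
          unfolding Q_def using lp am(2)[of \<rho>2] rho23 rho1 by (intro mult_right_mono mult_left_mono) auto
        also have "\<dots> \<le> hardy_pot H \<rho>2" using sub rho23 rho1 rho by (simp add: Q_def)
        finally show "l * am * exp (u \<rho>2) \<le> hardy_pot H \<rho>2" .
      qed (use AMpos am(1) in auto)
      also have "\<dots> = C1 * r powr (\<tau> - 2)" by (simp add: C1_def)
      finally show ?thesis .
    qed
    have u1ge2: "0 \<le> u' r + C1 * r powr (\<tau> - 1)" if r: "0 < r" "r < \<rho>2" for r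
    proof -
      let ?f = "\<lambda>r. r ^ 9 * u' r + C1 * r powr (8 + \<tau>)"
      have "0 \<le> ?f r"
      proof (rule right_limit_le[where A=0 and B=\<rho>2 and f="?f" and f'="\<lambda>r. - (r ^ 9 * Q r) + C1 * ((8 + \<tau>) * r powr (7 + \<tau>))"])
        fix x assume x: "0 < x" "x < \<rho>2"
        then have x1: "x < 1" using rho1 rho23 by simp
        have d: "(?f has_real_derivative - (x ^ 9 * Q x) + C1 * ((8 + \<tau>) * x powr (7 + \<tau>))) (at x)"
        proof (rule DERIV_add)
          show "((\<lambda>r. r ^ 9 * u' r) has_real_derivative - (x ^ 9 * Q x)) (at x)"
            using radial_ode_flux[OF u _ x(1) x1] by simp
          show "((\<lambda>r. C1 * r powr (8 + \<tau>)) has_real_derivative C1 * ((8 + \<tau>) * x powr (7 + \<tau>))) (at x)"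
            using x by (auto intro!: derivative_eq_intros simp: algebra_simps)
        qed
        have "x ^ 9 * Q x \<le> x ^ 9 * (C1 * x powr (\<tau> - 2))" using Qle2[OF x] x by (intro mult_left_mono) auto
        also have "\<dots> = C1 * (x powr 9 * x powr (\<tau> - 2))" using x by (simp add: powr_numeral)
        also have "\<dots> = C1 * (1 * x powr (7 + \<tau>))" by (simp flip: powr_add)
        also have "\<dots> \<le> C1 * ((8 + \<tau>) * x powr (7 + \<tau>))" using C1 tau by (intro mult_left_mono mult_right_mono) auto
        finally show "(?f has_real_derivative - (x ^ 9 * Q x) + C1 * ((8 + \<tau>) * x powr (7 + \<tau>))) (at x) \<and>
            0 \<le> - (x ^ 9 * Q x) + C1 * ((8 + \<tau>) * x powr (7 + \<tau>))" using d by simp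
      next
        have "(?f \<longlongrightarrow> 0 + C1 * 0 powr (8 + \<tau>)) (at_right 0)"
          using tau by (intro tendsto_intros radial_ode_vanishing(1)[OF u] power_vanishing
              tendsto_powr'[OF tendsto_ident_at tendsto_const]) (auto simp: eventually_at_filter)
        then show "(?f \<longlongrightarrow> 0) (at_right 0)" by simp
      qed (use r in auto)
      also have "?f r = r ^ 9 * (u' r + C1 * r powr (\<tau> - 1))"
      proof -
        have "r powr (8 + \<tau>) = r powr 9 * r powr (\<tau> - 1)" by (simp flip: powr_add)
        then show ?thesis using r by (simp add: powr_numeral algebra_simps)
      qed
      finally show ?thesis using r by (simp add: zero_le_mult_iff)
    qed
    let ?f = "\<lambda>r. u r + C1 / \<tau> * r powr \<tau>"
    have "u 0 \<le> ?f \<rho>3"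
    proof (rule right_limit_le[where A=0 and B=\<rho>2 and f="?f" and f'="\<lambda>r. u' r + C1 * r powr (\<tau> - 1)"])
      fix x assume x: "0 < x" "x < \<rho>2"
      show "(?f has_real_derivative u' x + C1 * x powr (\<tau> - 1)) (at x) \<and> 0 \<le> u' x + C1 * x powr (\<tau> - 1)"
        using u1ge2[OF x] x rho1 rho23 tau
        by (auto intro!: derivative_eq_intros radial_odeD(2)[OF u])
    next
      have "(?f \<longlongrightarrow> u 0 + C1 / \<tau> * 0 powr \<tau>) (at_right 0)"
        using tau by (intro tendsto_intros radial_odeD(4)[OF u]
            tendsto_powr'[OF tendsto_ident_at tendsto_const]) (auto simp: eventually_at_filter)
      then show "(?f \<longlongrightarrow> u 0) (at_right 0)" by simp
    qed (use rho23 in auto)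
    also have "\<dots> \<le> hardy_pot H \<rho>3 / (l0 * am) + C1 / \<tau> * 1"
    proof (intro add_mono mult_left_mono)
      have "l0 * am * exp (u \<rho>3) \<le> Q \<rho>3"
        unfolding Q_def using l l0 am(1) am(2)[of \<rho>3] rho23 rho1 by (intro mult_right_mono mult_mono) auto
      also have "\<dots> \<le> hardy_pot H \<rho>3" using sub rho23 rho1 rho by (simp add: Q_def)
      finally have "exp (u \<rho>3) \<le> hardy_pot H \<rho>3 / (l0 * am)"
        using l0 am(1) by (simp add: field_simps)
      then show "u \<rho>3 \<le> hardy_pot H \<rho>3 / (l0 * am)" using exp_ge_add_one_self[of "u \<rho>3"] by linarith
      show "\<rho>3 powr \<tau> \<le> 1" using rho23 rho1 tau by (intro powr_le1) auto
    qed (use C1 tau in auto)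
    finally show "u 0 \<le> hardy_pot H \<rho>3 / (l0 * am) + C1 / \<tau>" by simp
  qed
qed

section \<open>Comparison with the Hardy ground state\<close>

locale bessel_zero =
  fixes H :: real
  assumes H_pos: "H > 0" and bessel_H: "bessel_fn H = 0"
    and bessel_pos: "\<And>x. 0 \<le> x \<Longrightarrow> x < H \<Longrightarrow> bessel_fn x > 0"
begin

text \<open>\<open>r powr -4 * psi r\<close> solves \<open>- \<Delta> \<Phi> = hardy_pot H \<Phi>\<close> radially in dimension ten.\<close>

definition psi :: "real \<Rightarrow> real" where "psi r = bessel_fn (H * r\<^sup>2)"
definition psi1 :: "real \<Rightarrow> real" where "psi1 r = 2 * H * r * bessel_fn1 (H * r\<^sup>2)"

lemma psi_deriv: "(psi has_real_derivative psi1 r) (at r)"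
  unfolding psi_def[abs_def] psi1_def
  by (rule DERIV_chain2[where f=bessel_fn, OF bessel_fn_deriv, THEN DERIV_cong])
    (auto intro!: derivative_eq_intros)

lemma psi1_deriv: "r > 0 \<Longrightarrow> (psi1 has_real_derivative - H * psi r - psi1 r / r) (at r)"
proof -
  assume r: "r > 0"
  have "((\<lambda>r. bessel_fn1 (H * r\<^sup>2)) has_real_derivative bessel_fn2 (H * r\<^sup>2) * (2 * H * r)) (at r)"
    by (rule DERIV_chain2[where f=bessel_fn1, OF bessel_fn1_deriv]) (auto intro!: derivative_eq_intros)
  then have "(psi1 has_real_derivative 2 * H * bessel_fn1 (H * r\<^sup>2)
      + bessel_fn2 (H * r\<^sup>2) * (2 * H * r) * (2 * H * r)) (at r)"
    unfolding psi1_def[abs_def] by (auto intro!: derivative_eq_intros)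
  also have "2 * H * bessel_fn1 (H * r\<^sup>2) + bessel_fn2 (H * r\<^sup>2) * (2 * H * r) * (2 * H * r)
      = 4 * H * (H * r\<^sup>2 * bessel_fn2 (H * r\<^sup>2) + bessel_fn1 (H * r\<^sup>2)) - 2 * H * bessel_fn1 (H * r\<^sup>2)"
    by (simp add: power2_eq_square algebra_simps)
  also have "H * r\<^sup>2 * bessel_fn2 (H * r\<^sup>2) + bessel_fn1 (H * r\<^sup>2) = - psi r / 4"
    using bessel_fn_ode[of "H * r\<^sup>2"] by (simp add: psi_def)
  finally show ?thesis using r by (simp add: psi1_def[of r] mult.assoc)
qed

lemma psi_cont: "continuous_on S psi"
  using psi_deriv by (intro continuous_at_imp_continuous_on ballI) (auto intro: DERIV_isCont)

lemma psi1_cont: "continuous_on S psi1"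
  unfolding psi1_def
  by (intro continuous_intros continuous_on_compose2[OF bessel_fn1_cont[of UNIV]]) auto

lemma psi_pos: "0 \<le> r \<Longrightarrow> r < 1 \<Longrightarrow> psi r > 0"
proof -
  assume r: "0 \<le> r" "r < 1"
  then have "r\<^sup>2 < 1" by (simp add: power_less_one_iff)
  then show ?thesis unfolding psi_def using H_pos by (intro bessel_pos) auto
qed

lemma psi_1: "psi 1 = 0" by (simp add: psi_def bessel_H)

lemma psi_psi1_lims:
  "(psi \<longlongrightarrow> psi 0) (at_right 0)" "(psi1 \<longlongrightarrow> psi1 0) (at_right 0)"
  "(psi \<longlongrightarrow> 0) (at_left 1)" "(psi1 \<longlongrightarrow> psi1 1) (at_left 1)"
  using tendsto_at_right_of_cont[OF psi_cont[of "{0..1}"]] tendsto_at_right_of_cont[OF psi1_cont[of "{0..1}"]]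
    tendsto_at_left_of_cont[OF psi_cont[of "{0..1}"]] tendsto_at_left_of_cont[OF psi1_cont[of "{0..1}"]]
  by (auto simp: psi_1)

text \<open>The Wronskian \<open>r ^ 9 * (\<eta>' \<Phi> - \<eta> \<Phi>')\<close> for \<open>\<Phi> = r powr -4 * psi r\<close>.\<close>

definition wronsk :: "(real \<Rightarrow> real) \<Rightarrow> (real \<Rightarrow> real) \<Rightarrow> real \<Rightarrow> real" where
  "wronsk \<eta> \<eta>1 r = r ^ 5 * \<eta>1 r * psi r + 4 * (r ^ 4 * \<eta> r) * psi r - r ^ 5 * \<eta> r * psi1 r"

lemma wronsk_deriv:
  assumes "(\<eta> has_real_derivative \<eta>1 r) (at r)"
    and "(\<eta>1 has_real_derivative - k - 9 / r * \<eta>1 r) (at r)" and r: "r > 0"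
  shows "(wronsk \<eta> \<eta>1 has_real_derivative r ^ 5 * psi r * (hardy_pot H r * \<eta> r - k)) (at r)"
  unfolding wronsk_def[abs_def]
  by (rule derivative_eq_intros assms psi_deriv psi1_deriv refl)+
    (use r in \<open>simp add: hardy_pot_def field_simps power_numeral_reduce\<close>)

lemma wronsk_right_0:
  assumes "((\<lambda>r. r ^ 5 * \<eta>1 r) \<longlongrightarrow> 0) (at_right 0)" "((\<lambda>r. r ^ 4 * \<eta> r) \<longlongrightarrow> 0) (at_right 0)"
  shows "(wronsk \<eta> \<eta>1 \<longlongrightarrow> 0) (at_right 0)"
proof -
  have "((\<lambda>r. r ^ 5 * \<eta>1 r * psi r + 4 * (r ^ 4 * \<eta> r) * psi r - r * (r ^ 4 * \<eta> r) * psi1 r)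
      \<longlongrightarrow> 0 * psi 0 + 4 * 0 * psi 0 - 0 * 0 * psi1 0) (at_right 0)"
    by (intro tendsto_intros assms psi_psi1_lims)
  moreover have "r * (r ^ 4 * \<eta> r) = r ^ 5 * \<eta> r" for r by (simp add: power_numeral_reduce)
  ultimately show ?thesis unfolding wronsk_def[abs_def] by simp
qed

text \<open>The derivative \<open>\<eta>1\<close> is merely bounded near 1; its term disappears
  because of the factor \<open>psi\<close>, which vanishes at 1.\<close>

lemma wronsk_left_1:
  assumes "radial_ode N \<eta> \<eta>1 k" "\<eta> 1 = 0"
  shows "(wronsk \<eta> \<eta>1 \<longlongrightarrow> 0) (at_left 1)"
proof -
  have l: "((\<lambda>r. r ^ 5 * psi r) \<longlongrightarrow> 1 ^ 5 * 0) (at_left 1)"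
    by (intro tendsto_intros psi_psi1_lims)
  then have "((\<lambda>r. (r ^ 5 * psi r) * \<eta>1 r) \<longlongrightarrow> 0) (at_left 1)"
    by (intro radial_ode_vanishing(2)[OF assms(1)]) simp
  moreover have "(\<eta> \<longlongrightarrow> 0) (at_left 1)" using radial_odeD(5)[OF assms(1)] assms(2) by simp
  ultimately have "((\<lambda>r. (r ^ 5 * psi r) * \<eta>1 r + 4 * (r ^ 4 * \<eta> r) * psi r - r ^ 5 * \<eta> r * psi1 r)
      \<longlongrightarrow> 0 + 4 * (1 ^ 4 * 0) * 0 - 1 ^ 5 * 0 * psi1 1) (at_left 1)"
    by (intro tendsto_intros psi_psi1_lims)
  then show ?thesis unfolding wronsk_def[abs_def] by (simp add: mult_ac)
qed

text \<open>The Wronskian with the positive ground state starts at zero and increases strictly. The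
  lemma serves indirect arguments: at the first zero of a positive \<eta> the Wronskian would have
  to be nonpositive.\<close>

lemma hardy_wronskian:
  assumes r0: "0 < r0" "r0 \<le> 1"
    and d: "\<And>r. 0 < r \<Longrightarrow> r < r0 \<Longrightarrow> (\<eta> has_real_derivative \<eta>1 r) (at r)"
      "\<And>r. 0 < r \<Longrightarrow> r < r0 \<Longrightarrow> (\<eta>1 has_real_derivative - k r - 9 / r * \<eta>1 r) (at r)"
    and k: "\<And>r. 0 < r \<Longrightarrow> r < r0 \<Longrightarrow> k r < hardy_pot H r * \<eta> r"
    and lims: "(wronsk \<eta> \<eta>1 \<longlongrightarrow> 0) (at_right 0)" "(wronsk \<eta> \<eta>1 \<longlongrightarrow> c) (at_left r0)"
  shows "c > 0"
proof -
  have D: "(wronsk \<eta> \<eta>1 has_real_derivative r ^ 5 * psi r * (hardy_pot H r * \<eta> r - k r)) (at r) \<and>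
      0 < r ^ 5 * psi r * (hardy_pot H r * \<eta> r - k r)" if "0 < r" "r < r0" for r
    using wronsk_deriv[where k="k r", OF d[OF that]] that k[OF that] psi_pos[of r] r0 by simp
  have "0 < wronsk \<eta> \<eta>1 (r0 / 2)" by (rule right_limit_less[where A=0 and B=r0, OF D lims(1)]) (use r0 in auto)
  also have "\<dots> < c" by (rule less_left_limit[where A=0 and B=r0, OF D lims(2)]) (use r0 in auto)
  finally show ?thesis .
qed

text \<open>The quotient \<open>q = r ^ 4 * w / psi\<close> of \<open>w\<close> and the ground state increases, and its growth on
  \<open>[\<rho>, p]\<close> is at least \<open>q p\<close> times a multiple of \<open>ln (p / \<rho>)\<close>, while \<open>q > 0\<close>.\<close>

lemma supercritical_region_bound:
  assumes p: "0 < p" "p < p1" "p1 < 1" and \<delta>: "\<delta> > 0"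
  shows "\<exists>\<rho>. 0 < \<rho> \<and> \<rho> < 1 \<and> (\<forall>w w' k Q r. radial_ode 10 w w' k \<longrightarrow> w 1 = 0 \<longrightarrow>
    (\<forall>x. 0 < x \<longrightarrow> x < 1 \<longrightarrow> w x > 0 \<and> Q x * w x \<le> k x) \<longrightarrow>
    (\<forall>x. p \<le> x \<longrightarrow> x \<le> p1 \<longrightarrow> hardy_pot H x + \<delta> \<le> Q x) \<longrightarrow>
    (\<forall>x. r < x \<longrightarrow> x < 1 \<longrightarrow> hardy_pot H x \<le> Q x) \<longrightarrow> 0 < r \<longrightarrow> \<rho> \<le> r)"
proof -
  have "\<exists>x\<in>{p..p1}. \<forall>y\<in>{p..p1}. x * (psi x)\<^sup>2 \<le> y * (psi y)\<^sup>2"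
    by (rule continuous_attains_inf) (use p in \<open>auto intro!: continuous_intros psi_cont\<close>)
  then obtain xm where xm: "xm \<in> {p..p1}" "\<And>y. y \<in> {p..p1} \<Longrightarrow> xm * (psi xm)\<^sup>2 \<le> y * (psi y)\<^sup>2" by blast
  define m where "m = xm * (psi xm)\<^sup>2"
  have m: "m > 0" unfolding m_def using xm(1) p psi_pos[of xm] by simp
  have "\<exists>x\<in>{0..1}. \<forall>y\<in>{0..1}. (psi y)\<^sup>2 \<le> (psi x)\<^sup>2"
    by (rule continuous_attains_sup) (auto intro!: continuous_intros psi_cont)
  then obtain xM where xM: "xM \<in> {0..1}" "\<And>y. y \<in> {0..1} \<Longrightarrow> (psi y)\<^sup>2 \<le> (psi xM)\<^sup>2" by blast
  define M where "M = (psi xM)\<^sup>2"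
  have M: "M > 0" unfolding M_def using xM(2)[of 0] psi_pos[of 0] by (intro less_le_trans[OF _ xM(2)[of 0]]) auto
  define \<kappa> where "\<kappa> = \<delta> * m * (p1 - p)"
  have kap: "\<kappa> > 0" using \<delta> m p by (simp add: \<kappa>_def)
  \<comment> \<open>For r < \<rho> one has \<open>ln (p / (2 * r)) \<ge> M / \<kappa>\<close>, so
    the forced growth of q on [2 r, p] would already amount to \<open>q p\<close>. The factor 2 is
    there because the estimates hold only strictly to the right of r.\<close>
  define \<rho> where "\<rho> = p * exp (- M / \<kappa>) / 2"
  have ex: "exp (- M / \<kappa>) < 1" using M kap by simp
  have rho: "0 < \<rho>" "2 * \<rho> < p" "\<rho> < 1"
  proof -
    have "2 * \<rho> < p" using mult_strict_left_mono[OF ex p(1)] by (simp add: \<rho>_def)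
    moreover have "0 < \<rho>" using p by (simp add: \<rho>_def)
    ultimately show "0 < \<rho>" "2 * \<rho> < p" "\<rho> < 1" using p by linarith+
  qed
  show ?thesis
  proof (intro exI[of _ \<rho>] conjI rho allI impI)
    fix w w' k Q :: "real \<Rightarrow> real" and r :: real
    assume w: "radial_ode 10 w w' k" and w1: "w 1 = 0"
      and wk: "\<forall>x. 0 < x \<longrightarrow> x < 1 \<longrightarrow> w x > 0 \<and> Q x * w x \<le> k x"
      and Qp: "\<forall>x. p \<le> x \<longrightarrow> x \<le> p1 \<longrightarrow> hardy_pot H x + \<delta> \<le> Q x"
      and Qr: "\<forall>x. r < x \<longrightarrow> x < 1 \<longrightarrow> hardy_pot H x \<le> Q x" and r: "0 < r"
    show "\<rho> \<le> r"
    proof (rule ccontr)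
      assume "\<not> \<rho> \<le> r"
      then have rr: "2 * r < p" "r < \<rho>" using rho by auto
      define S where "S = wronsk w w'"
      define q where "q x = x ^ 4 * w x / psi x" for x
      define dS where "dS x = x ^ 5 * psi x * (hardy_pot H x * w x - k x)" for x
      have dS: "(S has_real_derivative dS x) (at x)" if "0 < x" "x < 1" for x
        unfolding S_def dS_def
        by (rule wronsk_deriv) (use that radial_odeD(2,3)[OF w that] in auto)
      have dSle: "dS x \<le> - (x ^ 5 * psi x * w x * (Q x - hardy_pot H x))" if x: "0 < x" "x < 1" for x
      proof -
        have "dS x \<le> x ^ 5 * psi x * (hardy_pot H x * w x - Q x * w x)"
          unfolding dS_def using wk x psi_pos[of x] by (intro mult_left_mono) auto
        then show ?thesis by (simp add: algebra_simps)
      qed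
      have xp: "x ^ 5 * psi x * w x > 0" if "0 < x" "x < 1" for x
        using that wk psi_pos[of x] by simp
      \<comment> \<open>To the right of r the Wronskian S is nonincreasing with limit zero at 1.
        Hence S is nonnegative, and q, whose derivative is
        \<open>S x / (x * (psi x)\<^sup>2)\<close>, is nondecreasing.\<close>
      have nS: "((\<lambda>x. - S x) has_real_derivative - dS x) (at x) \<and> 0 \<le> - dS x" if x: "r < x" "x < 1" for x
      proof -
        have "0 \<le> x ^ 5 * psi x * w x * (Q x - hardy_pot H x)"
          using xp[of x] x r Qr by (intro mult_nonneg_nonneg[OF less_imp_le]) auto
        then show ?thesis using dSle[of x] dS[of x] x r by (auto intro: DERIV_minus)
      qed
      have Slim: "((\<lambda>x. - S x) \<longlongrightarrow> 0) (at_left 1)"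
        using tendsto_minus[OF wronsk_left_1[OF w w1]] by (simp add: S_def)
      have Spos: "0 \<le> S x" if "r < x" "x < 1" for x
        using le_left_limit[where A=r and B=1, OF nS Slim that] by simp
      have Smono: "S y \<le> S x" if "r < x" "x \<le> y" "y < 1" for x y
        using deriv_nonneg_mono[where A=r and B=1, OF nS that] by simp
      have dq: "(q has_real_derivative S x / (x * (psi x)\<^sup>2)) (at x)" if x: "0 < x" "x < 1" for x
        unfolding q_def[abs_def] S_def wronsk_def using psi_pos[of x] x
        by (auto intro!: derivative_eq_intros radial_odeD(2)[OF w x] psi_deriv
            simp: field_simps power_numeral_reduce)
      have qpos: "q x > 0" if "0 < x" "x < 1" for x
        unfolding q_def using that wk psi_pos[of x] by simp
      have qmono: "q x \<le> q y" if "r < x" "x \<le> y" "y < 1" for x y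
        by (rule deriv_nonneg_mono[where A=r and B=1 and f'="\<lambda>x. S x / (x * (psi x)\<^sup>2)"])
          (use that r dq Spos in auto)
      \<comment> \<open>Across [p, p1] the excess \<delta> makes S drop at rate at least
        \<open>\<delta> * m * q p\<close>; since \<open>S p1\<close> is nonnegative,
        \<open>S p\<close> is at least \<open>\<kappa> * q p\<close>.\<close>
      have "S p1 + \<delta> * m * q p * p1 \<le> S p + \<delta> * m * q p * p"
      proof (rule DERIV_nonpos_imp_nonincreasing[where f="\<lambda>x. S x + \<delta> * m * q p * x"])
        fix x assume x: "p \<le> x" "x \<le> p1"
        then have x01: "0 < x" "x < 1" "r < x" using p rr r by auto
        have e: "x ^ 5 * psi x * w x = x * (psi x)\<^sup>2 * q x"
          using psi_pos[of x] x01 by (simp add: q_def field_simps power_numeral_reduce)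
        have mq: "m * q p \<le> x * (psi x)\<^sup>2 * q x"
          using xm(2)[of x] qmono[of p x] x x01 rr r qpos[of p] p m by (intro mult_mono) (auto simp: m_def)
        have "\<delta> * (m * q p) \<le> (Q x - hardy_pot H x) * (x * (psi x)\<^sup>2 * q x)"
          by (rule mult_mono) (use mq Qp[rule_format, OF x] qpos[of p] p m \<delta> in auto)
        then have "dS x + \<delta> * m * q p \<le> 0"
          using dSle[OF x01(1,2), unfolded e] by (simp add: mult_ac)
        moreover have "((\<lambda>x. S x + \<delta> * m * q p * x) has_real_derivative dS x + \<delta> * m * q p) (at x)"
          by (auto intro!: derivative_eq_intros dS x01)
        ultimately show "\<exists>y. ((\<lambda>x. S x + \<delta> * m * q p * x) has_real_derivative y) (at x) \<and> y \<le> 0" by blast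
      qed (use p in simp)
      then have Sp: "\<kappa> * q p \<le> S p" using Spos[of p1] p rr r by (simp add: \<kappa>_def algebra_simps)
      define x where "x = 2 * r"
      have x: "r < x" "x < p" "0 < x" using r rr by (auto simp: x_def)
      let ?f = "\<lambda>y. q y - \<kappa> * q p / M * ln y"
      have "?f x \<le> ?f p"
      proof (rule DERIV_nonneg_imp_nondecreasing[where f="?f"])
        fix y assume y: "x \<le> y" "y \<le> p"
        then have y01: "0 < y" "y < 1" "r < y" using x p by auto
        have "\<kappa> * q p / (y * M) \<le> S y / (y * (psi y)\<^sup>2)"
        proof (intro frac_le)
          show "\<kappa> * q p \<le> S y" using Sp Smono[of y p] y y01 p by simp
          show "y * (psi y)\<^sup>2 \<le> y * M" using xM(2)[of y] y01 by (intro mult_left_mono) (auto simp: M_def)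
          show "0 < y * (psi y)\<^sup>2" using y01 psi_pos[of y] by simp
          then show "0 \<le> S y" using Spos[of y] y01 by simp
        qed
        moreover have "(?f has_real_derivative S y / (y * (psi y)\<^sup>2) - \<kappa> * q p / M * (1 / y)) (at y)"
          by (intro DERIV_diff dq y01 DERIV_cmult) (use y01 in \<open>auto intro!: derivative_eq_intros\<close>)
        ultimately show "\<exists>d. (?f has_real_derivative d) (at y) \<and> 0 \<le> d"
          by (intro exI conjI) (auto simp: field_simps)
      qed (use x in simp)
      then have "\<kappa> * q p / M * (ln p - ln x) < q p"
        unfolding right_diff_distrib using qpos[of x] x p by linarith
      moreover have "M / \<kappa> \<le> ln p - ln x"
      proof -
        have "x \<le> p * exp (- M / \<kappa>)" using rr by (simp add: x_def \<rho>_def)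
        then have "ln x \<le> ln (p * exp (- M / \<kappa>))" using x p by simp
        then show ?thesis using p by (simp add: ln_mult)
      qed
      then have "\<kappa> * q p / M * (M / \<kappa>) \<le> \<kappa> * q p / M * (ln p - ln x)"
        using kap M qpos[of p] p by (intro mult_left_mono) auto
      moreover have "\<kappa> * q p / M * (M / \<kappa>) = q p" using kap M by simp
      ultimately show False by linarith
    qed
  qed
qed

text \<open>Let r0 be the first point where Q = V. Up to r0 the function z increases, and as \<beta>
  does not, \<open>\<eta> = z r0 - z\<close> satisfies
  \<open>V - Q \<le> V * (1 - exp (- \<eta>)) < V * \<eta>\<close>. A positive \<eta> of this kind
  vanishing at r0 < 1 contradicts \<open>hardy_wronskian\<close>.\<close>

lemma shooting_subcritical:
  fixes \<beta> :: "real \<Rightarrow> real"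
  assumes u: "radial_ode 10 u u' Q"
    and \<beta>: "\<And>r s. 0 < r \<Longrightarrow> r \<le> s \<Longrightarrow> s < 1 \<Longrightarrow> \<beta> s \<le> \<beta> r" "continuous_on {0<..<1} \<beta>"
    and Q: "\<And>r. 0 < r \<Longrightarrow> r < 1 \<Longrightarrow> Q r = hardy_pot H r * exp (\<beta> r + log_sing H u r)"
    and Qbd: "\<And>r. 0 < r \<Longrightarrow> r < 1 \<Longrightarrow> Q r \<le> B"
    and r: "0 < r" "r < 1"
  shows "Q r < hardy_pot H r"
proof (rule ccontr)
  assume nless: "\<not> Q r < hardy_pot H r"
  define z where "z = log_sing H u"
  define z1 where "z1 = log_sing1 H u'"
  note dz = log_sing_derivs[OF u, where H=H, folded z_def z1_def]
  define G where "G x = \<beta> x + z x" for x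
  have Vpos: "hardy_pot H x > 0" if "0 < x" for x using hardy_pot_pos[OF H_pos] that by simp
  have sgn: "Q x < hardy_pot H x \<longleftrightarrow> G x < 0" if "0 < x" "x < 1" for x
    using Q[OF that] Vpos[OF that(1)] mult_less_cancel_left_pos[of "hardy_pot H x" "exp (G x)" 1]
    by (simp add: G_def z_def)
  obtain s where s: "0 < s" "s < r" "\<And>x. 0 < x \<Longrightarrow> x \<le> s \<Longrightarrow> G x < 0"
  proof -
    \<comment> \<open>Q is bounded by B, whereas the Hardy potential is at least
      \<open>1 / x\<^sup>2\<close>; for x up to \<open>1 / (\<bar>B\<bar> + 1)\<close> this
      separates the two.\<close>
    define s where "s = min (r / 2) (1 / (\<bar>B\<bar> + 1))"
    have s: "0 < s" "s \<le> r / 2" "s \<le> 1 / (\<bar>B\<bar> + 1)"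
      unfolding s_def using r min.cobounded1 min.cobounded2 by (auto simp: min_def)
    have "G x < 0" if x: "0 < x" "x \<le> s" for x
    proof -
      have x1: "x < 1" using x s r by simp
      have "x \<le> 1 / (\<bar>B\<bar> + 1)" using x s by linarith
      then have "x * (\<bar>B\<bar> + 1) \<le> 1" by (simp add: pos_le_divide_eq)
      then have "x * \<bar>B\<bar> < 1" using x by (simp add: distrib_left)
      then have "\<bar>B\<bar> < 1 / x" using x by (simp add: field_simps)
      also have "\<dots> \<le> 1 / x\<^sup>2" using x x1 by (intro frac_le) (auto simp: power2_eq_square mult_left_le)
      also have "\<dots> \<le> hardy_pot H x" using H_pos by (simp add: hardy_pot_def divide_simps add_increasing2)
      finally show ?thesis using Qbd[OF x(1) x1] sgn[OF x(1) x1] by linarith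
    qed
    then show ?thesis using that[of s] s r by auto
  qed
  have "continuous_on {s..r} G"
    unfolding G_def
    by (intro continuous_on_add continuous_on_subset[OF \<beta>(2)] continuous_on_of_deriv[OF dz(1)])
      (use s r in auto)
  then obtain r0 where r0: "s < r0" "r0 \<le> r" "G r0 = 0" "\<And>x. s \<le> x \<Longrightarrow> x < r0 \<Longrightarrow> G x < 0"
    using first_crossing[of s r G 0] s(3)[of s] s(1,2) nless sgn[OF r] by auto
  have r01: "0 < r0" "r0 < 1" using r0 r s by auto
  have Gneg: "G x < 0" if "0 < x" "x < r0" for x
    using s(3)[of x] r0(4)[of x] that by (cases "x \<le> s") auto
  have z1pos: "0 < z1 x" if x: "0 < x" "x < r0" for x
  proof -
    let ?f = "\<lambda>r. r ^ 9 * z1 r"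
    have "0 < ?f x"
    proof (rule right_limit_less[where A=0 and B=r0 and f="?f" and f'="\<lambda>r. r ^ 9 * (hardy_pot H r - Q r)"])
      fix x assume x: "0 < x" "x < r0"
      then have x1: "x < 1" using r01 by simp
      have "(?f has_real_derivative x ^ 9 * (hardy_pot H x - Q x)) (at x)"
        by (rule derivative_eq_intros dz(2)[OF x(1) x1] refl)+
          (use x in \<open>simp add: field_simps power_numeral_reduce\<close>)
      then show "(?f has_real_derivative x ^ 9 * (hardy_pot H x - Q x)) (at x) \<and> 0 < x ^ 9 * (hardy_pot H x - Q x)"
        using sgn[OF x(1) x1] Gneg[OF x] x by simp
    next
      show "(?f \<longlongrightarrow> 0) (at_right 0)"
        unfolding z1_def by (rule log_sing_flux_vanishing(1)[OF u]) simp
    qed (use x in auto)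
    then show ?thesis using x by (simp add: zero_less_mult_iff)
  qed
  define \<eta> where "\<eta> x = z r0 - z x" for x
  define \<eta>1 where "\<eta>1 x = - z1 x" for x
  have d\<eta>: "(\<eta> has_real_derivative \<eta>1 x) (at x)"
    "(\<eta>1 has_real_derivative - (hardy_pot H x - Q x) - 9 / x * \<eta>1 x) (at x)" if x: "0 < x" "x < 1" for x
  proof -
    show "(\<eta> has_real_derivative \<eta>1 x) (at x)"
      unfolding \<eta>_def[abs_def] \<eta>1_def by (auto intro!: derivative_eq_intros dz(1)[OF x])
    show "(\<eta>1 has_real_derivative - (hardy_pot H x - Q x) - 9 / x * \<eta>1 x) (at x)"
      unfolding \<eta>1_def[abs_def] by (rule DERIV_cong[OF DERIV_minus[OF dz(2)[OF x]]]) simp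
  qed
  have dW: "isCont (wronsk \<eta> \<eta>1) r0"
    by (rule DERIV_isCont[OF wronsk_deriv[OF d\<eta>[OF r01] r01(1)]])
  have "wronsk \<eta> \<eta>1 r0 > 0"
  proof (rule hardy_wronskian[OF r01(1) less_imp_le[OF r01(2)], where k="\<lambda>x. hardy_pot H x - Q x"])
    fix x assume x: "0 < x" "x < r0"
    then have x1: "x < 1" using r01 by simp
    show "(\<eta> has_real_derivative \<eta>1 x) (at x)" "(\<eta>1 has_real_derivative - (hardy_pot H x - Q x) - 9 / x * \<eta>1 x) (at x)"
      using d\<eta>[OF x(1) x1] by auto
    have "z x < z r0"
      by (rule less_left_limit[where A=0 and B=r0 and f'=z1])
        (use x r01 dz(1) z1pos DERIV_isCont[OF dz(1)[OF r01]] in \<open>auto simp: isCont_def filterlim_at_split\<close>)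
    then have eta: "\<eta> x > 0" by (simp add: \<eta>_def)
    have "\<beta> r0 \<le> \<beta> x" using \<beta>(1)[of x r0] x r01 by simp
    then have "- \<eta> x \<le> G x" using r0(3) by (simp add: G_def \<eta>_def)
    then have "1 - exp (G x) \<le> 1 - exp (- \<eta> x)" by simp
    also have "\<dots> < \<eta> x"
    proof -
      have "exp (- \<eta> x) > 1 - \<eta> x" using exp_minus_greater[of "\<eta> x"] eta by simp
      then show ?thesis by simp
    qed
    finally have "hardy_pot H x * (1 - exp (G x)) < hardy_pot H x * \<eta> x"
      using Vpos[OF x(1)] by simp
    then show "hardy_pot H x - Q x < hardy_pot H x * \<eta> x"
      using Q[OF x(1) x1] by (simp add: G_def z_def algebra_simps)
  next
    show "(wronsk \<eta> \<eta>1 \<longlongrightarrow> 0) (at_right 0)"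
    proof (rule wronsk_right_0)
      show "((\<lambda>r. r ^ 5 * \<eta>1 r) \<longlongrightarrow> 0) (at_right 0)"
        using tendsto_minus[OF log_sing_flux_vanishing(1)[OF u, of 5 H]] by (simp add: \<eta>1_def z1_def)
      have "((\<lambda>r. z r0 * r ^ 4 - r ^ 4 * z r) \<longlongrightarrow> z r0 * 0 - 0) (at_right 0)"
        unfolding z_def by (intro tendsto_intros log_sing_flux_vanishing(2)[OF u] power_vanishing) simp
      then show "((\<lambda>r. r ^ 4 * \<eta> r) \<longlongrightarrow> 0) (at_right 0)" by (simp add: \<eta>_def algebra_simps)
    qed
    show "(wronsk \<eta> \<eta>1 \<longlongrightarrow> wronsk \<eta> \<eta>1 r0) (at_left r0)"
      using dW by (auto simp: isCont_def filterlim_at_split)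
  qed
  moreover have "\<eta>1 r0 \<le> 0"
  proof (rule deriv_nonpos_at_min_left[OF d\<eta>(1)[OF r01] r01(1)])
    fix x assume x: "0 < x" "x < r0"
    have "z x \<le> z r0"
      by (rule le_left_limit[where A=0 and B=r0 and f'=z1])
        (use x r01 dz(1) z1pos DERIV_isCont[OF dz(1)[OF r01]] in \<open>auto simp: isCont_def filterlim_at_split intro: less_imp_le\<close>)
    then show "\<eta> r0 \<le> \<eta> x" by (simp add: \<eta>_def)
  qed
  then have "wronsk \<eta> \<eta>1 r0 \<le> 0"
    using r01 psi_pos[of r0] by (simp add: wronsk_def \<eta>_def mult_nonneg_nonpos mult_nonpos_nonneg)
  ultimately show False by simp
qed

text \<open>Convexity of exp gives \<open>k = a * exp v2 * (1 - exp (- d)) \<le> a * exp v2 * d < V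
  * d\<close>, so it is enough that the upper solution is subcritical. A first zero of d in (0, 1]
  then contradicts \<open>hardy_wronskian\<close>.\<close>

lemma shooting_ordered:
  assumes v: "radial_ode 10 v1 v1' (\<lambda>r. a r * exp (v1 r))" "radial_ode 10 v2 v2' (\<lambda>r. a r * exp (v2 r))"
    and a: "\<And>r. 0 < r \<Longrightarrow> r < 1 \<Longrightarrow> a r > 0"
    and sub: "\<And>r. 0 < r \<Longrightarrow> r < 1 \<Longrightarrow> a r * exp (v2 r) < hardy_pot H r"
    and init: "v1 0 < v2 0"
  shows "v1 1 < v2 1"
proof (rule ccontr)
  assume nless: "\<not> v1 1 < v2 1"
  define d where "d r = v2 r - v1 r" for r
  define d1 where "d1 r = v2' r - v1' r" for r
  define k where "k r = a r * exp (v2 r) - a r * exp (v1 r)" for r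
  have ode: "radial_ode 10 d d1 k"
    using radial_ode_diff[OF v(2,1)] unfolding d_def[abs_def] d1_def[abs_def] k_def[abs_def] .
  have "continuous_on {0..1} (\<lambda>r. - d r)" by (intro continuous_intros radial_odeD(1)[OF ode])
  then obtain r0 where r0: "0 < r0" "r0 \<le> 1" "d r0 = 0" "\<And>x. 0 \<le> x \<Longrightarrow> x < r0 \<Longrightarrow> d x > 0"
    using first_crossing[of 0 1 "\<lambda>r. - d r" 0] nless init by (auto simp: d_def)
  \<comment> \<open>At r0 = 1 the Wronskian tends to zero because d and \<open>psi\<close> both
    vanish; at an interior first zero, \<open>d1 r0 \<le> 0\<close> makes it nonpositive.\<close>
  have "\<exists>c\<le>0. (wronsk d d1 \<longlongrightarrow> c) (at_left r0)"
  proof (cases "r0 = 1")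
    case True
    then show ?thesis using wronsk_left_1[OF ode] r0(3) by auto
  next
    case False
    then have r01: "r0 < 1" using r0 by simp
    have "isCont (wronsk d d1) r0"
      by (rule DERIV_isCont[OF wronsk_deriv[where k="k r0"]])
        (use radial_odeD(2,3)[OF ode r0(1) r01] r0 in auto)
    moreover have "d1 r0 \<le> 0"
      by (rule deriv_nonpos_at_min_left[OF radial_odeD(2)[OF ode r0(1) r01] r0(1)])
        (use r0 in \<open>auto intro: less_imp_le\<close>)
    then have "wronsk d d1 r0 \<le> 0"
      using r0 psi_pos[of r0] r01 by (simp add: wronsk_def mult_nonneg_nonpos mult_nonpos_nonneg)
    ultimately show ?thesis by (auto simp: isCont_def filterlim_at_split)
  qed
  then obtain c where c: "c \<le> 0" "(wronsk d d1 \<longlongrightarrow> c) (at_left r0)" by blast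
  have "c > 0"
  proof (rule hardy_wronskian[OF r0(1,2), where k=k])
    fix x assume x: "0 < x" "x < r0"
    then have x1: "x < 1" using r0 by simp
    show "(d has_real_derivative d1 x) (at x)" "(d1 has_real_derivative - k x - 9 / x * d1 x) (at x)"
      using radial_odeD(2,3)[OF ode x(1) x1] by auto
    have dx: "d x > 0" using r0(4)[of x] x by simp
    have "1 - exp (- d x) \<le> d x" using exp_ge_add_one_self[of "- d x"] by linarith
    then have "a x * exp (v2 x) * (1 - exp (- d x)) \<le> a x * exp (v2 x) * d x"
      using a[OF x(1) x1] by (intro mult_left_mono) auto
    also have "\<dots> < hardy_pot H x * d x" using sub[OF x(1) x1] dx by simp
    also have "a x * exp (v2 x) * (1 - exp (- d x)) = k x"
      unfolding k_def d_def by (simp add: algebra_simps exp_diff)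
    finally show "k x < hardy_pot H x * d x" .
  next
    show "(wronsk d d1 \<longlongrightarrow> 0) (at_right 0)"
    proof (rule wronsk_right_0)
      show "((\<lambda>r. r ^ 5 * d1 r) \<longlongrightarrow> 0) (at_right 0)"
        by (intro radial_ode_vanishing(1)[OF ode] power_vanishing) simp
      have "((\<lambda>r. r ^ 4 * d r) \<longlongrightarrow> 0 * d 0) (at_right 0)"
        by (intro tendsto_intros radial_odeD(4)[OF ode] power_vanishing) simp
      then show "((\<lambda>r. r ^ 4 * d r) \<longlongrightarrow> 0) (at_right 0)" by simp
    qed
  qed (use c in auto)
  then show False using c by simp
qed

end

section \<open>Shooting solutions\<close>

text \<open>For \<open>\<Delta> v = g\<close> this is \<open>v' s / s\<close>. The division by s is
  harmless at the origin, where the prescribed value \<open>g 0 / real N\<close> is the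
  limit.\<close>

definition rad_avg :: "nat \<Rightarrow> (real \<Rightarrow> real) \<Rightarrow> real \<Rightarrow> real" where
  "rad_avg N g s = (if s = 0 then g 0 / real N else integral {0..s} (\<lambda>t. t ^ (N - 1) * g t) / s ^ N)"

text \<open>\<open>rad_green N g\<close> is the solution of \<open>\<Delta> v = g\<close> with \<open>v 0 = v' 0 = 0\<close> in the radial variable.\<close>

definition rad_green :: "nat \<Rightarrow> (real \<Rightarrow> real) \<Rightarrow> real \<Rightarrow> real" where
  "rad_green N g r = integral {0..r} (\<lambda>s. s * rad_avg N g s)"

lemma has_integral_monomial:
  fixes s :: real
  assumes "0 \<le> s"
  shows "((\<lambda>t. t ^ k) has_integral s ^ Suc k / real (Suc k)) {0..s}"
proof -
  have "((\<lambda>t. t ^ k) has_integral (s ^ Suc k / real (Suc k) - 0 ^ Suc k / real (Suc k))) {0..s}"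
  proof (rule fundamental_theorem_of_calculus[OF assms])
    fix x assume "x \<in> {0..s}"
    have "((\<lambda>t. t ^ Suc k / real (Suc k)) has_real_derivative real (Suc k) * x ^ k / real (Suc k)) (at x)"
      using DERIV_pow[of "Suc k" x] by (intro DERIV_cdivide) simp
    then show "((\<lambda>t. t ^ Suc k / real (Suc k)) has_vector_derivative x ^ k) (at x within {0..s})"
      by (simp add: has_real_derivative_iff_has_vector_derivative[symmetric] has_field_derivative_at_within del: of_nat_Suc)
  qed
  then show ?thesis by simp
qed

lemma integral_monomial_bound:
  fixes g :: "real \<Rightarrow> real"
  assumes s: "0 \<le> s" "s \<le> 1" and cg: "continuous_on {0..1} g"
    and b: "\<And>t. 0 \<le> t \<Longrightarrow> t \<le> s \<Longrightarrow> \<bar>g t\<bar> \<le> c * t ^ k"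
  shows "\<bar>integral {0..s} g\<bar> \<le> c * (s ^ Suc k / real (Suc k))"
proof -
  have "norm (integral {0..s} g) \<le> integral {0..s} (\<lambda>t. c * t ^ k)"
    by (rule integral_norm_bound_integral)
       (use b s in \<open>auto intro!: integrable_continuous_real continuous_intros continuous_on_subset[OF cg]\<close>)
  also have "\<dots> = c * (s ^ Suc k / real (Suc k))"
    using has_integral_mult_right[OF has_integral_monomial[OF s(1), of k], of c] by (rule integral_unique)
  finally show ?thesis by simp
qed

context
  fixes N :: nat and g :: "real \<Rightarrow> real"
  assumes N: "N \<ge> 1" and cg: "continuous_on {0..1} g"
begin

lemma rad_avg_bound:
  assumes s: "0 \<le> s" "s \<le> 1" and b: "\<And>t. 0 \<le> t \<Longrightarrow> t \<le> s \<Longrightarrow> \<bar>g t\<bar> \<le> c * t ^ k"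
  shows "\<bar>rad_avg N g s\<bar> \<le> c * s ^ k / real (k + N)"
proof (cases "s = 0")
  case True
  show ?thesis
  proof (cases "k = 0")
    case t: True
    then show ?thesis using b[of 0] s True N by (simp add: rad_avg_def divide_right_mono)
  next
    case False
    then show ?thesis using b[of 0] s True N by (simp add: rad_avg_def power_0_left)
  qed
next
  case False
  then have sp: "s > 0" using s by simp
  have "\<bar>integral {0..s} (\<lambda>t. t ^ (N - 1) * g t)\<bar> \<le> c * (s ^ Suc (k + N - 1) / real (Suc (k + N - 1)))"
  proof (rule integral_monomial_bound[OF s])
    show "continuous_on {0..1} (\<lambda>t. t ^ (N - 1) * g t)" by (intro continuous_intros cg)
    fix t assume t: "0 \<le> t" "t \<le> s"
    have "t ^ (N - 1) * \<bar>g t\<bar> \<le> t ^ (N - 1) * (c * t ^ k)" using b[OF t] t by (intro mult_left_mono) auto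
    also have "\<dots> = c * t ^ (k + N - 1)" using N by (simp add: mult_ac flip: power_add)
    finally show "\<bar>t ^ (N - 1) * g t\<bar> \<le> c * t ^ (k + N - 1)" using t by (simp add: abs_mult)
  qed
  also have "Suc (k + N - 1) = k + N" using N by simp
  finally have "\<bar>integral {0..s} (\<lambda>t. t ^ (N - 1) * g t)\<bar> / s ^ N \<le> c * (s ^ (k + N) / real (k + N)) / s ^ N"
    using sp by (intro divide_right_mono) auto
  also have "\<dots> = c * s ^ k / real (k + N)" using sp by (simp add: power_add)
  finally show ?thesis using sp by (simp add: rad_avg_def abs_divide)
qed

lemma rad_avg_deriv:
  assumes s: "0 < s" "s < 1"
  shows "(rad_avg N g has_real_derivative (g s - real N * rad_avg N g s) / s) (at s)"
proof -
  let ?P = "\<lambda>s. integral {0..s} (\<lambda>t. t ^ (N - 1) * g t)"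
  have c: "continuous_on {0..1} (\<lambda>t. t ^ (N - 1) * g t)" by (intro continuous_intros cg)
  have "(?P has_real_derivative s ^ (N - 1) * g s) (at s)"
    using integral_has_real_derivative[OF c, of s] s by (simp add: at_within_Icc_at)
  then have "((\<lambda>s. ?P s / s ^ N) has_real_derivative
     (s ^ (N - 1) * g s * s ^ N - ?P s * (real N * s ^ (N - 1))) / (s ^ N * s ^ N)) (at s)"
    by (rule DERIV_divide[OF _ DERIV_pow[THEN DERIV_cong]]) (use s in auto)
  moreover have "\<forall>\<^sub>F x in nhds s. rad_avg N g x = ?P x / x ^ N"
    by (rule eventually_mono[OF eventually_nhds_in_open[of "{0<..}" s]]) (use s in \<open>auto simp: rad_avg_def\<close>)
  ultimately have "(rad_avg N g has_real_derivative
     (s ^ (N - 1) * g s * s ^ N - ?P s * (real N * s ^ (N - 1))) / (s ^ N * s ^ N)) (at s)"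
    by (subst DERIV_cong_ev[OF refl _ refl])
  also have "(s ^ (N - 1) * g s * s ^ N - ?P s * (real N * s ^ (N - 1))) / (s ^ N * s ^ N)
      = (g s - real N * (?P s / s ^ N)) / s"
  proof -
    have e: "s ^ N = s * s ^ (N - 1)" using N by (cases N) auto
    show ?thesis unfolding e using s by (simp add: field_simps)
  qed
  finally show ?thesis using s by (simp add: rad_avg_def[of N g s])
qed

end

lemma rad_avg_diff:
  assumes "continuous_on {0..1} g" "continuous_on {0..1} h" "0 \<le> s" "s \<le> 1"
  shows "rad_avg N (\<lambda>t. g t - h t) s = rad_avg N g s - rad_avg N h s"
proof -
  have "(\<lambda>t. t ^ (N - 1) * f t) integrable_on {0..s}" if "continuous_on {0..1} f" for f :: "real \<Rightarrow> real"
    using assms that by (auto intro!: integrable_continuous_real continuous_intros continuous_on_subset[OF that])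
  then show ?thesis using assms
    by (simp add: rad_avg_def diff_divide_distrib right_diff_distrib Henstock_Kurzweil_Integration.integral_diff)
qed

lemma rad_avg_const:
  assumes "N \<ge> 1" "0 \<le> s"
  shows "rad_avg N (\<lambda>t. c) s = c / real N"
proof (cases "s = 0")
  case False
  then have "s > 0" using assms by simp
  moreover have "integral {0..s} (\<lambda>t. t ^ (N - 1) * c) = s ^ N / real N * c"
    using has_integral_mult_left[OF has_integral_monomial[OF assms(2), of "N - 1"], of c] assms(1)
    by (intro integral_unique) simp
  ultimately show ?thesis by (simp add: rad_avg_def)
qed (simp add: rad_avg_def)

lemma rad_avg_cont:
  assumes N: "N \<ge> 1" and cg: "continuous_on {0..1} g"
  shows "continuous_on {0..1} (rad_avg N g)"
  unfolding continuous_on_eq_continuous_within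
proof
  fix s :: real assume s: "s \<in> {0..1}"
  show "continuous (at s within {0..1}) (rad_avg N g)"
  proof (cases "s = 0")
    case False
    have "continuous_on {s / 2..1} (\<lambda>x. integral {0..x} (\<lambda>t. t ^ (N - 1) * g t) / x ^ N)"
      using False s
      by (intro continuous_intros continuous_on_subset[OF indefinite_integral_continuous_1]
          integrable_continuous_real) (auto simp: cg)
    then have "continuous_on {s / 2..1} (rad_avg N g)"
      by (rule continuous_on_eq) (use False s in \<open>auto simp: rad_avg_def\<close>)
    then have "continuous (at s within {s / 2..1}) (rad_avg N g)"
      using s unfolding continuous_on_eq_continuous_within by auto
    moreover have "at s within {0..1} = at s within {s / 2..1}"
      by (rule at_within_nhd[of s "{s / 2<..}"]) (use False s in auto)
    ultimately show ?thesis by simp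
  next
    case True
    have "(rad_avg N g \<longlongrightarrow> g 0 / real N) (at 0 within {0..1})"
    proof (rule tendstoI)
      fix e :: real assume e: "e > 0"
      have "(g \<longlongrightarrow> g 0) (at 0 within {0..1})" using cg by (auto simp: continuous_on_def)
      then have "\<forall>\<^sub>F t in at 0 within {0..1}. dist (g t) (g 0) < e / 2"
        using tendstoD[of g "g 0" _ "e / 2"] e by simp
      then obtain d where d: "d > 0" "\<And>t. t \<in> {0..1} \<Longrightarrow> t \<noteq> 0 \<Longrightarrow> dist t 0 < d \<Longrightarrow> dist (g t) (g 0) < e / 2"
        by (auto simp: eventually_at)
      have "dist (rad_avg N g x) (g 0 / real N) < e" if x: "x \<in> {0..1}" "x < d" for x
      proof -
        have "rad_avg N (\<lambda>t. g t - g 0) x = rad_avg N g x - g 0 / real N"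
          using rad_avg_diff[OF cg continuous_on_const, of x N "g 0"] rad_avg_const[OF N, of x "g 0"] x by simp
        moreover have "\<bar>rad_avg N (\<lambda>t. g t - g 0) x\<bar> \<le> e / 2 * x ^ 0 / real (0 + N)"
        proof (rule rad_avg_bound[OF N])
          show "continuous_on {0..1} (\<lambda>t. g t - g 0)" by (intro continuous_intros cg)
          fix t assume t: "0 \<le> t" "t \<le> x"
          show "\<bar>g t - g 0\<bar> \<le> e / 2 * t ^ 0"
          proof (cases "t = 0")
            case False
            then show ?thesis using d(2)[of t] t x by (auto simp: dist_real_def)
          qed (use e in simp)
        qed (use x in auto)
        moreover have "e / 2 * x ^ 0 / real (0 + N) \<le> e / 2" using N e by (simp add: field_simps)
        ultimately show ?thesis using e by (simp add: dist_real_def)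
      qed
      then show "\<forall>\<^sub>F x in at 0 within {0..1}. dist (rad_avg N g x) (g 0 / real N) < e"
        unfolding eventually_at using d(1) by (intro exI[of _ d]) (auto simp: dist_real_def)
    qed
    then show ?thesis using True by (simp add: continuous_within rad_avg_def)
  qed
qed

lemma rad_green_cont:
  assumes "N \<ge> 1" "continuous_on {0..1} g"
  shows "continuous_on {0..1} (rad_green N g)"
  unfolding rad_green_def
  by (intro indefinite_integral_continuous_1 integrable_continuous_real continuous_intros rad_avg_cont assms)

lemma rad_green_deriv:
  assumes "N \<ge> 1" "continuous_on {0..1} g" "0 < r" "r < 1"
  shows "(rad_green N g has_real_derivative r * rad_avg N g r) (at r)"
proof -
  have c: "continuous_on {0..1} (\<lambda>s. s * rad_avg N g s)"
    by (intro continuous_intros rad_avg_cont assms)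
  show ?thesis
    using integral_has_real_derivative[OF c, of r] assms(3,4)
    unfolding rad_green_def[abs_def] by (simp add: at_within_Icc_at)
qed

lemma rad_green_bound:
  assumes N: "N \<ge> 1" and cg: "continuous_on {0..1} g" and r: "0 \<le> r" "r \<le> 1"
    and b: "\<And>t. 0 \<le> t \<Longrightarrow> t \<le> r \<Longrightarrow> \<bar>g t\<bar> \<le> c * t ^ k" and c: "c \<ge> 0"
  shows "\<bar>rad_green N g r\<bar> \<le> c * r ^ (k + 2) / real (k + 2)"
proof -
  have "\<bar>rad_green N g r\<bar> \<le> c * (r ^ Suc (k + 1) / real (Suc (k + 1)))"
    unfolding rad_green_def
  proof (rule integral_monomial_bound[OF r])
    show "continuous_on {0..1} (\<lambda>s. s * rad_avg N g s)" by (intro continuous_intros rad_avg_cont assms)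
    fix t assume t: "0 \<le> t" "t \<le> r"
    have "\<bar>rad_avg N g t\<bar> \<le> c * t ^ k / real (k + N)"
      by (rule rad_avg_bound[OF N cg]) (use t r b in auto)
    also have "\<dots> \<le> c * t ^ k / 1" using N c t by (intro divide_left_mono) auto
    finally have "t * \<bar>rad_avg N g t\<bar> \<le> t * (c * t ^ k)" using t by (intro mult_left_mono) auto
    then show "\<bar>t * rad_avg N g t\<bar> \<le> c * t ^ (k + 1)" using t by (simp add: abs_mult mult_ac)
  qed
  then show ?thesis by simp
qed

lemma rad_green_diff:
  assumes "N \<ge> 1" "continuous_on {0..1} g" "continuous_on {0..1} h" "0 \<le> r" "r \<le> 1"
  shows "rad_green N (\<lambda>t. g t - h t) r = rad_green N g r - rad_green N h r"
proof -
  have i: "(\<lambda>s. s * rad_avg N f s) integrable_on {0..r}" if "continuous_on {0..1} f" for f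
    using assms(5) continuous_on_subset[OF rad_avg_cont[OF assms(1) that], of "{0..r}"]
    by (auto intro!: integrable_continuous_real continuous_intros)
  have "rad_green N (\<lambda>t. g t - h t) r = integral {0..r} (\<lambda>s. s * rad_avg N g s - s * rad_avg N h s)"
    unfolding rad_green_def
    by (intro Henstock_Kurzweil_Integration.integral_cong)
      (use assms in \<open>auto simp: rad_avg_diff right_diff_distrib\<close>)
  then show ?thesis
    using i[OF assms(2)] i[OF assms(3)] by (simp add: rad_green_def Henstock_Kurzweil_Integration.integral_diff)
qed

lemma rad_green_nonneg:
  assumes "N \<ge> 1" "continuous_on {0..1} g" "0 \<le> r" "r \<le> 1" and g: "\<And>t. 0 \<le> t \<Longrightarrow> t \<le> 1 \<Longrightarrow> 0 \<le> g t"
  shows "0 \<le> rad_green N g r"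
proof -
  have a: "0 \<le> rad_avg N g s" if "0 \<le> s" "s \<le> 1" for s
  proof -
    have "0 \<le> integral {0..s} (\<lambda>t. t ^ (N - 1) * g t)"
      by (rule integral_nonneg) (use that g assms(2) in \<open>auto intro!: integrable_continuous_real continuous_intros continuous_on_subset[OF assms(2)]\<close>)
    then show ?thesis using g[of 0] that by (simp add: rad_avg_def)
  qed
  show ?thesis unfolding rad_green_def
    by (rule integral_nonneg)
      (use a assms continuous_on_subset[OF rad_avg_cont[OF assms(1,2)], of "{0..r}"] in
        \<open>auto intro!: integrable_continuous_real continuous_intros\<close>)
qed

section \<open>Existence by Picard iteration\<close>

lemma exp_diff_le:
  fixes x y c :: real
  assumes "x \<le> c" "y \<le> c"
  shows "\<bar>exp x - exp y\<bar> \<le> exp c * \<bar>x - y\<bar>"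
proof -
  have *: "exp x - exp y \<le> exp c * (x - y)" if "y \<le> x" "x \<le> c" for x y :: real
  proof -
    have "exp x - exp y = exp x * (1 - exp (y - x))" by (simp add: exp_diff right_diff_distrib)
    also have "\<dots> \<le> exp x * (x - y)"
    proof (intro mult_left_mono)
      show "1 - exp (y - x) \<le> x - y" using exp_ge_add_one_self[of "y - x"] by linarith
    qed simp
    also have "\<dots> \<le> exp c * (x - y)" using that by (intro mult_right_mono) auto
    finally show ?thesis .
  qed
  show ?thesis
  proof (cases "y \<le> x")
    case True
    then show ?thesis using *[of y x] assms by simp
  next
    case False
    then have "\<bar>exp x - exp y\<bar> = exp y - exp x" "\<bar>x - y\<bar> = y - x" by auto
    then show ?thesis using *[of x y] assms False by simp
  qed
qed

primrec picard :: "nat \<Rightarrow> (real \<Rightarrow> real) \<Rightarrow> real \<Rightarrow> nat \<Rightarrow> real \<Rightarrow> real" where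
  "picard N a \<alpha> 0 = (\<lambda>r. \<alpha>)"
| "picard N a \<alpha> (Suc n) = (\<lambda>r. \<alpha> - rad_green N (\<lambda>t. a t * exp (picard N a \<alpha> n t)) r)"

text \<open>Since a is nonnegative, no iterate exceeds \<alpha>, so exp is uniformly Lipschitz along
  the iteration and the factorial bounds give convergence on all of [0, 1]: there is no blow-up,
  however large \<alpha> is. The function \<open>p = v' / r\<close> is returned since it expresses
  the gradient as \<open>p (norm x) *\<^sub>R x\<close>, without a singular quotient.\<close>

lemma shooting_exists:
  assumes N: "N \<ge> 1" and ca: "continuous_on {0..1} a" and a: "\<And>r. 0 \<le> r \<Longrightarrow> r \<le> 1 \<Longrightarrow> a r \<ge> 0"
  shows "\<exists>v p. continuous_on {0..1} v \<and> continuous_on {0..1} p \<and> v 0 = \<alpha> \<and>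
    p 0 = - (a 0 * exp (v 0)) / real N \<and>
    (\<forall>r. 0 < r \<longrightarrow> r < 1 \<longrightarrow> (v has_real_derivative r * p r) (at r) \<and>
      (p has_real_derivative - (a r * exp (v r) + real N * p r) / r) (at r))"
proof -
  define V where "V = picard N a \<alpha>"
  define g where "g n t = a t * exp (V n t)" for n t
  have VSuc: "V (Suc n) r = \<alpha> - rad_green N (g n) r" for n r
    unfolding V_def g_def[abs_def] by simp
  have cV: "continuous_on {0..1} (V n)" for n
  proof (induction n)
    case (Suc n)
    show ?case unfolding VSuc[abs_def] g_def[abs_def]
      by (intro continuous_intros rad_green_cont N ca Suc)
  qed (simp add: V_def)
  have cgn: "continuous_on {0..1} (g n)" for n unfolding g_def by (intro continuous_intros ca cV)
  have Vle: "V n r \<le> \<alpha>" if "0 \<le> r" "r \<le> 1" for n r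
  proof (cases n)
    case (Suc m)
    have "0 \<le> rad_green N (g m) r"
      by (rule rad_green_nonneg[OF N cgn that]) (use a in \<open>auto simp: g_def\<close>)
    then show ?thesis by (simp add: Suc VSuc)
  qed (simp add: V_def)
  have "\<exists>x\<in>{0..1}. \<forall>y\<in>{0..1}. a y \<le> a x"
    by (rule continuous_attains_sup) (use ca in auto)
  then obtain xM where xM: "xM \<in> {0..1}" "\<And>y. y \<in> {0..1} \<Longrightarrow> a y \<le> a xM" by blast
  define L where "L = a xM * exp \<alpha>"
  have L: "L \<ge> 0" using a[of xM] xM(1) by (simp add: L_def)
  have lip: "\<bar>a t * exp x - a t * exp y\<bar> \<le> L * \<bar>x - y\<bar>" if "0 \<le> t" "t \<le> 1" "x \<le> \<alpha>" "y \<le> \<alpha>" for t x y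
  proof -
    have "\<bar>a t * exp x - a t * exp y\<bar> = a t * \<bar>exp x - exp y\<bar>"
      using a[of t] that by (simp add: abs_mult flip: right_diff_distrib)
    also have "\<dots> \<le> a xM * (exp \<alpha> * \<bar>x - y\<bar>)"
      using a[of t] a[of xM] xM that exp_diff_le[of x \<alpha> y] by (intro mult_mono) auto
    finally show ?thesis by (simp add: L_def)
  qed
  have step: "\<bar>V (Suc n) r - V n r\<bar> \<le> L ^ Suc n * r ^ (2 * Suc n) / fact (Suc n)"
    if "0 \<le> r" "r \<le> 1" for n r
    using that
  proof (induction n arbitrary: r)
    case 0
    have "\<bar>rad_green N (g 0) r\<bar> \<le> L * r ^ (0 + 2) / real (0 + 2)"
    proof (rule rad_green_bound[OF N cgn 0 _ L])
      fix t assume "0 \<le> t" "t \<le> r"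
      then show "\<bar>g 0 t\<bar> \<le> L * t ^ 0"
        using xM(2)[of t] a[of t] 0 by (simp add: g_def V_def L_def abs_mult)
    qed
    also have "\<dots> \<le> L * r ^ 2" using mult_nonneg_nonneg[OF L zero_le_power2[of r]] by (simp add: power2_eq_square)
    finally show ?case unfolding VSuc by (simp add: V_def)
  next
    case (Suc n)
    let ?c = "L ^ Suc (Suc n) / fact (Suc n)"
    have "\<bar>rad_green N (\<lambda>t. g (Suc n) t - g n t) r\<bar> \<le> ?c * r ^ (2 * Suc n + 2) / real (2 * Suc n + 2)"
    proof (rule rad_green_bound[OF N _ Suc.prems])
      show "continuous_on {0..1} (\<lambda>t. g (Suc n) t - g n t)" by (intro continuous_intros cgn)
      fix t assume t: "0 \<le> t" "t \<le> r"
      have "\<bar>g (Suc n) t - g n t\<bar> \<le> L * \<bar>V (Suc n) t - V n t\<bar>"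
        unfolding g_def by (rule lip) (use t Suc.prems Vle in auto)
      also have "\<dots> \<le> L * (L ^ Suc n * t ^ (2 * Suc n) / fact (Suc n))"
        using L Suc.IH[of t] t Suc.prems by (intro mult_left_mono) auto
      finally show "\<bar>g (Suc n) t - g n t\<bar> \<le> ?c * t ^ (2 * Suc n)" by simp
    qed (use L in simp)
    \<comment> \<open>The denominator is weakened from \<open>2 * Suc n + 2\<close> to
      \<open>Suc (Suc n)\<close>, which completes the factorial.\<close>
    also have "\<dots> \<le> ?c * r ^ (2 * Suc n + 2) / real (Suc (Suc n))"
      using L Suc.prems by (intro divide_left_mono mult_nonneg_nonneg) auto
    also have "\<dots> = L ^ Suc (Suc n) * r ^ (2 * Suc (Suc n)) / fact (Suc (Suc n))"
      unfolding fact_Suc[of "Suc n"] by (simp add: field_simps)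
    also have "rad_green N (\<lambda>t. g (Suc n) t - g n t) r = - (V (Suc (Suc n)) r - V (Suc n) r)"
      unfolding VSuc[of "Suc n"] VSuc[of n] using rad_green_diff[OF N cgn cgn Suc.prems] by simp
    finally show ?case by (simp only: abs_minus_cancel)
  qed
  define W where "W r = \<alpha> + (\<Sum>i. V (Suc i) r - V i r)" for r
  have ul: "uniform_limit {0..1} V W sequentially"
  proof -
    have "summable (\<lambda>n. L ^ Suc n / fact (Suc n))"
      using summable_exp[of L] by (subst summable_Suc_iff) (simp add: field_simps)
    then have "uniform_limit {0..1} (\<lambda>n r. \<Sum>i<n. V (Suc i) r - V i r) (\<lambda>r. \<Sum>i. V (Suc i) r - V i r) sequentially"
    proof (rule Weierstrass_m_test[rotated])
      fix n r assume r: "r \<in> {0..1::real}"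
      have "\<bar>V (Suc n) r - V n r\<bar> \<le> L ^ Suc n * r ^ (2 * Suc n) / fact (Suc n)" using step r by simp
      also have "\<dots> \<le> L ^ Suc n * 1 / fact (Suc n)"
        using L r by (intro divide_right_mono mult_left_mono power_le_one zero_le_power) auto
      finally show "norm (V (Suc n) r - V n r) \<le> L ^ Suc n / fact (Suc n)" by simp
    qed
    then have "uniform_limit {0..1} (\<lambda>n r. \<alpha> + (\<Sum>i<n. V (Suc i) r - V i r)) W sequentially"
      unfolding W_def by (intro uniform_limit_add uniform_limit_const)
    moreover have "\<alpha> + (\<Sum>i<n. V (Suc i) r - V i r) = V n r" for n r
      using sum_lessThan_telescope[of "\<lambda>i. V i r" n] by (simp add: V_def)
    ultimately show ?thesis by simp
  qed
  have cW: "continuous_on {0..1} W"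
    by (rule uniform_limit_theorem[OF _ ul]) (auto simp: cV)
  have limW: "(\<lambda>n. V n r) \<longlonglongrightarrow> W r" if "0 \<le> r" "r \<le> 1" for r
    using tendsto_uniform_limitI[OF ul] that by simp
  have Wle: "W r \<le> \<alpha>" if "0 \<le> r" "r \<le> 1" for r
    by (rule LIMSEQ_le_const2[OF limW[OF that]]) (use Vle that in auto)
  define G where "G t = a t * exp (W t)" for t
  have cG: "continuous_on {0..1} G" unfolding G_def by (intro continuous_intros ca cW)
  have fixW: "W r = \<alpha> - rad_green N G r" if r: "0 \<le> r" "r \<le> 1" for r
  proof -
    have "(\<lambda>n. rad_green N (g n) r) \<longlonglongrightarrow> rad_green N G r"
    proof (rule metric_LIMSEQ_I)
      fix e :: real assume e: "e > 0"
      define e' where "e' = e / (L + 1)"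
      have e': "e' > 0" "L * e' < e" using e L by (auto simp: e'_def field_simps)
      have "\<forall>\<^sub>F n in sequentially. \<forall>t\<in>{0..1}. dist (V n t) (W t) < e'"
        by (rule uniform_limitD[OF ul e'(1)])
      then obtain n0 where n0: "\<And>n t. n \<ge> n0 \<Longrightarrow> t \<in> {0..1} \<Longrightarrow> dist (V n t) (W t) < e'"
        unfolding eventually_sequentially by blast
      have "dist (rad_green N (g n) r) (rad_green N G r) < e" if n: "n \<ge> n0" for n
      proof -
        have "\<bar>rad_green N (\<lambda>t. g n t - G t) r\<bar> \<le> (L * e') * r ^ (0 + 2) / real (0 + 2)"
        proof (rule rad_green_bound[OF N _ r])
          show "continuous_on {0..1} (\<lambda>t. g n t - G t)" by (intro continuous_intros cgn cG)
          fix t assume t: "0 \<le> t" "t \<le> r"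
          have "\<bar>g n t - G t\<bar> \<le> L * \<bar>V n t - W t\<bar>"
            unfolding g_def G_def by (rule lip) (use t r Vle Wle in auto)
          also have "\<dots> \<le> L * e'" using n0[OF n, of t] t r L by (intro mult_left_mono) (auto simp: dist_real_def)
          finally show "\<bar>g n t - G t\<bar> \<le> L * e' * t ^ 0" by simp
        qed (use L e' in simp)
        also have "\<dots> \<le> (L * e') * 1 / 1"
          using L e' r by (intro frac_le mult_left_mono power_le_one) auto
        also have "\<dots> < e" using e' by simp
        finally show ?thesis using rad_green_diff[OF N cgn cG r] by (simp add: dist_real_def)
      qed
      then show "\<exists>no. \<forall>n\<ge>no. dist (rad_green N (g n) r) (rad_green N G r) < e" by blast
    qed
    then have "(\<lambda>n. V (Suc n) r) \<longlonglongrightarrow> \<alpha> - rad_green N G r" unfolding VSuc by (intro tendsto_intros)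
    moreover have "(\<lambda>n. V (Suc n) r) \<longlonglongrightarrow> W r" using limW[OF r] by (rule LIMSEQ_Suc)
    ultimately show ?thesis using LIMSEQ_unique by blast
  qed
  define p where "p r = - rad_avg N G r" for r
  show ?thesis
  proof (rule exI[of _ W], rule exI[of _ p], intro conjI allI impI)
    show "continuous_on {0..1} p" unfolding p_def by (intro continuous_intros rad_avg_cont N cG)
    show "W 0 = \<alpha>" using fixW[of 0] by (simp add: rad_green_def)
    show "p 0 = - (a 0 * exp (W 0)) / real N" by (simp add: p_def rad_avg_def G_def)
    fix r :: real assume r: "0 < r" "r < 1"
    have "((\<lambda>r. \<alpha> - rad_green N G r) has_real_derivative r * p r) (at r)"
      by (rule DERIV_cong[OF DERIV_diff[OF DERIV_const rad_green_deriv[OF N cG r]]]) (simp add: p_def)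
    moreover have "\<forall>\<^sub>F x in nhds r. W x = \<alpha> - rad_green N G x"
      using eventually_nhds_in_open[of "{0<..<1}" r] r by (auto elim!: eventually_mono intro!: fixW)
    ultimately show "(W has_real_derivative r * p r) (at r)"
      by (subst DERIV_cong_ev[OF refl _ refl])
    show "(p has_real_derivative - (a r * exp (W r) + real N * p r) / r) (at r)"
      unfolding p_def[abs_def]
      by (rule DERIV_cong[OF DERIV_minus[OF rad_avg_deriv[OF N cG r]]]) (use r in \<open>simp add: G_def field_simps\<close>)
  qed (fact cW)
qed

section \<open>Weak solutions\<close>

lemma AE_not_sphere: "AE x :: 'a::euclidean_space in lborel. x \<notin> sphere c r"
proof -
  have "sphere c r \<in> null_sets lborel"
    using negligible_sphere[of c r]
    by (auto simp: null_sets_completion_iff negligible_iff_null_sets)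
  then show ?thesis by (rule AE_not_in)
qed

text \<open>Only the open segment has to lie in the ball: an endpoint may be an exit point on the
  sphere, where F is continuous but no derivative is assumed.\<close>

lemma segment_in_ball_lipschitz:
  fixes F :: "'a::real_normed_vector \<Rightarrow> real"
  assumes cF: "continuous_on (cball 0 1) F"
    and d: "\<And>x. x \<in> ball 0 1 \<Longrightarrow> ((\<lambda>t. F (x + t *\<^sub>R b)) has_real_derivative F' x) (at 0)"
    and M: "\<And>x. x \<in> ball 0 1 \<Longrightarrow> \<bar>F' x\<bar> \<le> M"
    and t: "0 < t" and in_ball: "\<And>s. 0 < s \<Longrightarrow> s < t \<Longrightarrow> x + s *\<^sub>R b \<in> ball 0 1"
    and ends: "x \<in> cball 0 1" "x + t *\<^sub>R b \<in> cball 0 1"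
  shows "\<bar>F (x + t *\<^sub>R b) - F x\<bar> \<le> M * t"
proof -
  let ?h = "\<lambda>s. F (x + s *\<^sub>R b)"
  have D: "(?h has_real_derivative F' (x + s *\<^sub>R b)) (at s)" if "0 < s" "s < t" for s
  proof -
    have "((\<lambda>t. F (x + s *\<^sub>R b + t *\<^sub>R b)) has_real_derivative F' (x + s *\<^sub>R b)) (at 0)"
      by (rule d[OF in_ball[OF that]])
    then show ?thesis
      using DERIV_shift[of ?h "F' (x + s *\<^sub>R b)" 0 s] by (simp add: algebra_simps)
  qed
  have "x + s *\<^sub>R b \<in> cball 0 1" if "s \<in> {0..t}" for s
    using in_ball[of s] ends that by (cases "s = 0 \<or> s = t") auto
  then have "continuous_on {0..t} ?h"
    by (intro continuous_on_compose2[OF cF] continuous_intros) auto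
  moreover have "?h differentiable (at s)" if "0 < s" "s < t" for s
    using D[OF that] by (auto simp: real_differentiable_def)
  ultimately obtain l z where z: "0 < z" "z < t" "(?h has_real_derivative l) (at z)" "?h t - ?h 0 = (t - 0) * l"
    using MVT[OF t, of ?h] by blast
  have "l = F' (x + z *\<^sub>R b)" using DERIV_unique[OF z(3) D[OF z(1,2)]] .
  then have "\<bar>l\<bar> \<le> M" using M[OF in_ball[OF z(1,2)]] by simp
  then show ?thesis using z(4) t by (simp add: abs_mult mult.commute mult_left_mono)
qed

text \<open>F vanishes at the point where the ray first leaves the ball, which is reached no later
  than t.\<close>

lemma exit_bound:
  fixes F :: "'a::real_normed_vector \<Rightarrow> real"
  assumes cF: "continuous_on (cball 0 1) F" and F0: "\<And>x. norm x = 1 \<Longrightarrow> F x = 0"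
    and d: "\<And>x. x \<in> ball 0 1 \<Longrightarrow> ((\<lambda>t. F (x + t *\<^sub>R b)) has_real_derivative F' x) (at 0)"
    and M: "\<And>x. x \<in> ball 0 1 \<Longrightarrow> \<bar>F' x\<bar> \<le> M"
    and x: "x \<in> ball 0 1" and t: "0 \<le> t" "x + t *\<^sub>R b \<notin> ball 0 1"
  shows "\<bar>F x\<bar> \<le> M * t"
proof -
  have "continuous_on {0..t} (\<lambda>s. norm (x + s *\<^sub>R b))" by (intro continuous_intros)
  then obtain r where r: "0 < r" "r \<le> t" "norm (x + r *\<^sub>R b) = 1" "\<And>s. 0 \<le> s \<Longrightarrow> s < r \<Longrightarrow> norm (x + s *\<^sub>R b) < 1"
    using first_crossing[of 0 t "\<lambda>s. norm (x + s *\<^sub>R b)" 1] x t by auto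
  have "\<bar>F (x + r *\<^sub>R b) - F x\<bar> \<le> M * r"
    by (rule segment_in_ball_lipschitz[OF cF d M r(1)]) (use r x in auto)
  moreover have "0 \<le> M" using M[OF x] by linarith
  then have "M * r \<le> M * t" using r(2) by (rule mult_left_mono[rotated])
  ultimately show ?thesis using F0[OF r(3)] by simp
qed

text \<open>Extended by zero, \<open>F\<close> is Lipschitz along \<open>b\<close>, so its difference quotients are dominated; their
  integrals vanish by translation invariance.\<close>

lemma integral_directional_derivative_eq_0:
  fixes F :: "'a::euclidean_space \<Rightarrow> real"
  assumes cF: "continuous_on (cball 0 1) F" and F0: "\<And>x. norm x = 1 \<Longrightarrow> F x = 0"
    and d: "\<And>x. x \<in> ball 0 1 \<Longrightarrow> ((\<lambda>t. F (x + t *\<^sub>R b)) has_real_derivative F' x) (at 0)"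
    and M: "\<And>x. x \<in> ball 0 1 \<Longrightarrow> \<bar>F' x\<bar> \<le> M"
    and cF': "continuous_on (ball 0 1 - {0}) F'"
  shows "integrable lborel (\<lambda>x. indicator (ball 0 1 - {0}) x *\<^sub>R F' x)"
    and "integral\<^sup>L lborel (\<lambda>x. indicator (ball 0 1 - {0}) x *\<^sub>R F' x) = 0"
proof -
  define G where "G x = indicator (cball 0 1) x *\<^sub>R F x" for x
  have GF: "G x = F x" if "norm x \<le> 1" for x using that by (simp add: G_def)
  have G0: "G x = 0" if "norm x \<ge> 1" for x using that F0[of x] by (auto simp: G_def indicator_def)
  have M0: "M \<ge> 0" using M[of 0] by simp
  have d': "((\<lambda>t. F (x + t *\<^sub>R (- b))) has_real_derivative - F' x) (at 0)" if "x \<in> ball 0 1" for x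
    using d[OF that] DERIV_mirror[of "\<lambda>t. F (x + t *\<^sub>R b)" "F' x" 0] by simp
  have M': "\<bar>- F' x\<bar> \<le> M" if "x \<in> ball 0 1" for x using M[OF that] by simp
  have lip: "\<bar>G (x + t *\<^sub>R b) - G x\<bar> \<le> M * t" if t: "0 < t" for x t
  proof -
    let ?y = "x + t *\<^sub>R b"
    show ?thesis
    \<comment> \<open>If the segment is outside the ball at time s, the two endpoints are bounded
      separately by their distance in time from s, the second one along the direction
      \<open>- b\<close>.\<close>
    proof (cases "\<exists>s. 0 \<le> s \<and> s \<le> t \<and> x + s *\<^sub>R b \<notin> ball 0 1")
      case False
      then have s: "x + s *\<^sub>R b \<in> ball 0 1" if "0 \<le> s" "s \<le> t" for s using that by blast
      have "\<bar>F ?y - F x\<bar> \<le> M * t"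
        by (rule segment_in_ball_lipschitz[OF cF d M t]) (use s[of 0] s[of t] s t in \<open>auto intro: less_imp_le\<close>)
      then show ?thesis using s[of 0] s[of t] t by (simp add: GF)
    next
      case True
      then obtain s where s: "0 \<le> s" "s \<le> t" "x + s *\<^sub>R b \<notin> ball 0 1" by blast
      have "\<bar>G x\<bar> \<le> M * s"
      proof (cases "x \<in> ball 0 1")
        case True
        have "\<bar>F x\<bar> \<le> M * s" by (rule exit_bound[OF cF F0 d M True s(1,3)])
        then show ?thesis using True by (simp add: GF)
      qed (use G0[of x] s M0 in auto)
      moreover have "\<bar>G ?y\<bar> \<le> M * (t - s)"
      proof (cases "?y \<in> ball 0 1")
        case True
        have "\<bar>F ?y\<bar> \<le> M * (t - s)"
          by (rule exit_bound[OF cF F0 d' M' True]) (use s in \<open>auto simp: algebra_simps\<close>)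
        then show ?thesis using True by (simp add: GF)
      qed (use G0[of ?y] s M0 in auto)
      ultimately have "\<bar>G ?y - G x\<bar> \<le> M * s + M * (t - s)" by linarith
      then show ?thesis by (simp add: algebra_simps)
    qed
  qed
  have Gint: "integrable lborel G" unfolding G_def by (rule borel_integrable_compact[OF compact_cball cF])
  have Gmeas: "G \<in> borel_measurable borel" using borel_measurable_integrable[OF Gint] by simp
  define h where "h n = 1 / real (Suc n)" for n
  have h: "h n > 0" "h n \<le> 1" for n by (auto simp: h_def)
  have hlim: "h \<longlonglongrightarrow> 0" unfolding h_def by (rule LIMSEQ_Suc[OF lim_1_over_n])
  define S where "S n x = (G (h n *\<^sub>R b + x) - G x) / h n" for n x
  define f where "f x = indicator (ball 0 1 - {0}) x *\<^sub>R F' x" for x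
  \<comment> \<open>As \<open>h n \<le> 1\<close>, every difference quotient vanishes outside the
    ball of radius \<open>1 + norm b\<close>.\<close>
  define w where "w x = indicator (cball 0 (1 + norm b)) x *\<^sub>R M" for x :: 'a
  have trans: "integrable lborel (\<lambda>x. G (c + x))" "integral\<^sup>L lborel (\<lambda>x. G (c + x)) = integral\<^sup>L lborel G" for c
  proof -
    have "integrable (distr lborel borel ((+) c)) G" by (simp add: lborel_distr_plus Gint)
    then show "integrable lborel (\<lambda>x. G (c + x))"
      by (rule integrable_distr[rotated]) simp
    have "integral\<^sup>L (distr lborel borel ((+) c)) G = integral\<^sup>L lborel (\<lambda>x. G (c + x))"
      by (rule integral_distr) (use Gmeas in auto)
    then show "integral\<^sup>L lborel (\<lambda>x. G (c + x)) = integral\<^sup>L lborel G" by (simp add: lborel_distr_plus)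
  qed
  have fm: "f \<in> borel_measurable lborel"
    unfolding f_def using borel_measurable_continuous_on_indicator[OF _ cF'] by simp
  have Sm: "S n \<in> borel_measurable lborel" for n
    unfolding S_def using trans(1) Gint by (intro borel_measurable_divide borel_measurable_diff) auto
  have wint: "integrable lborel w"
    unfolding w_def by (rule borel_integrable_compact) auto
  \<comment> \<open>The sphere, where the quotients need not converge, and the origin, where f was
    set to zero, are null sets.\<close>
  have lim: "AE x in lborel. (\<lambda>n. S n x) \<longlonglongrightarrow> f x"
    using AE_not_sphere[of 0 1] AE_lborel_singleton[of 0]
  proof eventually_elim
    case (elim x)
    show ?case
    proof (cases "x \<in> ball 0 1")
      case True
      have "(\<lambda>n. (F (x + h n *\<^sub>R b) - F (x + 0 *\<^sub>R b)) / (h n - 0)) \<longlonglongrightarrow> F' x"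
      proof (rule filterlim_compose[of "\<lambda>t. (F (x + t *\<^sub>R b) - F (x + 0 *\<^sub>R b)) / (t - 0)"])
        show "((\<lambda>t. (F (x + t *\<^sub>R b) - F (x + 0 *\<^sub>R b)) / (t - 0)) \<longlongrightarrow> F' x) (at 0)"
          using d[OF True] unfolding has_field_derivative_iff .
        show "filterlim h (at 0) sequentially"
          unfolding filterlim_at using hlim h(1) by (auto simp: less_imp_neq[symmetric])
      qed
      moreover have "\<forall>\<^sub>F n in sequentially. (F (x + h n *\<^sub>R b) - F (x + 0 *\<^sub>R b)) / (h n - 0) = S n x"
      proof -
        have "\<forall>\<^sub>F n in sequentially. x + h n *\<^sub>R b \<in> ball 0 1"
          using filterlim_iff[THEN iffD1, OF hlim] eventually_line_in_open[OF open_ball True, of b] by blast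
        then show ?thesis
          by eventually_elim (use True in \<open>simp add: S_def GF add.commute\<close>)
      qed
      ultimately have "(\<lambda>n. S n x) \<longlonglongrightarrow> F' x" by (rule Lim_transform_eventually)
      then show ?thesis using True elim by (simp add: f_def)
    next
      case False
      then have x1: "norm x > 1" using elim by auto
      have "\<forall>\<^sub>F t in nhds 0. x + t *\<^sub>R b \<in> - cball 0 1"
        by (rule eventually_line_in_open) (use x1 in auto)
      then have "\<forall>\<^sub>F n in sequentially. x + h n *\<^sub>R b \<in> - cball 0 1"
        using filterlim_iff[THEN iffD1, OF hlim] by blast
      then have "\<forall>\<^sub>F n in sequentially. 0 = S n x"
        by eventually_elim (use x1 in \<open>auto simp: S_def G0 add.commute\<close>)
      then have "(\<lambda>n. S n x) \<longlonglongrightarrow> 0" by (rule Lim_transform_eventually[OF tendsto_const])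
      then show ?thesis using False by (simp add: f_def)
    qed
  qed
  have bound: "AE x in lborel. norm (S n x) \<le> w x" for n
  proof (rule AE_I2)
    fix x :: 'a
    have L: "\<bar>S n x\<bar> \<le> M"
      using lip[of "h n" x] h(1)[of n] by (simp add: S_def abs_divide add.commute pos_divide_le_eq)
    have "S n x = 0" if "norm x > 1 + norm b"
    proof -
      have "norm x \<le> norm (h n *\<^sub>R b + x) + norm (h n *\<^sub>R b)"
        using norm_triangle_sub[of x "- (h n *\<^sub>R b)"] by (simp add: add.commute)
      also have "norm (h n *\<^sub>R b) \<le> norm b" using h[of n] by (simp add: mult_left_le_one_le)
      finally have "norm (h n *\<^sub>R b + x) > 1" using that by linarith
      moreover have "norm x > 1" using that norm_ge_zero[of b] by linarith
      ultimately show ?thesis by (simp add: S_def G0)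
    qed
    then show "norm (S n x) \<le> w x" using L by (auto simp: w_def indicator_def)
  qed
  have "integral\<^sup>L lborel (S n) = 0" for n
    unfolding S_def using trans Gint by simp
  moreover have "(\<lambda>n. integral\<^sup>L lborel (S n)) \<longlonglongrightarrow> integral\<^sup>L lborel f"
    by (rule integral_dominated_convergence[OF fm Sm wint lim bound])
  ultimately have "integral\<^sup>L lborel f = 0" by (simp add: LIMSEQ_const_iff)
  moreover have "integrable lborel f"
    by (rule integrable_dominated_convergence[OF fm Sm wint lim bound])
  ultimately show "integrable lborel (\<lambda>x. indicator (ball 0 1 - {0}) x *\<^sub>R F' x)"
    and "integral\<^sup>L lborel (\<lambda>x. indicator (ball 0 1 - {0}) x *\<^sub>R F' x) = 0"
    unfolding f_def by auto
qed

text \<open>Trades the completed measure on the open ball for Borel integrals over the closed one,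
  on which continuous functions are integrable by compactness; the sphere between them is a null
  set.\<close>

lemma integral_on_ball:
  fixes E g :: "'a::euclidean_space \<Rightarrow> real"
  assumes cE: "continuous_on (cball 0 1) E" and eq: "\<And>x. x \<in> ball 0 1 \<Longrightarrow> g x = E x"
  shows "integrable (lebesgue_on (ball 0 1)) g"
    and "integral\<^sup>L (lebesgue_on (ball 0 1)) g = integral\<^sup>L lborel (\<lambda>x. indicator (cball 0 1) x *\<^sub>R E x)"
proof -
  let ?g = "\<lambda>x. indicator (ball 0 1) x *\<^sub>R E x" and ?E = "\<lambda>x. indicator (cball 0 1) x *\<^sub>R E x"
  have ge: "(\<lambda>x. indicator (ball 0 1) x *\<^sub>R g x) = ?g" using eq by (auto simp: indicator_def fun_eq_iff)
  have Eint: "integrable lborel ?E" by (rule borel_integrable_compact[OF compact_cball cE])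
  have gm: "?g \<in> borel_measurable lborel"
    using borel_measurable_continuous_on_indicator[OF _ continuous_on_subset[OF cE ball_subset_cball]] by simp
  have ae: "AE x in lborel. ?g x = ?E x"
    using AE_not_sphere[of 0 1] by eventually_elim (auto simp: indicator_def)
  have "integrable lborel ?g"
    using integrable_cong_AE[OF gm _ ae] Eint by auto
  then have "integrable lebesgue ?g" by (simp add: integrable_completion gm)
  then show "integrable (lebesgue_on (ball 0 1)) g"
    by (subst integrable_restrict_space) (simp_all add: ge del: real_scaleR_def)
  have "integral\<^sup>L (lebesgue_on (ball 0 1)) g = integral\<^sup>L lebesgue ?g"
    by (subst integral_restrict_space) (simp_all add: ge del: real_scaleR_def)
  also have "\<dots> = integral\<^sup>L lborel ?g" by (rule integral_completion[OF gm])
  also have "\<dots> = integral\<^sup>L lborel ?E"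
    by (rule integral_cong_AE[OF gm _ ae]) (use Eint in auto)
  finally show "integral\<^sup>L (lebesgue_on (ball 0 1)) g = integral\<^sup>L lborel ?E" .
qed

lemma norm_line_deriv:
  fixes x :: "'a::real_inner"
  assumes "x \<noteq> 0"
  shows "((\<lambda>t. norm (x + t *\<^sub>R b)) has_real_derivative (x \<bullet> b) / norm x) (at 0)"
proof -
  have e: "norm (x + t *\<^sub>R b) = sqrt (x \<bullet> x + 2 * t * (x \<bullet> b) + t\<^sup>2 * (b \<bullet> b))" for t
    by (simp add: norm_eq_sqrt_inner inner_add_left inner_add_right inner_commute power2_eq_square algebra_simps)
  have "((\<lambda>t. sqrt (x \<bullet> x + 2 * t * (x \<bullet> b) + t\<^sup>2 * (b \<bullet> b))) has_real_derivative (x \<bullet> b) / sqrt (x \<bullet> x)) (at 0)"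
    using assms inner_gt_zero_iff[of x]
    by (auto intro!: derivative_eq_intros simp: field_simps simp del: inner_gt_zero_iff)
  then show ?thesis unfolding e by (simp add: norm_eq_sqrt_inner)
qed

text \<open>Subtracting \<open>v 1\<close> gives zero boundary values and moves the constant into
  the parameter \<open>exp (v 1)\<close>. Green's second identity is obtained one coordinate at a
  time: the derivative along b of U times the b-derivative of \<xi> minus \<xi> times the
  b-derivative of U integrates to zero, because U and \<xi> vanish on the sphere.\<close>

lemma shooting_weak_solution:
  fixes a :: "real \<Rightarrow> real"
  defines "N \<equiv> DIM('a::euclidean_space)"
  assumes ca: "continuous_on {0..1} a" and cv: "continuous_on {0..1} v" and cp: "continuous_on {0..1} p"
    and dv: "\<And>r. 0 < r \<Longrightarrow> r < 1 \<Longrightarrow> (v has_real_derivative r * p r) (at r)"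
    and dp: "\<And>r. 0 < r \<Longrightarrow> r < 1 \<Longrightarrow> (p has_real_derivative - (a r * exp (v r) + real N * p r) / r) (at r)"
  shows "weak_solution a (exp (v 1)) (\<lambda>x::'a. v (norm x) - v 1)"
proof -
  define U where "U x = v (norm x) - v 1" for x :: 'a
  define h where "h r = a r * exp (v r)" for r
  have ch: "continuous_on {0..1} h" unfolding h_def by (intro continuous_intros ca cv)
  have cn: "continuous_on (cball 0 1) (\<lambda>x::'a. f (norm x))" if "continuous_on {0..1} f" for f :: "real \<Rightarrow> real"
    by (rule continuous_on_compose2[OF that]) (auto intro!: continuous_intros)
  have cU: "continuous_on (cball 0 1) U" unfolding U_def by (intro continuous_intros cn cv)
  have lU: "exp (v 1) * a (norm x) * exp (U x) = h (norm x)" for x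
    by (simp add: U_def h_def exp_diff)
  have bdd: "\<exists>B. \<forall>x\<in>cball 0 1. \<bar>f x\<bar> \<le> B" if "continuous_on (cball 0 1) f" for f :: "'a \<Rightarrow> real"
    using compact_imp_bounded[OF compact_continuous_image[OF that compact_cball]]
    by (auto simp: bounded_iff)
  \<comment> \<open>The second derivative of U along b. At the origin the quotient is zero by the
    convention for division, which leaves the correct value \<open>p 0\<close>; continuity is
    claimed only away from the origin.\<close>
  define Gd where "Gd b x = p (norm x) - (h (norm x) + real N * p (norm x)) * ((x \<bullet> b) / norm x)\<^sup>2" for b x :: 'a
  have dU: "((\<lambda>t. U (x + t *\<^sub>R b)) has_real_derivative p (norm x) * (x \<bullet> b)) (at 0)"
    if x: "x \<in> ball 0 1" and b: "b \<in> Basis" for x b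
  proof (cases "x = 0")
    case False
    have "((\<lambda>t. v (norm (x + t *\<^sub>R b))) has_real_derivative (norm x * p (norm x)) * ((x \<bullet> b) / norm x)) (at 0)"
      by (rule DERIV_chain2[where f=v and g="\<lambda>t. norm (x + t *\<^sub>R b)"])
        (use x False norm_line_deriv[OF False, of b] dv[of "norm x"] in auto)
    then show ?thesis unfolding U_def using False by (auto intro!: derivative_eq_intros)
  next
    case True
    obtain B where "\<forall>r\<in>{0..1}. \<bar>p r\<bar> \<le> B"
      using compact_imp_bounded[OF compact_continuous_image[OF cp compact_Icc]] by (auto simp: bounded_iff)
    then have B: "\<bar>p r\<bar> \<le> B" if "r \<in> {0..1}" for r using that by blast
    have nb: "norm b = 1" using b by simp
    \<comment> \<open>Quadratic growth, from \<open>v' = r * p\<close> with p bounded, makes U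
      differentiable at the origin with derivative zero.\<close>
    have vb: "\<bar>v t - v 0\<bar> \<le> B * t\<^sup>2" if t: "0 < t" "t < 1" for t
    proof -
      have "continuous_on {0..t} v" by (rule continuous_on_subset[OF cv]) (use t in auto)
      moreover have "v differentiable (at s)" if "0 < s" "s < t" for s
        using dv[of s] that t by (auto simp: real_differentiable_def)
      ultimately obtain l z where z: "0 < z" "z < t" "(v has_real_derivative l) (at z)" "v t - v 0 = (t - 0) * l"
        using MVT[OF t(1), of v] by blast
      have l: "l = z * p z" using DERIV_unique[OF z(3) dv] z t by auto
      have "\<bar>l\<bar> \<le> t * B"
        unfolding l abs_mult using z t B[of z] by (intro mult_mono) auto
      then have "t * \<bar>l\<bar> \<le> t * (t * B)" using t by (intro mult_left_mono) auto
      then show ?thesis using z(4) t by (simp add: abs_mult power2_eq_square mult_ac)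
    qed
    have "((\<lambda>t. (v \<bar>t\<bar> - v 0) / t) \<longlongrightarrow> 0) (at 0)"
    proof (rule Lim_null_comparison)
      show "\<forall>\<^sub>F t in at 0. norm ((v \<bar>t\<bar> - v 0) / t) \<le> B * \<bar>t\<bar>"
        unfolding eventually_at
      proof (intro exI[of _ 1] conjI ballI impI)
        fix t :: real assume "t \<noteq> 0 \<and> dist t 0 < 1"
        then have t: "0 < \<bar>t\<bar>" "\<bar>t\<bar> < 1" by (auto simp: dist_real_def)
        have "\<bar>v \<bar>t\<bar> - v 0\<bar> / \<bar>t\<bar> \<le> B * \<bar>t\<bar>\<^sup>2 / \<bar>t\<bar>" using vb[OF t] by (intro divide_right_mono) auto
        also have "\<dots> = B * \<bar>t\<bar>"
        proof -
          have "B * s\<^sup>2 / s = B * s" if "s > 0" for s using that by (simp add: power2_eq_square)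
          then show ?thesis using t(1) .
        qed
        finally show "norm ((v \<bar>t\<bar> - v 0) / t) \<le> B * \<bar>t\<bar>" by (simp add: abs_divide)
      qed simp
      show "((\<lambda>t. B * \<bar>t\<bar>) \<longlongrightarrow> 0) (at 0)" by (auto intro!: tendsto_eq_intros)
    qed
    then show ?thesis using True nb by (simp add: has_field_derivative_iff U_def)
  qed
  have dG: "((\<lambda>t. p (norm (x + t *\<^sub>R b)) * ((x + t *\<^sub>R b) \<bullet> b)) has_real_derivative Gd b x) (at 0)"
    if x: "x \<in> ball 0 1" and b: "b \<in> Basis" for x b
  proof (cases "x = 0")
    case False
    have bb: "b \<bullet> b = 1" using b by simp
    have "((\<lambda>t. p (norm (x + t *\<^sub>R b))) has_real_derivative
        - (a (norm x) * exp (v (norm x)) + real N * p (norm x)) / norm x * ((x \<bullet> b) / norm x)) (at 0)"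
      by (rule DERIV_chain2[where f=p and g="\<lambda>t. norm (x + t *\<^sub>R b)"])
        (use x False norm_line_deriv[OF False, of b] dp[of "norm x"] in auto)
    moreover have "((\<lambda>t. (x + t *\<^sub>R b) \<bullet> b) has_real_derivative 1) (at 0)"
      unfolding inner_add_left inner_scaleR_left bb by (auto intro!: derivative_eq_intros)
    ultimately have "((\<lambda>t. p (norm (x + t *\<^sub>R b)) * ((x + t *\<^sub>R b) \<bullet> b)) has_real_derivative
        - (a (norm x) * exp (v (norm x)) + real N * p (norm x)) / norm x * ((x \<bullet> b) / norm x) * ((x + 0 *\<^sub>R b) \<bullet> b)
        + 1 * p (norm (x + 0 *\<^sub>R b))) (at 0)"
      by (rule DERIV_mult)
    then show ?thesis by (rule DERIV_cong) (use False in \<open>simp add: Gd_def h_def power2_eq_square field_simps\<close>)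
  next
    case True
    have nb: "norm b = 1" "b \<bullet> b = 1" using b by auto
    have "(p \<longlongrightarrow> p 0) (at_right 0)" using tendsto_at_right_of_cont[OF cp] by simp
    moreover have "LIM t at 0. \<bar>t::real\<bar> :> at_right 0"
      unfolding filterlim_at by (auto intro!: tendsto_eq_intros simp: eventually_at_filter)
    ultimately have "((\<lambda>t. p \<bar>t\<bar>) \<longlongrightarrow> p 0) (at 0)" by (rule filterlim_compose)
    moreover have "\<forall>\<^sub>F t in at 0. p \<bar>t\<bar> = (p \<bar>t\<bar> * t) / t" by (auto simp: eventually_at_filter)
    ultimately have "((\<lambda>t. (p \<bar>t\<bar> * t) / t) \<longlongrightarrow> p 0) (at 0)" by (rule Lim_transform_eventually)
    then show ?thesis using True nb by (simp add: has_field_derivative_iff Gd_def)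
  qed
  have Gdbd: "\<exists>B. \<forall>x\<in>ball 0 1. \<bar>Gd b x\<bar> \<le> B" if b: "b \<in> Basis" for b
  proof -
    obtain B1 where B1: "\<forall>x\<in>cball (0::'a) 1. \<bar>p (norm x)\<bar> \<le> B1" using bdd[OF cn[OF cp]] by blast
    obtain B2 where B2: "\<forall>x\<in>cball (0::'a) 1. \<bar>h (norm x) + real N * p (norm x)\<bar> \<le> B2"
      using bdd[OF continuous_on_add[OF cn[OF ch] continuous_on_mult_left[OF cn[OF cp], of "real N"]]] by blast
    have "\<bar>Gd b x\<bar> \<le> B1 + B2 * 1" if x: "x \<in> ball 0 1" for x
    proof -
      have "\<bar>(x \<bullet> b) / norm x\<bar> \<le> 1"
        using Basis_le_norm[OF b, of x] by (cases "x = 0") (auto simp: abs_divide divide_simps)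
      then have "((x \<bullet> b) / norm x)\<^sup>2 \<le> 1" by (simp only: abs_square_le_1)
      then have "\<bar>(h (norm x) + real N * p (norm x)) * ((x \<bullet> b) / norm x)\<^sup>2\<bar> \<le> B2 * 1"
        unfolding abs_mult using bspec[OF B2, of x] x by (intro mult_mono) auto
      then show ?thesis unfolding Gd_def using bspec[OF B1, of x] x by auto
    qed
    then show ?thesis by blast
  qed
  have weak: "- (\<integral>x. U x * laplacian \<xi> x \<partial>lebesgue_on (ball 0 1)) =
      (\<integral>x. exp (v 1) * a (norm x) * exp (U x) * \<xi> x \<partial>lebesgue_on (ball 0 1))"
    if \<xi>: "C2_closure (ball 0 1) \<xi>" "\<forall>x\<in>sphere 0 1. \<xi> x = 0" for \<xi> :: "'a \<Rightarrow> real"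
  proof -
    obtain D1 D2 where D1: "\<forall>x\<in>ball 0 1. (\<xi> has_derivative blinfun_apply (D1 x)) (at x)"
      and D2: "\<forall>x\<in>ball 0 1. (D1 has_derivative blinfun_apply (D2 x)) (at x)"
      and c\<xi>: "continuous_on (cball 0 1) \<xi>" and cD1: "continuous_on (cball 0 1) D1"
      and cD2: "continuous_on (cball 0 1) D2"
      using \<xi>(1) unfolding C2_closure_def closure_ball[OF zero_less_one] by blast
    define L where "L x = (\<Sum>b\<in>Basis. D2 x b b)" for x
    have lap: "laplacian \<xi> x = L x" if "x \<in> ball 0 1" for x
      unfolding L_def by (rule laplacian_eq[OF open_ball that D1 D2])
    have cD2b: "continuous_on (cball 0 1) (\<lambda>x. D2 x b b)" for b by (intro continuous_intros cD2)
    have cD1b: "continuous_on (cball 0 1) (\<lambda>x. D1 x b)" for b by (intro continuous_intros cD1)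
    have cL: "continuous_on (cball 0 1) L" unfolding L_def by (intro continuous_intros cD2b)
    define F' where "F' b x = U x * D2 x b b - \<xi> x * Gd b x" for b x
    have int0: "integrable lborel (\<lambda>x. indicator (ball 0 1 - {0}) x *\<^sub>R F' b x)"
      "integral\<^sup>L lborel (\<lambda>x. indicator (ball 0 1 - {0}) x *\<^sub>R F' b x) = 0" if b: "b \<in> Basis" for b
    proof -
      let ?F = "\<lambda>x. U x * D1 x b - \<xi> x * (p (norm x) * (x \<bullet> b))"
      have cF: "continuous_on (cball 0 1) ?F" by (intro continuous_intros cU cD1b c\<xi> cn cp)
      have F0: "?F x = 0" if "norm x = 1" for x using that \<xi>(2) by (simp add: U_def)
      have d: "((\<lambda>t. ?F (x + t *\<^sub>R b)) has_real_derivative F' b x) (at 0)" if x: "x \<in> ball 0 1" for x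
      proof -
        have l: "((\<lambda>t. \<xi> (x + t *\<^sub>R b)) has_real_derivative D1 x b) (at 0)"
          "((\<lambda>t. D1 (x + t *\<^sub>R b) b) has_real_derivative D2 x b b) (at 0)"
          using C2_closure_line_derivs[OF D1 D2, of x 0 b] x by simp_all
        show ?thesis
          by (rule DERIV_cong[OF DERIV_diff[OF DERIV_mult[OF dU[OF x b] l(2)] DERIV_mult[OF l(1) dG[OF x b]]]])
            (simp add: F'_def algebra_simps)
      qed
      obtain B1 where B1: "\<forall>x\<in>cball 0 1. \<bar>U x * D2 x b b\<bar> \<le> B1"
        using bdd[OF continuous_on_mult[OF cU cD2b]] by blast
      obtain B2 where B2: "\<forall>x\<in>cball 0 1. \<bar>\<xi> x\<bar> \<le> B2" using bdd[OF c\<xi>] by blast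
      obtain B3 where B3: "\<forall>x\<in>ball 0 1. \<bar>Gd b x\<bar> \<le> B3" using Gdbd[OF b] by blast
      have M: "\<bar>F' b x\<bar> \<le> B1 + B2 * B3" if x: "x \<in> ball 0 1" for x
      proof -
        have "\<bar>\<xi> x * Gd b x\<bar> \<le> B2 * B3"
          unfolding abs_mult using bspec[OF B2, of x] bspec[OF B3, of x] x by (intro mult_mono) auto
        moreover have "\<bar>U x * D2 x b b\<bar> \<le> B1" using B1 x by auto
        ultimately show ?thesis unfolding F'_def by linarith
      qed
      have sub: "continuous_on (ball 0 1 - {0}) f" if "continuous_on (cball 0 1) f" for f :: "'a \<Rightarrow> real"
        by (rule continuous_on_subset[OF that]) auto
      have cF': "continuous_on (ball 0 1 - {0}) (F' b)"
        unfolding F'_def Gd_def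
        by (intro continuous_intros sub[OF cU] sub[OF cD2b] sub[OF c\<xi>] sub[OF cn[OF cp]] sub[OF cn[OF ch]]) auto
      show "integrable lborel (\<lambda>x. indicator (ball 0 1 - {0}) x *\<^sub>R F' b x)"
        "integral\<^sup>L lborel (\<lambda>x. indicator (ball 0 1 - {0}) x *\<^sub>R F' b x) = 0"
        using integral_directional_derivative_eq_0[OF cF F0 d M cF'] by blast+
    qed
    let ?E1 = "\<lambda>x. U x * L x" and ?E2 = "\<lambda>x. h (norm x) * \<xi> x"
    have cE1: "continuous_on (cball 0 1) ?E1" by (intro continuous_intros cU cL)
    have cE2: "continuous_on (cball 0 1) ?E2" by (intro continuous_intros cn ch c\<xi>)
    have i1: "integrable lborel (\<lambda>x. indicator (cball 0 1) x *\<^sub>R ?E1 x)"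
      by (rule borel_integrable_compact[OF compact_cball cE1])
    have i2: "integrable lborel (\<lambda>x. indicator (cball 0 1) x *\<^sub>R ?E2 x)"
      by (rule borel_integrable_compact[OF compact_cball cE2])
    \<comment> \<open>The squares of the direction cosines sum to one, so the trace of
      \<open>Gd\<close> is \<open>- h\<close>: this is the radial equation read as
      \<open>\<Delta> U = - h\<close>.\<close>
    have sumF': "(\<Sum>b\<in>Basis. F' b x) = ?E1 x + ?E2 x" if "x \<noteq> 0" for x
    proof -
      have "(\<Sum>b\<in>Basis. ((x \<bullet> b) / norm x)\<^sup>2) = (\<Sum>b\<in>Basis. (x \<bullet> b) * (x \<bullet> b)) / (norm x)\<^sup>2"
        by (simp add: power_divide power2_eq_square sum_divide_distrib)
      also have "\<dots> = 1" unfolding euclidean_inner[symmetric] using that by (simp add: power2_norm_eq_inner)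
      finally have s1: "(\<Sum>b\<in>Basis. ((x \<bullet> b) / norm x)\<^sup>2) = 1" .
      have "(\<Sum>b\<in>Basis. Gd b x) = real N * p (norm x) - (h (norm x) + real N * p (norm x)) * 1"
        unfolding Gd_def sum_subtractf sum_distrib_left[symmetric] s1 by (simp add: N_def)
      then have "(\<Sum>b\<in>Basis. Gd b x) = - h (norm x)" by simp
      then show ?thesis
        unfolding F'_def sum_subtractf sum_distrib_left[symmetric] L_def[symmetric] by simp
    qed
    have "(\<Sum>b\<in>Basis. integral\<^sup>L lborel (\<lambda>x. indicator (ball 0 1 - {0}) x *\<^sub>R F' b x)) = 0"
      by (rule sum.neutral) (use int0(2) in blast)
    then have "integral\<^sup>L lborel (\<lambda>x. \<Sum>b\<in>Basis. indicator (ball 0 1 - {0}) x *\<^sub>R F' b x) = 0"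
      using Bochner_Integration.integral_sum[of Basis lborel "\<lambda>b x. indicator (ball 0 1 - {0}) x *\<^sub>R F' b x"] int0(1) by simp
    also have "integral\<^sup>L lborel (\<lambda>x. \<Sum>b\<in>Basis. indicator (ball 0 1 - {0}) x *\<^sub>R F' b x) =
        integral\<^sup>L lborel (\<lambda>x. indicator (cball 0 1) x *\<^sub>R ?E1 x + indicator (cball 0 1) x *\<^sub>R ?E2 x)"
    proof (rule integral_cong_AE)
      show "(\<lambda>x. \<Sum>b\<in>Basis. indicator (ball 0 1 - {0}) x *\<^sub>R F' b x) \<in> borel_measurable lborel"
        by (intro borel_measurable_sum borel_measurable_integrable int0(1))
      show "(\<lambda>x. indicator (cball 0 1) x *\<^sub>R ?E1 x + indicator (cball 0 1) x *\<^sub>R ?E2 x) \<in> borel_measurable lborel"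
        by (intro borel_measurable_integrable Bochner_Integration.integrable_add i1 i2)
      show "AE x in lborel. (\<Sum>b\<in>Basis. indicator (ball 0 1 - {0}) x *\<^sub>R F' b x) =
          indicator (cball 0 1) x *\<^sub>R ?E1 x + indicator (cball 0 1) x *\<^sub>R ?E2 x"
        using AE_not_sphere[of 0 1] AE_lborel_singleton[of 0]
      proof eventually_elim
        case (elim x)
        show ?case
        proof (cases "x \<in> ball 0 1")
          case True
          then show ?thesis using sumF'[of x] elim by simp
        next
          case False
          then have "x \<notin> cball 0 1" using elim by auto
          then show ?thesis using False by simp
        qed
      qed
    qed
    also have "\<dots> = integral\<^sup>L lborel (\<lambda>x. indicator (cball 0 1) x *\<^sub>R ?E1 x)
        + integral\<^sup>L lborel (\<lambda>x. indicator (cball 0 1) x *\<^sub>R ?E2 x)"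
      by (rule Bochner_Integration.integral_add[OF i1 i2])
    also have "integral\<^sup>L lborel (\<lambda>x. indicator (cball 0 1) x *\<^sub>R ?E1 x)
        = (\<integral>x. U x * laplacian \<xi> x \<partial>lebesgue_on (ball 0 1))"
      by (rule integral_on_ball(2)[symmetric, OF cE1]) (simp add: lap)
    also have "integral\<^sup>L lborel (\<lambda>x. indicator (cball 0 1) x *\<^sub>R ?E2 x)
        = (\<integral>x. exp (v 1) * a (norm x) * exp (U x) * \<xi> x \<partial>lebesgue_on (ball 0 1))"
      by (rule integral_on_ball(2)[symmetric, OF cE2]) (simp add: lU)
    finally show ?thesis by simp
  qed
  have "integrable (lebesgue_on (ball 0 1)) U" by (rule integral_on_ball(1)[OF cU]) simp
  moreover have "continuous_on (cball 0 1) (\<lambda>x::'a. a (norm x) * exp (U x) * infdist x (sphere 0 1))"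
    by (intro continuous_intros cn ca cU)
  then have "integrable (lebesgue_on (ball 0 1)) (\<lambda>x::'a. a (norm x) * exp (U x) * infdist x (sphere 0 1))"
    by (rule integral_on_ball(1)) simp
  ultimately have "weak_solution a (exp (v 1)) U" unfolding weak_solution_def using weak by blast
  then show ?thesis unfolding U_def .
qed

section \<open>The extremal solution\<close>

lemma radial_ode_cong:
  assumes "radial_ode N v v' h" "\<And>r. 0 < r \<Longrightarrow> r < 1 \<Longrightarrow> h r = k r"
  shows "radial_ode N v v' k"
  using assms unfolding radial_ode_def by auto

lemma shooting_radial_ode:
  assumes "continuous_on {0..1} v" "continuous_on {0..1} p"
    and d: "\<And>r. 0 < r \<Longrightarrow> r < 1 \<Longrightarrow> (v has_real_derivative r * p r) (at r)"
      "\<And>r. 0 < r \<Longrightarrow> r < 1 \<Longrightarrow> (p has_real_derivative - (h r + real N * p r) / r) (at r)"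
  shows "radial_ode N v (\<lambda>r. r * p r) h"
proof -
  obtain B where B: "\<forall>r\<in>{0..1}. \<bar>p r\<bar> \<le> B"
    using compact_imp_bounded[OF compact_continuous_image[OF assms(2) compact_Icc]] by (auto simp: bounded_iff)
  have "\<bar>r * p r\<bar> \<le> 1 * B" if "r \<in> {0<..<1}" for r
    unfolding abs_mult using that bspec[OF B, of r] by (intro mult_mono) auto
  then have "\<exists>M. \<forall>r\<in>{0<..<1}. \<bar>r * p r\<bar> \<le> M" by (intro exI[of _ "1 * B"]) blast
  moreover have "((\<lambda>r. r * p r) has_real_derivative - h r - (real N - 1) / r * (r * p r)) (at r)"
    if "0 < r" "r < 1" for r
    by (rule DERIV_cong[OF DERIV_mult[OF DERIV_ident d(2)[OF that]]]) (use that in \<open>simp add: field_simps\<close>)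
  ultimately show ?thesis unfolding radial_ode_def using assms(1) d(1) by auto
qed

text \<open>Links almost everywhere bounds with the value at the origin: by continuity, a strict
  excess there would fill a whole ball.\<close>

lemma L_infty_on_le_at_point:
  fixes f :: "'a::euclidean_space \<Rightarrow> real"
  assumes ae: "AE x in lebesgue_on (ball 0 1). f x \<le> C" and cf: "isCont f 0"
  shows "f 0 \<le> C"
proof (rule ccontr)
  assume "\<not> f 0 \<le> C"
  then have "\<forall>\<^sub>F x in nhds 0. f x > C"
    using cf by (intro order_tendstoD(1)[of f "f 0"]) (auto simp: isCont_def tendsto_at_iff_tendsto_nhds)
  then obtain d where d: "d > 0" "\<And>x. dist x 0 < d \<Longrightarrow> f x > C" by (auto simp: eventually_nhds_metric)
  have "AE x\<in>ball 0 1 in lebesgue. f x \<le> C" using ae by (simp add: AE_restrict_space_iff)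
  then have ae': "AE x\<in>ball 0 1 in lebesgue. x \<in> - ball (0::'a) d"
    by (rule eventually_mono) (use d(2) in \<open>force simp: dist_commute\<close>)
  have "(0::'a) \<in> - ball 0 d"
    by (rule mem_closed_if_AE_lebesgue_open[OF _ _ ae']) auto
  then show False using d(1) by simp
qed

section \<open>The branch along a ray\<close>

lemma branch_profile:
  fixes u :: "real \<Rightarrow> 'a::euclidean_space \<Rightarrow> real"
  assumes br: "extremal_branch a ls u" and l: "0 < l" "l < ls" and e: "e \<in> Basis"
  shows "\<exists>U'. radial_ode DIM('a) (\<lambda>r. u l (r *\<^sub>R e)) U' (\<lambda>r. l * a r * exp (u l (r *\<^sub>R e)))"
    and "u l e = 0" and "x \<in> ball 0 1 \<Longrightarrow> u l x = u l (norm x *\<^sub>R e)"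
    and "isCont (u l) 0" and "x \<in> ball 0 1 \<Longrightarrow> u l x > 0"
proof -
  have cs: "classical_solution a l (u l)" and rad: "radial_on (ball 0 1) (u l)"
    using br l unfolding extremal_branch_def minimal_classical_solution_def by auto
  have C2: "C2_closure (ball 0 1) (u l)" and eq: "\<And>x. x \<in> ball 0 1 \<Longrightarrow> - laplacian (u l) x = l * a (norm x) * exp (u l x)"
    and bd: "\<And>x. x \<in> sphere 0 1 \<Longrightarrow> u l x = 0" and pos: "\<And>x. x \<in> ball 0 1 \<Longrightarrow> u l x > 0"
    using cs unfolding classical_solution_def by auto
  show "\<exists>U'. radial_ode DIM('a) (\<lambda>r. u l (r *\<^sub>R e)) U' (\<lambda>r. l * a r * exp (u l (r *\<^sub>R e)))"
  proof -
    obtain U' where "radial_ode DIM('a) (\<lambda>r. u l (r *\<^sub>R e)) U' (\<lambda>r. - laplacian (u l) (r *\<^sub>R e))"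
      using radial_reduction[OF C2 rad e] by blast
    then show ?thesis
      by (intro exI[of _ U'], elim radial_ode_cong) (use eq e in auto)
  qed
  show "u l e = 0" using bd[of e] e by simp
  show "x \<in> ball 0 1 \<Longrightarrow> u l x = u l (norm x *\<^sub>R e)"
    using rad[unfolded radial_on_def, rule_format, of x "norm x *\<^sub>R e"] e by simp
  have "continuous_on (ball 0 1) (u l)"
    using C2 unfolding C2_closure_def
    by (meson continuous_on_subset closure_subset)
  then show "isCont (u l) 0" by (simp add: continuous_on_eq_continuous_at)
  show "x \<in> ball 0 1 \<Longrightarrow> u l x > 0" using pos .
qed

text \<open>Strict monotonicity of the branch replaces the usual spectral argument for the stability of
  minimal solutions: by convexity of \<open>exp\<close>, the difference of two branch elements is a positive
  supersolution of the equation linearised at the lower one.\<close>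

lemma branch_supersolution:
  fixes u :: "real \<Rightarrow> 'a::euclidean_space \<Rightarrow> real"
  assumes br: "extremal_branch a ls u" and l: "0 < l" "l < ls" and e: "e \<in> Basis"
    and a: "\<And>r. 0 \<le> r \<Longrightarrow> r \<le> 1 \<Longrightarrow> a r > 0"
  shows "\<exists>w w' k. radial_ode DIM('a) w w' k \<and> w 1 = 0 \<and> (\<forall>r. 0 \<le> r \<longrightarrow> r < 1 \<longrightarrow> w r > 0) \<and>
    (\<forall>r. 0 < r \<longrightarrow> r < 1 \<longrightarrow> l * a r * exp (u l (r *\<^sub>R e)) * w r \<le> k r)"
proof -
  \<comment> \<open>Any parameter strictly between l and ls would serve.\<close>
  define m where "m = (l + ls) / 2"
  have m: "0 < m" "m < ls" "l < m" using l by (auto simp: m_def)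
  obtain U' where U': "radial_ode DIM('a) (\<lambda>r. u l (r *\<^sub>R e)) U' (\<lambda>r. l * a r * exp (u l (r *\<^sub>R e)))"
    using branch_profile(1)[OF br l e] by blast
  obtain W' where W': "radial_ode DIM('a) (\<lambda>r. u m (r *\<^sub>R e)) W' (\<lambda>r. m * a r * exp (u m (r *\<^sub>R e)))"
    using branch_profile(1)[OF br m(1,2) e] by blast
  have pos: "u l (r *\<^sub>R e) < u m (r *\<^sub>R e)" if "0 \<le> r" "r < 1" for r
    using br l m that e unfolding extremal_branch_def by (auto simp: ball_def)
  have k: "l * a r * exp (u l (r *\<^sub>R e)) * (u m (r *\<^sub>R e) - u l (r *\<^sub>R e)) \<le>
      m * a r * exp (u m (r *\<^sub>R e)) - l * a r * exp (u l (r *\<^sub>R e))" if r: "0 < r" "r < 1" for r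
  proof -
    let ?x = "u l (r *\<^sub>R e)" and ?y = "u m (r *\<^sub>R e)"
    have la: "l * a r > 0" using a[of r] r l by simp
    have "exp ?x * (1 + (?y - ?x)) \<le> exp ?x * exp (?y - ?x)"
      by (intro mult_left_mono exp_ge_add_one_self) simp
    then have "exp ?x * (?y - ?x) \<le> exp ?y - exp ?x" by (simp add: algebra_simps flip: exp_add)
    then have "l * a r * (exp ?x * (?y - ?x)) \<le> l * a r * (exp ?y - exp ?x)"
      using la by (intro mult_left_mono) auto
    moreover have "l * a r * exp ?y \<le> m * a r * exp ?y"
      using m a[of r] r by (intro mult_right_mono) auto
    ultimately show ?thesis by (simp add: algebra_simps)
  qed
  have z: "u m e - u l e = 0" using branch_profile(2)[OF br l e] branch_profile(2)[OF br m(1,2) e] by simp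
  show ?thesis
    by (rule exI, rule exI, rule exI, rule conjI[OF radial_ode_diff[OF W' U']]) (use pos k z in auto)
qed

text \<open>Branch elements are positive and radially nonincreasing, so a uniform bound at the
  origin is a uniform bound on the ball and passes to the limit.\<close>

lemma branch_bounded_imp_L_infty:
  fixes u :: "real \<Rightarrow> 'a::euclidean_space \<Rightarrow> real"
  assumes br: "extremal_branch a ls u" and ex: "extremal_solution ls u us" and wk: "weak_solution a ls us"
    and a: "\<And>r. 0 \<le> r \<Longrightarrow> r \<le> 1 \<Longrightarrow> a r > 0" and dim: "DIM('a) \<ge> 2"
    and l0: "l0 < ls" and C: "\<And>l. l0 < l \<Longrightarrow> 0 < l \<Longrightarrow> l < ls \<Longrightarrow> u l 0 \<le> C"
  shows "L_infty_on (ball 0 1) us"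
proof -
  obtain e :: 'a where e: "e \<in> Basis" using nonempty_Basis by blast
  have ls: "0 < ls" using br by (simp add: extremal_branch_def)
  have ub: "0 \<le> u l x \<and> u l x \<le> C" if l: "l0 < l" "0 < l" "l < ls" and x: "x \<in> ball 0 1" for l x
  proof -
    obtain U' where U': "radial_ode DIM('a) (\<lambda>r. u l (r *\<^sub>R e)) U' (\<lambda>r. l * a r * exp (u l (r *\<^sub>R e)))"
      using branch_profile(1)[OF br l(2,3) e] by blast
    have "u l (norm x *\<^sub>R e) \<le> u l (0 *\<^sub>R e)"
      by (rule radial_ode_decreasing(2)[OF U' dim]) (use a l x in \<open>auto intro!: mult_nonneg_nonneg less_imp_le\<close>)
    then have "u l x \<le> u l 0" using branch_profile(3)[OF br l(2,3) e x] by simp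
    then show ?thesis using C[OF l] branch_profile(5)[OF br l(2,3) e x] by simp
  qed
  have lim: "AE x in lebesgue_on (ball 0 1). ((\<lambda>l. u l x) \<longlongrightarrow> us x) (at_left ls)"
    using ex unfolding extremal_solution_def .
  have "AE x in lebesgue_on (ball 0 1). \<bar>us x\<bar> \<le> C"
    using lim AE_space[of "lebesgue_on (ball 0 1)"]
  proof eventually_elim
    case (elim x)
    have x: "x \<in> ball 0 1" using elim by (simp add: space_restrict_space)
    have ev: "\<forall>\<^sub>F l in at_left ls. l0 < l \<and> 0 < l \<and> l < ls"
      using eventually_at_left_real[of "max l0 0" ls] l0 ls by (auto elim!: eventually_mono)
    have "0 \<le> us x"
      by (rule tendsto_lowerbound[OF elim(1)]) (use ev ub x in \<open>auto elim!: eventually_mono\<close>)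
    moreover have "us x \<le> C"
      by (rule tendsto_upperbound[OF elim(1)]) (use ev ub x in \<open>auto elim!: eventually_mono\<close>)
    ultimately show ?case by simp
  qed
  moreover have "us \<in> borel_measurable (lebesgue_on (ball 0 1))"
    using wk unfolding weak_solution_def by auto
  ultimately show ?thesis unfolding L_infty_on_def by blast
qed

text \<open>The branch increases to its limit, so a bound on the limit holds almost everywhere for
  each branch element and, by continuity, at the origin.\<close>

lemma branch_le_extremal:
  fixes u :: "real \<Rightarrow> 'a::euclidean_space \<Rightarrow> real"
  assumes br: "extremal_branch a ls u" and ex: "extremal_solution ls u us"
    and bd: "L_infty_on (ball 0 1) us"
  shows "\<exists>C. \<forall>l. 0 < l \<longrightarrow> l < ls \<longrightarrow> u l 0 \<le> C"
proof -
  obtain C where C: "AE x in lebesgue_on (ball 0 1). \<bar>us x\<bar> \<le> C"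
    using bd unfolding L_infty_on_def by blast
  obtain e :: 'a where e: "e \<in> Basis" using nonempty_Basis by blast
  have "u l 0 \<le> C" if l: "0 < l" "l < ls" for l
  proof (rule L_infty_on_le_at_point[OF _ branch_profile(4)[OF br l e]])
    show "AE x in lebesgue_on (ball 0 1). u l x \<le> C"
      using C ex[unfolded extremal_solution_def] AE_space[of "lebesgue_on (ball 0 1)"]
    proof eventually_elim
      case (elim x)
      have x: "x \<in> ball 0 1" using elim by (simp add: space_restrict_space)
      have "u l x \<le> us x"
      proof (rule tendsto_lowerbound[OF elim(2)])
        have "u l x \<le> u m x" if "l < m" "m < ls" for m
          using br l that x unfolding extremal_branch_def by (auto intro!: less_imp_le)
        then show "\<forall>\<^sub>F m in at_left ls. u l x \<le> u m x"
          using eventually_at_left_real[OF l(2)] by (auto elim!: eventually_mono)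
      qed simp
      then show ?case using elim(1) by simp
    qed
  qed
  then show ?thesis by blast
qed

lemma extremal_bounded_low_dim:
  fixes u :: "real \<Rightarrow> 'a::euclidean_space \<Rightarrow> real"
  assumes br: "extremal_branch a ls u" and ex: "extremal_solution ls u us" and wk: "weak_solution a ls us"
    and ca: "continuous_on {0..1} a" and a: "\<And>r. 0 \<le> r \<Longrightarrow> r \<le> 1 \<Longrightarrow> a r > 0"
    and dim: "3 \<le> DIM('a)" "DIM('a) \<le> 9"
  shows "L_infty_on (ball 0 1) us"
proof -
  obtain e :: 'a where e: "e \<in> Basis" using nonempty_Basis by blast
  have ls: "0 < ls" using br by (simp add: extremal_branch_def)
  have "\<exists>x\<in>{0..1}. \<forall>y\<in>{0..1}. a y \<le> a x"
    by (rule continuous_attains_sup) (use ca in auto)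
  then obtain xM where xM: "xM \<in> {0..1}" "\<And>y. y \<in> {0..1} \<Longrightarrow> a y \<le> a xM" by blast
  define K where "K = ls * a xM"
  show ?thesis
  proof (rule branch_bounded_imp_L_infty[OF br ex wk a _ ls])
    fix l assume l: "0 < l" "l < ls"
    obtain U' where U': "radial_ode DIM('a) (\<lambda>r. u l (r *\<^sub>R e)) U' (\<lambda>r. l * a r * exp (u l (r *\<^sub>R e)))"
      using branch_profile(1)[OF br l e] by blast
    obtain w w' k where w: "radial_ode DIM('a) w w' k" "w 1 = 0" "\<forall>r. 0 \<le> r \<longrightarrow> r < 1 \<longrightarrow> w r > 0"
      "\<forall>r. 0 < r \<longrightarrow> r < 1 \<longrightarrow> l * a r * exp (u l (r *\<^sub>R e)) * w r \<le> k r"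
      using branch_supersolution[OF br l e a] by blast
    have "u l (0 *\<^sub>R e) \<le> 1 + 10000000 * (K * exp 1)"
    proof (rule stable_bounded_low_dim[OF dim U' _ _ _ _ w(1)])
      show "continuous_on {0..1} (\<lambda>r. l * a r * exp (u l (r *\<^sub>R e)))"
        using radial_odeD(1)[OF U'] by (intro continuous_intros ca)
      show "0 \<le> K" using ls a[of xM] xM(1) by (simp add: K_def)
      show "u l (1 *\<^sub>R e) = 0" using branch_profile(2)[OF br l e] by simp
      fix r :: real assume r: "0 \<le> r" "r < 1"
      have "l * a r \<le> K" unfolding K_def using l xM(2)[of r] a[of r] r by (intro mult_mono) auto
      then show "0 \<le> l * a r * exp (u l (r *\<^sub>R e)) \<and> l * a r * exp (u l (r *\<^sub>R e)) \<le> K * exp (u l (r *\<^sub>R e))"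
        using l a[of r] r by (auto intro!: mult_right_mono)
    qed (use w in auto)
    then show "u l 0 \<le> 1 + 10000000 * (K * exp 1)" by simp
  qed (use dim in auto)
qed

context bessel_zero
begin

lemma extremal_bounded_dim_10:
  fixes u :: "real \<Rightarrow> 'a::euclidean_space \<Rightarrow> real"
  assumes br: "extremal_branch a ls u" and ex: "extremal_solution ls u us" and wk: "weak_solution a ls us"
    and ca: "continuous_on {0..1} a" and a: "\<And>r. 0 \<le> r \<Longrightarrow> r \<le> 1 \<Longrightarrow> a r > 0"
    and dim: "DIM('a) = 10"
    and b: "\<And>r. 0 < r \<Longrightarrow> r < 1 \<Longrightarrow> \<exists>D>0. ((\<lambda>s. a s / a_H H 10 s) has_real_derivative D) (at r)"
  shows "L_infty_on (ball 0 1) us"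
proof -
  obtain e :: 'a where e: "e \<in> Basis" using nonempty_Basis by blast
  have ls: "0 < ls" using br by (simp add: extremal_branch_def)
  define bb where "bb r = a r / a_H H 10 r" for r
  obtain D where D: "\<And>r. 0 < r \<Longrightarrow> r < 1 \<Longrightarrow> (bb has_real_derivative D r) (at r) \<and> D r > 0"
    using b unfolding bb_def[abs_def] by metis
  have bmono: "a r / a_H H 10 r < a s / a_H H 10 s" if "0 < r" "r < s" "s < 1" for r s
    using deriv_pos_mono[of 0 1 bb D, OF D that] by (simp add: bb_def)
  have bpos: "bb r > 0" if "0 < r" "r < 1" for r
    unfolding bb_def a_H_def using a[of r] that H_pos by (intro divide_pos_pos mult_pos_pos add_pos_nonneg) auto
  define Q where "Q l r = l * a r * exp (u l (r *\<^sub>R e))" for l r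
  have ode: "\<exists>U'. radial_ode 10 (\<lambda>r. u l (r *\<^sub>R e)) U' (Q l)" if "0 < l" "l < ls" for l
    using branch_profile(1)[OF br that e] unfolding dim Q_def[abs_def] .
  have Qfac: "Q l r = hardy_pot H r * (l / 16 * bb r * exp (log_sing H (\<lambda>r. u l (r *\<^sub>R e)) r))" if "0 < r" for l r
    unfolding Q_def bb_def using weight_factorisation[OF H_pos that] .
  \<comment> \<open>If Q exceeds V nowhere along the branch, the claim is immediate. Otherwise an
    excess \<delta> for one parameter l1 persists on [p, x0] for all larger l because the branch
    increases, so the radius \<rho> from \<open>supercritical_region_bound\<close> does not depend
    on l.\<close>
  have main: "\<exists>\<rho> l0. 0 < \<rho> \<and> \<rho> < 1 \<and> l0 < ls \<and>
      (\<forall>l r. 0 < l \<longrightarrow> l0 < l \<longrightarrow> l < ls \<longrightarrow> 0 < r \<longrightarrow> r < \<rho> \<longrightarrow> Q l r \<le> hardy_pot H r)"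
  proof (cases "\<forall>l r. 0 < l \<longrightarrow> l < ls \<longrightarrow> 0 < r \<longrightarrow> r < 1 \<longrightarrow> Q l r \<le> hardy_pot H r")
    case True
    then show ?thesis using ls by (intro exI[of _ "1/2"] exI[of _ 0]) auto
  next
    case False
    then obtain l1 x0 where l1: "0 < l1" "l1 < ls" and x0: "0 < x0" "x0 < 1" "hardy_pot H x0 < Q l1 x0"
      by (auto simp: not_le)
    define \<delta> where "\<delta> = (Q l1 x0 - hardy_pot H x0) / 2"
    have \<delta>: "\<delta> > 0" using x0 by (simp add: \<delta>_def)
    obtain U1 where U1: "radial_ode 10 (\<lambda>r. u l1 (r *\<^sub>R e)) U1 (Q l1)" using ode[OF l1] by blast
    define f where "f r = Q l1 r - hardy_pot H r" for r
    have "continuous_on {0<..<1} f"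
      unfolding f_def Q_def hardy_pot_def
      by (intro continuous_intros continuous_on_subset[OF ca] continuous_on_subset[OF radial_odeD(1)[OF U1]]) auto
    then have "isCont f x0" using x0 by (simp add: continuous_on_eq_continuous_at)
    then have "(f \<longlongrightarrow> f x0) (nhds x0)" by (simp add: isCont_def tendsto_at_iff_tendsto_nhds)
    moreover have "\<delta> < f x0" using \<delta> by (simp add: \<delta>_def f_def)
    ultimately have "\<forall>\<^sub>F r in nhds x0. \<delta> < Q l1 r - hardy_pot H r"
      unfolding f_def[symmetric] by (rule order_tendstoD(1))
    then obtain d where d: "d > 0" "\<And>r. \<bar>r - x0\<bar> < d \<Longrightarrow> \<delta> < Q l1 r - hardy_pot H r"
      by (auto simp: eventually_nhds_metric dist_real_def)
    define p where "p = max (x0 / 2) (x0 - d / 2)"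
    have p: "0 < p" "p < x0" "x0 - d / 2 \<le> p" using x0 d(1) by (auto simp: p_def)
    obtain \<rho> where rho: "0 < \<rho>" "\<rho> < 1" and reg: "\<And>w w' k Q r. radial_ode 10 w w' k \<Longrightarrow> w 1 = 0 \<Longrightarrow>
      (\<forall>x. 0 < x \<longrightarrow> x < 1 \<longrightarrow> w x > 0 \<and> Q x * w x \<le> k x) \<Longrightarrow>
      (\<forall>x. p \<le> x \<longrightarrow> x \<le> x0 \<longrightarrow> hardy_pot H x + \<delta> \<le> Q x) \<Longrightarrow>
      (\<forall>x. r < x \<longrightarrow> x < 1 \<longrightarrow> hardy_pot H x \<le> Q x) \<Longrightarrow> 0 < r \<Longrightarrow> \<rho> \<le> r"
      using supercritical_region_bound[OF p(1,2) x0(2) \<delta>] by blast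
    have "Q l r \<le> hardy_pot H r" if l: "0 < l" "l1 < l" "l < ls" and r: "0 < r" "r < \<rho>" for l r
    proof (rule ccontr)
      assume nle: "\<not> Q l r \<le> hardy_pot H r"
      obtain U' where U': "radial_ode 10 (\<lambda>r. u l (r *\<^sub>R e)) U' (Q l)" using ode[OF l(1,3)] by blast
      obtain w w' k where w: "radial_ode 10 w w' k" "w 1 = 0" "\<forall>r. 0 \<le> r \<longrightarrow> r < 1 \<longrightarrow> w r > 0"
        "\<forall>r. 0 < r \<longrightarrow> r < 1 \<longrightarrow> Q l r * w r \<le> k r"
        using branch_supersolution[OF br l(1,3) e a] unfolding dim Q_def by blast
      have lb: "l / 16 * bb x > 0" if "0 < x" "x < 1" for x using bpos[OF that] l(1) by simp
      \<comment> \<open>The subcritical set is an initial interval, so a point r with Q above V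
        excludes subcritical points to its right.\<close>
      have "hardy_pot H x \<le> Q l x" if x: "r < x" "x < 1" for x
      proof (rule ccontr)
        assume "\<not> hardy_pot H x \<le> Q l x"
        then have "Q l r < hardy_pot H r"
        proof (intro subcritical_initial_segment[where z="log_sing H (\<lambda>r. u l (r *\<^sub>R e))"
              and z'="log_sing1 H U'" and V="hardy_pot H" and \<beta>="\<lambda>r. ln (l / 16 * bb r)"
              and d="\<lambda>r. D r / bb r" and w=w and w'=w' and k=k and r=r and t=x])
          fix s :: real assume s: "0 < s" "s < 1"
          show "((\<lambda>r. ln (l / 16 * bb r)) has_real_derivative D s / bb s) (at s) \<and> 0 < D s / bb s"
            using D[OF s] bpos[OF s] lb[OF s] l(1)
            by (auto intro!: derivative_eq_intros simp: field_simps)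
          show "Q l s = hardy_pot H s * exp (ln (l / 16 * bb s) + log_sing H (\<lambda>r. u l (r *\<^sub>R e)) s)"
            unfolding exp_add exp_ln[OF lb[OF s]] using Qfac[OF s(1)] .
        qed (use log_sing_derivs[OF U'] log_sing_at_bot[OF U'] hardy_pot_pos[OF H_pos] w x r in auto)
        then show False using nle by simp
      qed
      moreover have "hardy_pot H x + \<delta> \<le> Q l x" if x: "p \<le> x" "x \<le> x0" for x
      proof -
        have "\<delta> < Q l1 x - hardy_pot H x" using d(2)[of x] x p d(1) by auto
        moreover have "Q l1 x \<le> Q l x"
        proof -
          have "u l1 (x *\<^sub>R e) < u l (x *\<^sub>R e)"
            using br l l1 x p x0 e unfolding extremal_branch_def by auto
          then show ?thesis unfolding Q_def using l l1 a[of x] x p x0 by (intro mult_mono) auto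
        qed
        ultimately show ?thesis by linarith
      qed
      ultimately have "\<rho> \<le> r" using reg[of w w' k "Q l" r] w r by auto
      then show False using r by simp
    qed
    then show ?thesis using rho l1 by (intro exI[of _ \<rho>] exI[of _ l1]) auto
  qed
  then obtain \<rho> l0 where rho: "0 < \<rho>" "\<rho> < 1" "l0 < ls"
    and sub: "\<And>l r. 0 < l \<Longrightarrow> l0 < l \<Longrightarrow> l < ls \<Longrightarrow> 0 < r \<Longrightarrow> r < \<rho> \<Longrightarrow> Q l r \<le> hardy_pot H r" by blast
  have "ls / 2 > 0" using ls by simp
  from bounded_if_subcritical[OF H_pos ca a bmono rho(1,2) this]
  obtain C where C: "\<And>l u u'. ls / 2 \<le> l \<Longrightarrow> radial_ode 10 u u' (\<lambda>r. l * a r * exp (u r)) \<Longrightarrow>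
    (\<forall>r. 0 < r \<longrightarrow> r < \<rho> \<longrightarrow> l * a r * exp (u r) \<le> hardy_pot H r) \<Longrightarrow> u 0 \<le> C" by blast
  show ?thesis
  proof (rule branch_bounded_imp_L_infty[OF br ex wk a])
    show "max l0 (ls / 2) < ls" using rho ls by simp
    fix l assume l: "max l0 (ls / 2) < l" "0 < l" "l < ls"
    obtain U' where U': "radial_ode 10 (\<lambda>r. u l (r *\<^sub>R e)) U' (Q l)" using ode[OF l(2,3)] by blast
    have "u l (0 *\<^sub>R e) \<le> C"
      by (rule C[of l "\<lambda>r. u l (r *\<^sub>R e)" U']) (use l U' sub in \<open>auto simp: Q_def[abs_def]\<close>)
    then show "u l 0 \<le> C" by simp
  qed (use dim in auto)
qed

text \<open>After the shift by \<open>ln l\<close> all branch elements solve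
  \<open>- \<Delta> v = a * exp v\<close>, and such solutions are ordered by their values at the
  origin. A bounded limit bounds these values, so shooting from above all of them reaches a
  parameter beyond ls, where no weak solution exists.\<close>

lemma extremal_singular_dim_10:
  fixes u :: "real \<Rightarrow> 'a::euclidean_space \<Rightarrow> real"
  assumes br: "extremal_branch a ls u" and ex: "extremal_solution ls u us"
    and ca: "continuous_on {0..1} a" and a: "\<And>r. 0 \<le> r \<Longrightarrow> r \<le> 1 \<Longrightarrow> a r > 0"
    and dim: "DIM('a) = 10"
    and b: "\<And>r. 0 < r \<Longrightarrow> r < 1 \<Longrightarrow> \<exists>D\<le>0. ((\<lambda>s. a s / a_H H 10 s) has_real_derivative D) (at r)"
  shows "\<not> L_infty_on (ball 0 1) us"
proof
  assume bd: "L_infty_on (ball 0 1) us"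
  obtain e :: 'a where e: "e \<in> Basis" using nonempty_Basis by blast
  have ls: "0 < ls" using br by (simp add: extremal_branch_def)
  obtain C where C: "\<And>l. 0 < l \<Longrightarrow> l < ls \<Longrightarrow> u l 0 \<le> C"
    using branch_le_extremal[OF br ex bd] by blast
  define bb where "bb r = a r / a_H H 10 r" for r
  obtain D where D: "\<And>r. 0 < r \<Longrightarrow> r < 1 \<Longrightarrow> (bb has_real_derivative D r) (at r) \<and> D r \<le> 0"
    using b unfolding bb_def[abs_def] by metis
  have bmono: "bb s \<le> bb r" if "0 < r" "r \<le> s" "s < 1" for r s
    using deriv_nonneg_mono[of 0 1 "\<lambda>r. - bb r" "\<lambda>r. - D r" r s] D that by (auto intro: DERIV_minus)
  have bpos: "bb r > 0" if "0 < r" "r < 1" for r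
    unfolding bb_def a_H_def using a[of r] that H_pos by (intro divide_pos_pos mult_pos_pos add_pos_nonneg) auto
  have bcont: "continuous_on {0<..<1} bb"
    using D by (intro continuous_at_imp_continuous_on ballI) (auto intro: DERIV_isCont)
  have sub: "a r * exp (v r) < hardy_pot H r"
    if v: "radial_ode 10 v v' (\<lambda>r. a r * exp (v r))" and r: "0 < r" "r < 1" for v v' r
  proof -
    have "continuous_on {0..1} (\<lambda>r. a r * exp (v r))" by (intro continuous_intros ca radial_odeD(1)[OF v])
    then have "bounded ((\<lambda>r. a r * exp (v r)) ` {0..1})"
      by (intro compact_imp_bounded compact_continuous_image) auto
    then obtain B where B: "\<forall>r\<in>{0..1}. \<bar>a r * exp (v r)\<bar> \<le> B" by (auto simp: bounded_iff)
    show ?thesis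
    proof (rule shooting_subcritical[OF v, where \<beta>="\<lambda>r. ln (1 / 16 * bb r)" and B=B])
      fix s assume s: "0 < s" "s < (1::real)"
      have lb: "1 / 16 * bb s > 0" using bpos[OF s] by simp
      show "a s * exp (v s) = hardy_pot H s * exp (ln (1 / 16 * bb s) + log_sing H v s)"
        unfolding exp_add exp_ln[OF lb] using weight_factorisation[OF H_pos s(1), of 1 a v] by (simp add: bb_def)
      show "a s * exp (v s) \<le> B" using bspec[OF B, of s] s by auto
    next
      show "continuous_on {0<..<1} (\<lambda>r. ln (1 / 16 * bb r))"
        by (intro continuous_intros bcont) (use bpos in force)
      show "ln (1 / 16 * bb s) \<le> ln (1 / 16 * bb r)" if "0 < r" "r \<le> s" "s < 1" for r s
        using bmono[OF that] bpos[of r] bpos[of s] that by simp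
    qed (use r in auto)
  qed
  have shoot: "\<exists>v v'. radial_ode 10 v v' (\<lambda>r. a r * exp (v r)) \<and> v 0 = \<alpha> \<and>
      weak_solution a (exp (v 1)) (\<lambda>x::'a. v (norm x) - v 1)" for \<alpha>
  proof -
    have "\<exists>v p. continuous_on {0..1} v \<and> continuous_on {0..1} p \<and> v 0 = \<alpha> \<and>
        p 0 = - (a 0 * exp (v 0)) / real 10 \<and>
        (\<forall>r. 0 < r \<longrightarrow> r < 1 \<longrightarrow> (v has_real_derivative r * p r) (at r) \<and>
          (p has_real_derivative - (a r * exp (v r) + real 10 * p r) / r) (at r))"
      by (rule shooting_exists[OF _ ca]) (use a in \<open>auto intro: less_imp_le\<close>)
    then obtain v p where v: "continuous_on {0..1} v" "continuous_on {0..1} p" "v 0 = \<alpha>"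
      "\<And>r. 0 < r \<Longrightarrow> r < 1 \<Longrightarrow> (v has_real_derivative r * p r) (at r)"
      "\<And>r. 0 < r \<Longrightarrow> r < 1 \<Longrightarrow> (p has_real_derivative - (a r * exp (v r) + real 10 * p r) / r) (at r)"
      by blast
    have "radial_ode 10 v (\<lambda>r. r * p r) (\<lambda>r. a r * exp (v r))"
      by (rule shooting_radial_ode[OF v(1,2,4,5)])
    moreover have "weak_solution a (exp (v 1)) (\<lambda>x::'a. v (norm x) - v 1)"
      by (rule shooting_weak_solution[OF ca v(1,2,4)]) (use v(5) dim in auto)
    ultimately show ?thesis using v(3) by blast
  qed
  \<comment> \<open>A bounds \<open>u l 0 + ln l\<close> along the whole branch. Shooting from A + 1
    yields only \<open>exp (v1 1) \<ge> ls\<close>, by letting l approach ls; the second shot from A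
    + 2 makes the inequality strict.\<close>
  define A where "A = C + ln ls"
  obtain v1 v1' where v1: "radial_ode 10 v1 v1' (\<lambda>r. a r * exp (v1 r))" "v1 0 = A + 1"
    using shoot[of "A + 1"] by blast
  obtain v2 v2' where v2: "radial_ode 10 v2 v2' (\<lambda>r. a r * exp (v2 r))" "v2 0 = A + 2"
    and weak: "weak_solution a (exp (v2 1)) (\<lambda>x::'a. v2 (norm x) - v2 1)"
    using shoot[of "A + 2"] by blast
  have a': "a r > 0" if "0 < r" "r < 1" for r using a that by simp
  have "v1 1 < v2 1" by (rule shooting_ordered[OF v1(1) v2(1) a' sub[OF v2(1)]]) (use v1 v2 in auto)
  moreover have "ls \<le> exp (v1 1)"
  proof (rule dense_le_bounded[OF ls])
    fix l assume l: "0 < l" "l < ls"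
    obtain U' where U': "radial_ode 10 (\<lambda>r. u l (r *\<^sub>R e)) U' (\<lambda>r. l * a r * exp (u l (r *\<^sub>R e)))"
      using branch_profile(1)[OF br l e] dim by auto
    have "radial_ode 10 (\<lambda>r. u l (r *\<^sub>R e) + ln l) U' (\<lambda>r. a r * exp (u l (r *\<^sub>R e) + ln l))"
      by (rule radial_ode_cong[OF radial_ode_add_const[OF U']]) (use l in \<open>simp add: exp_add\<close>)
    then have "u l (1 *\<^sub>R e) + ln l < v1 1"
    proof (rule shooting_ordered[OF _ v1(1) a' sub[OF v1(1)]])
      have "ln l < ln ls" using l by simp
      then show "u l (0 *\<^sub>R e) + ln l < v1 0" using C[OF l] v1(2) by (simp add: A_def)
    qed auto
    then have "exp (ln l) < exp (v1 1)" using branch_profile(2)[OF br l e] by simp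
    then show "l \<le> exp (v1 1)" using l by simp
  qed
  ultimately have "ls < exp (v2 1)" by (meson exp_less_mono le_less_trans)
  then show False using br weak unfolding extremal_branch_def by blast
qed

end

theorem corollary1p6:
  fixes a :: "real \<Rightarrow> real"
    and H lambda_star :: real
    and u :: "real \<Rightarrow> real ^ 'n \<Rightarrow> real"
    and u_star :: "real ^ 'n \<Rightarrow> real"
  assumes "3 \<le> CARD('n)" and "CARD('n) \<le> 10"
    and "C2_closure (ball 0 1) (\<lambda>x::real ^ 'n. a (norm x))"
    and "\<forall>r\<in>{0..1}. a r > 0"
    and "a 0 = 1"
    and "first_dirichlet_eigenvalue (ball 0 1 :: (real ^ 2) set) H"
    and "extremal_branch a lambda_star u"
    and "extremal_solution lambda_star u u_star"
    and "weak_solution a lambda_star u_star"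
  shows
    "(CARD('n) \<le> 9 \<longrightarrow> L_infty_on (ball 0 1) u_star) \<and>
     (CARD('n) = 10 \<and>
        (\<forall>r\<in>{0<..1}. \<exists>D\<le>0.
          ((\<lambda>s. a s / a_H H CARD('n) s) has_real_derivative D) (at r within {0..1}))
        \<longrightarrow> \<not> L_infty_on (ball 0 1) u_star) \<and>
     (CARD('n) = 10 \<and>
        (\<forall>r\<in>{0<..1}. \<exists>D>0.
          ((\<lambda>s. a s / a_H H CARD('n) s) has_real_derivative D) (at r within {0..1}))
        \<longrightarrow> L_infty_on (ball 0 1) u_star)"
proof -
  interpret bessel_zero H
    using first_dirichlet_eigenvalue_bessel[OF assms(6)] by unfold_locales
  have a: "a r > 0" if "0 \<le> r" "r \<le> 1" for r using assms(4) that by simp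
  obtain e :: "real ^ 'n" where e: "e \<in> Basis" using nonempty_Basis by blast
  have "continuous_on (cball 0 1) (\<lambda>x::real ^ 'n. a (norm x))"
    using assms(3) unfolding C2_closure_def closure_ball[OF zero_less_one] by blast
  then have "continuous_on {0..1} (\<lambda>r. a (norm (r *\<^sub>R e)))"
    by (rule continuous_on_compose2) (use e in \<open>auto intro!: continuous_intros\<close>)
  then have ca: "continuous_on {0..1} a"
    by (rule continuous_on_eq) (use e in auto)
  show ?thesis
  proof (intro conjI impI)
    assume "CARD('n) \<le> 9"
    then show "L_infty_on (ball 0 1) u_star"
      by (intro extremal_bounded_low_dim[OF assms(7,8,9) ca a]) (use assms(1) in simp_all)
  next
    assume h: "CARD('n) = 10 \<and> (\<forall>r\<in>{0<..1}. \<exists>D\<le>0.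
          ((\<lambda>s. a s / a_H H CARD('n) s) has_real_derivative D) (at r within {0..1}))"
    show "\<not> L_infty_on (ball 0 1) u_star"
    proof (rule extremal_singular_dim_10[OF assms(7,8) ca a])
      fix r :: real assume "0 < r" "r < 1"
      then show "\<exists>D\<le>0. ((\<lambda>s. a s / a_H H 10 s) has_real_derivative D) (at r)"
        using conjunct2[OF h, rule_format, of r] conjunct1[OF h] by (simp add: at_within_Icc_at)
    qed (use h in simp_all)
  next
    assume h: "CARD('n) = 10 \<and> (\<forall>r\<in>{0<..1}. \<exists>D>0.
          ((\<lambda>s. a s / a_H H CARD('n) s) has_real_derivative D) (at r within {0..1}))"
    show "L_infty_on (ball 0 1) u_star"
    proof (rule extremal_bounded_dim_10[OF assms(7,8,9) ca a])
      fix r :: real assume "0 < r" "r < 1"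
      then show "\<exists>D>0. ((\<lambda>s. a s / a_H H 10 s) has_real_derivative D) (at r)"
        using conjunct2[OF h, rule_format, of r] conjunct1[OF h] by (simp add: at_within_Icc_at)
    qed (use h in simp_all)
  qed
qed

end
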